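(* Let $B$ be a ring of prime characteristic $p$, $D$ a derivation of $B$, and let $f=X^{p^e}+X^{p^{e-1}}b_e+\cdots+X^pb_{2}+Xb_1+b_0$ ($e\ge 1$) be in $B[X;D]_{(0)}$. (1) $f$ is weakly separable in $B[X;D]$ if and only if the following sequence of $V^{\tilde D}$-$V^{\tilde D}$-homomorphisms is exact: $$0\longrightarrow V^{\tilde D}\overset{\mathrm{inj}}{\longrightarrow}V\overset{\tilde D}{\longrightarrow}V\overset{\tau}{\longrightarrow}V^{\tilde D}.$$ (2) $f$ is separable in $B[X;D]$ if and only if the following sequence of $V^{\tilde D}$-$V^{\tilde D}$-homomorphisms is exact: $$0\longrightarrow V^{\tilde D}\overset{\mathrm{inj}}{\longrightarrow}V\overset{\tilde D}{\longrightarrow}V\overset{\tau}{\longrightarrow}V^{\tilde D}\longrightarrow 0.$$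
   Context: Rings are associative with identity, not necessarily commutative. A derivation of $B$ is an additive map $D:B\to B$ with $D(\alpha\beta)=D(\alpha)\beta+\alpha D(\beta)$. $B[X;D]$ is the skew polynomial ring whose elements are $\sum_jX^jc_j$ ($c_j\in B$), with multiplication determined by $\alpha X=X\alpha+D(\alpha)$ for $\alpha\in B$. $B[X;D]_{(0)}$ is the set of all monic $g\in B[X;D]$ with $gB[X;D]=B[X;D]g$. Put $b_{e+1}=1$, so $f=\sum_{j=0}^{e}X^{p^j}b_{j+1}+b_0$. Set $A=B[X;D]/fB[X;D]$, a ring extension of $B$ that is free with basis $1,x,\dots,x^{p^e-1}$, where $x=X+fB[X;D]$. For such $f\in B[X;D]_{(0)}$ the coefficients of $f$ are all killed by $D$, so $D$ induces a derivation $\tilde D$ of $A$ given by $\tilde D(\sum_{j=0}^{p^e-1}x^jc_j)=\sum_{j=0}^{p^e-1}x^jD(c_j)$. Let $V=V_A(B)$ be the centralizer of $B$ in $A$ and $V^{\tilde D}=\{v\in V\mid\tilde D(v)=0\}$. The map $\tau:V\to V^{\tilde D}$ is the $V^{\tilde D}$-$V^{\tilde D}$-homomorphism $$\tau(h)=\sum_{j=0}^{e}\tilde D^{\,p^j-1}(h)\,b_{j+1}=\tilde D^{\,p^e-1}(h)+\tilde D^{\,p^{e-1}-1}(h)b_e+\cdots+\tilde D^{\,p-1}(h)b_2+hb_1.$$ The map "inj" is the inclusion, and $\tilde D:V\to V$ is the restriction of $\tilde D$ to $V$. A ring extension $A/B$ is separable if the $A$-$A$-homomorphism $A\otimes_BA\to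 A$, $a\otimes b\mapsto ab$, splits (as a homomorphism of $A$-$A$-bimodules). A $B$-derivation of $A$ is an additive map $\delta:A\to A$ with $\delta(yz)=\delta(y)z+y\delta(z)$ for all $y,z\in A$ and $\delta(\alpha)=0$ for all $\alpha\in B$; it is inner if there is $u\in A$ with $\delta(y)=uy-yu$ for all $y\in A$. $A/B$ is weakly separable if every $B$-derivation of $A$ to $A$ is inner. The polynomial $f$ is separable (resp. weakly separable) in $B[X;D]$ if $A=B[X;D]/fB[X;D]$ is separable (resp. weakly separable) over $B$. *)

theory Defs
  imports "HOL-Algebra.Algebra"
begin

section \<open>Rings and derivations\<close>

text \<open>The additive order of one; it is 0 if no positive multiple of one vanishes.\<close>

definition ring_char :: "('a, 'm) ring_scheme \<Rightarrow> nat"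
  where "ring_char R = group.ord (add_monoid R) \<one>\<^bsub>R\<^esub>"

definition ring_derivation :: "('a, 'm) ring_scheme \<Rightarrow> ('a \<Rightarrow> 'a) \<Rightarrow> bool"
  where "ring_derivation R d \<longleftrightarrow>
    d \<in> carrier R \<rightarrow> carrier R \<and>
    (\<forall>y\<in>carrier R. \<forall>z\<in>carrier R. d (y \<oplus>\<^bsub>R\<^esub> z) = d y \<oplus>\<^bsub>R\<^esub> d z) \<and>
    (\<forall>y\<in>carrier R. \<forall>z\<in>carrier R.
      d (y \<otimes>\<^bsub>R\<^esub> z) = d y \<otimes>\<^bsub>R\<^esub> z \<oplus>\<^bsub>R\<^esub> y \<otimes>\<^bsub>R\<^esub> d z)"

definition centralizer_in :: "('a, 'm) ring_scheme \<Rightarrow> 'a set \<Rightarrow> 'a set"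
  where "centralizer_in A K = {v \<in> carrier A. \<forall>k\<in>K. k \<otimes>\<^bsub>A\<^esub> v = v \<otimes>\<^bsub>A\<^esub> k}"


section \<open>Bimodules and exact sequences\<close>

text \<open>The underlying additive group is written multiplicatively, as is customary for the groups
  of the library (quotient groups, free Abelian groups, exact sequences).\<close>

record ('r, 'm) bimodule = "'m monoid" +
  lact :: "'r \<Rightarrow> 'm \<Rightarrow> 'm"
  ract :: "'m \<Rightarrow> 'r \<Rightarrow> 'm"

definition bimodule_hom ::
    "'r set \<Rightarrow> ('r, 'm, 'c) bimodule_scheme \<Rightarrow> ('r, 'n, 'd) bimodule_scheme \<Rightarrow> ('m \<Rightarrow> 'n) set"
  where "bimodule_hom S M N = {\<phi> \<in> hom M N. \<forall>s\<in>S. \<forall>m\<in>carrier M.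
    \<phi> (lact M s m) = lact N s (\<phi> m) \<and> \<phi> (ract M m s) = ract N (\<phi> m) s}"

definition sub_bimodule :: "('a, 'm) ring_scheme \<Rightarrow> 'a set \<Rightarrow> ('a, 'a) bimodule"
  where "sub_bimodule A M = \<lparr>carrier = M, monoid.mult = add A, one = \<zero>\<^bsub>A\<^esub>,
    lact = (\<otimes>\<^bsub>A\<^esub>), ract = (\<otimes>\<^bsub>A\<^esub>)\<rparr>"

text \<open>As for \<^const>\<open>exact_seq\<close>, the objects and the maps are listed from right to left.\<close>

definition exact_bimodule_seq ::
    "'r set \<Rightarrow> ('r, 'm) bimodule list \<Rightarrow> ('m \<Rightarrow> 'm) list \<Rightarrow> bool"
  where "exact_bimodule_seq S Ms \<phi>s \<longleftrightarrow>
    exact_seq (map monoid.truncate Ms, \<phi>s) \<and>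
    (\<forall>i<length \<phi>s. \<phi>s ! i \<in> bimodule_hom S (Ms ! Suc i) (Ms ! i))"


section \<open>Separable and weakly separable ring extensions\<close>

text \<open>A ring extension is a ring \<open>A\<close> with a subring \<open>K\<close>.  The tensor product of \<open>A\<close> with itself
  over \<open>K\<close> is the free Abelian group on pairs modulo the usual relations.\<close>

definition tensor_rel :: "('a, 'm) ring_scheme \<Rightarrow> 'a set \<Rightarrow> ('a \<times> 'a \<Rightarrow>\<^sub>0 int) set"
  where "tensor_rel A K =
    {frag_of (a \<oplus>\<^bsub>A\<^esub> a', c) - frag_of (a, c) - frag_of (a', c) | a a' c.
      a \<in> carrier A \<and> a' \<in> carrier A \<and> c \<in> carrier A} \<union>
    {frag_of (a, c \<oplus>\<^bsub>A\<^esub> c') - frag_of (a, c) - frag_of (a, c') | a c c'.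
      a \<in> carrier A \<and> c \<in> carrier A \<and> c' \<in> carrier A} \<union>
    {frag_of (a \<otimes>\<^bsub>A\<^esub> k, c) - frag_of (a, k \<otimes>\<^bsub>A\<^esub> c) | a k c.
      a \<in> carrier A \<and> k \<in> K \<and> c \<in> carrier A}"

definition tensor_free :: "('a, 'm) ring_scheme \<Rightarrow> ('a \<times> 'a \<Rightarrow>\<^sub>0 int) monoid"
  where "tensor_free A = free_Abelian_group (carrier A \<times> carrier A)"

definition tensor_null :: "('a, 'm) ring_scheme \<Rightarrow> 'a set \<Rightarrow> ('a \<times> 'a \<Rightarrow>\<^sub>0 int) set"
  where "tensor_null A K = generate (tensor_free A) (tensor_rel A K)"

text \<open>The actions are \<open>y (a \<otimes> c) = (y a) \<otimes> c\<close> and \<open>(a \<otimes> c) y = a \<otimes> (c y)\<close>.  These maps and the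
  multiplication map below are induced from maps on the free Abelian group that respect the
  relations, so they are constant on each coset and \<^const>\<open>the_elem\<close> picks their value.\<close>

definition tensor_bimodule ::
    "('a, 'm) ring_scheme \<Rightarrow> 'a set \<Rightarrow> ('a, ('a \<times> 'a \<Rightarrow>\<^sub>0 int) set) bimodule"
  where "tensor_bimodule A K =
    (let F = tensor_free A; N = tensor_null A K in
      \<lparr>carrier = carrier (F Mod N), monoid.mult = monoid.mult (F Mod N), one = one (F Mod N),
       lact = (\<lambda>y C. the_elem
         ((\<lambda>t. N #>\<^bsub>F\<^esub> frag_extend (\<lambda>(a, c). frag_of (y \<otimes>\<^bsub>A\<^esub> a, c)) t) ` C)),
       ract = (\<lambda>C y. the_elem
         ((\<lambda>t. N #>\<^bsub>F\<^esub> frag_extend (\<lambda>(a, c). frag_of (a, c \<otimes>\<^bsub>A\<^esub> y)) t) ` C))\<rparr>)"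

definition tensor_mult :: "('a, 'm) ring_scheme \<Rightarrow> ('a \<times> 'a \<Rightarrow>\<^sub>0 int) set \<Rightarrow> 'a"
  where "tensor_mult A C = the_elem
    ((\<lambda>t. \<Oplus>\<^bsub>A\<^esub>s\<in>Poly_Mapping.keys t. [Poly_Mapping.lookup t s] \<cdot>\<^bsub>A\<^esub> (fst s \<otimes>\<^bsub>A\<^esub> snd s)) ` C)"

definition separable_ext :: "('a, 'm) ring_scheme \<Rightarrow> 'a set \<Rightarrow> bool"
  where "separable_ext A K \<longleftrightarrow>
    (\<exists>\<sigma>\<in>bimodule_hom (carrier A) (sub_bimodule A (carrier A)) (tensor_bimodule A K).
      \<forall>z\<in>carrier A. tensor_mult A (\<sigma> z) = z)"

definition weakly_separable_ext :: "('a, 'm) ring_scheme \<Rightarrow> 'a set \<Rightarrow> bool"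
  where "weakly_separable_ext A K \<longleftrightarrow>
    (\<forall>\<delta>. ring_derivation A \<delta> \<and> (\<forall>k\<in>K. \<delta> k = \<zero>\<^bsub>A\<^esub>) \<longrightarrow>
      (\<exists>u\<in>carrier A. \<forall>y\<in>carrier A. \<delta> y = u \<otimes>\<^bsub>A\<^esub> y \<ominus>\<^bsub>A\<^esub> y \<otimes>\<^bsub>A\<^esub> u))"


section \<open>Skew polynomials\<close>

text \<open>The sequence \<open>g\<close> stands for the sum of the \<open>X\<^sup>j g\<^sub>j\<close>, coefficients being on the right.
  Since \<open>\<alpha> X = X \<alpha> + D \<alpha>\<close>, right multiplication by \<open>X\<close> sends the sum of the \<open>X\<^sup>j g\<^sub>j\<close> to the sum
  of the \<open>X\<^sup>j\<^sup>+\<^sup>1 g\<^sub>j + X\<^sup>j D(g\<^sub>j)\<close>.  The product of \<open>g\<close> and \<open>h\<close> is then the sum of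
  the \<open>(g X\<^sup>j) h\<^sub>j\<close>.\<close>

definition skew_timesX ::
    "('a, 'm) ring_scheme \<Rightarrow> ('a \<Rightarrow> 'a) \<Rightarrow> (nat \<Rightarrow> 'a) \<Rightarrow> nat \<Rightarrow> 'a"
  where "skew_timesX B D g n = (if n = 0 then \<zero>\<^bsub>B\<^esub> else g (n - 1)) \<oplus>\<^bsub>B\<^esub> D (g n)"

definition skew_const :: "('a, 'm) ring_scheme \<Rightarrow> 'a \<Rightarrow> nat \<Rightarrow> 'a"
  where "skew_const B a = (\<lambda>n. if n = 0 then a else \<zero>\<^bsub>B\<^esub>)"

definition skew_X :: "('a, 'm) ring_scheme \<Rightarrow> nat \<Rightarrow> 'a"
  where "skew_X B = (\<lambda>n. if n = 1 then \<one>\<^bsub>B\<^esub> else \<zero>\<^bsub>B\<^esub>)"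

definition skew_poly :: "('a, 'm) ring_scheme \<Rightarrow> ('a \<Rightarrow> 'a) \<Rightarrow> (nat \<Rightarrow> 'a) ring"
  where "skew_poly B D =
    \<lparr>carrier = up B,
     monoid.mult = (\<lambda>g h n. \<Oplus>\<^bsub>B\<^esub>j\<in>{j. h j \<noteq> \<zero>\<^bsub>B\<^esub>}. (skew_timesX B D ^^ j) g n \<otimes>\<^bsub>B\<^esub> h j),
     one = skew_const B \<one>\<^bsub>B\<^esub>,
     ring.zero = (\<lambda>n. \<zero>\<^bsub>B\<^esub>),
     ring.add = (\<lambda>g h n. g n \<oplus>\<^bsub>B\<^esub> h n)\<rparr>"

definition monic_normal :: "('a, 'm) ring_scheme \<Rightarrow> ('a \<Rightarrow> 'a) \<Rightarrow> (nat \<Rightarrow> 'a) set"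
  where "monic_normal B D =
    {g \<in> carrier (skew_poly B D). g (deg B g) = \<one>\<^bsub>B\<^esub> \<and>
      g <#\<^bsub>skew_poly B D\<^esub> carrier (skew_poly B D) = carrier (skew_poly B D) #>\<^bsub>skew_poly B D\<^esub> g}"


section \<open>The quotient by a skew polynomial\<close>

definition skew_ideal :: "('a, 'm) ring_scheme \<Rightarrow> ('a \<Rightarrow> 'a) \<Rightarrow> (nat \<Rightarrow> 'a) \<Rightarrow> (nat \<Rightarrow> 'a) set"
  where "skew_ideal B D f = f <#\<^bsub>skew_poly B D\<^esub> carrier (skew_poly B D)"

definition skew_quot :: "('a, 'm) ring_scheme \<Rightarrow> ('a \<Rightarrow> 'a) \<Rightarrow> (nat \<Rightarrow> 'a) \<Rightarrow> (nat \<Rightarrow> 'a) set ring"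
  where "skew_quot B D f = skew_poly B D Quot skew_ideal B D f"

definition quot_x :: "('a, 'm) ring_scheme \<Rightarrow> ('a \<Rightarrow> 'a) \<Rightarrow> (nat \<Rightarrow> 'a) \<Rightarrow> (nat \<Rightarrow> 'a) set"
  where "quot_x B D f = skew_ideal B D f +>\<^bsub>skew_poly B D\<^esub> skew_X B"

definition quot_const ::
    "('a, 'm) ring_scheme \<Rightarrow> ('a \<Rightarrow> 'a) \<Rightarrow> (nat \<Rightarrow> 'a) \<Rightarrow> 'a \<Rightarrow> (nat \<Rightarrow> 'a) set"
  where "quot_const B D f a = skew_ideal B D f +>\<^bsub>skew_poly B D\<^esub> skew_const B a"

definition quot_base ::
    "('a, 'm) ring_scheme \<Rightarrow> ('a \<Rightarrow> 'a) \<Rightarrow> (nat \<Rightarrow> 'a) \<Rightarrow> (nat \<Rightarrow> 'a) set set"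
  where "quot_base B D f = quot_const B D f ` carrier B"

definition quot_sum ::
    "('a, 'm) ring_scheme \<Rightarrow> ('a \<Rightarrow> 'a) \<Rightarrow> (nat \<Rightarrow> 'a) \<Rightarrow> nat \<Rightarrow> (nat \<Rightarrow> 'a) \<Rightarrow> (nat \<Rightarrow> 'a) set"
  where "quot_sum B D f n c = (\<Oplus>\<^bsub>skew_quot B D f\<^esub>j\<in>{..<n}.
    quot_x B D f [^]\<^bsub>skew_quot B D f\<^esub> j \<otimes>\<^bsub>skew_quot B D f\<^esub> quot_const B D f (c j))"

text \<open>Here \<open>n\<close> is the degree of \<open>f\<close>, so that an element of the quotient has a unique expansion.\<close>

definition induced_derivation ::
    "('a, 'm) ring_scheme \<Rightarrow> ('a \<Rightarrow> 'a) \<Rightarrow> (nat \<Rightarrow> 'a) \<Rightarrow> nat \<Rightarrow> (nat \<Rightarrow> 'a) set \<Rightarrow> (nat \<Rightarrow> 'a) set"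
  where "induced_derivation B D f n y =
    (THE z. \<exists>c\<in>{..<n} \<rightarrow> carrier B. y = quot_sum B D f n c \<and> z = quot_sum B D f n (\<lambda>j. D (c j)))"

definition separable_poly :: "('a, 'm) ring_scheme \<Rightarrow> ('a \<Rightarrow> 'a) \<Rightarrow> (nat \<Rightarrow> 'a) \<Rightarrow> bool"
  where "separable_poly B D f \<longleftrightarrow> separable_ext (skew_quot B D f) (quot_base B D f)"

definition weakly_separable_poly :: "('a, 'm) ring_scheme \<Rightarrow> ('a \<Rightarrow> 'a) \<Rightarrow> (nat \<Rightarrow> 'a) \<Rightarrow> bool"
  where "weakly_separable_poly B D f \<longleftrightarrow> weakly_separable_ext (skew_quot B D f) (quot_base B D f)"

end

theory Submission
  imports Defs
begin

text \<open>Let \<open>A\<close> be the quotient of the skew polynomial ring by \<open>f\<close>, let \<open>K\<close> be the image of \<open>B\<close>, let \<open>x\<close>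
  be the class of \<open>X\<close>, and let \<open>\<beta>\<^sub>j\<close> be the image of \<open>b\<^sub>j\<close>, so that \<open>\<beta>\<^sub>e\<^sub>+\<^sub>1 = 1\<close>.  From \<open>\<alpha> X = X \<alpha> + D \<alpha>\<close> one sees that the
  induced derivation of \<open>A\<close> is the commutator \<open>y \<mapsto> y x - x y\<close>.  Everything follows from the study
  of this commutator, and it pays to study it on an arbitrary \<open>A\<close>-\<open>A\<close>-bimodule \<open>M\<close>, as \<open>ad m = m x - x m\<close>.

  Left and right multiplication by \<open>x\<close> commute, so in characteristic \<open>p\<close>, with \<open>q = p\<^sup>j\<close>, the power \<open>ad\<^sup>q\<close>
  sends \<open>m\<close> to \<open>m x\<^sup>q - x\<^sup>q m\<close>, and \<open>ad\<^sup>q\<^sup>-\<^sup>1\<close> sends \<open>m\<close> to the sum of all \<open>x\<^sup>i m x\<^sup>q\<^sup>-\<^sup>1\<^sup>-\<^sup>i\<close>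
  (\<open>ad_prime_power\<close>, \<open>power_derivative_prime_power\<close>).  Let \<open>V\<close> be the centralizer of \<open>K\<close> in \<open>M\<close> and
  \<open>\<tau> m\<close> the sum of the \<open>ad\<^sup>q\<^sup>-\<^sup>1(m) \<beta>\<^sub>j\<^sub>+\<^sub>1\<close>.  For \<open>m\<close> in \<open>V\<close> the first formula gives
  \<open>ad (\<tau> m) = \<tau> (ad m) = m f(x) - f(x) m = 0\<close>, because the coefficients \<open>\<beta>\<^sub>j\<^sub>+\<^sub>1\<close> are central in \<open>A\<close>.  Hence \<open>\<tau>\<close> maps
  \<open>V\<close> into the elements of \<open>M\<close> that commute with all of \<open>A\<close> (\<open>tau_commutes\<close>), and the sequences
  of the theorem are complexes.

  Weak separability.  A derivation over \<open>K\<close> is determined by its value \<open>u\<close> at \<open>x\<close>.  Its value at \<open>x\<^sup>q\<close>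
  is the sum of the \<open>x\<^sup>i u x\<^sup>q\<^sup>-\<^sup>1\<^sup>-\<^sup>i\<close>, that is \<open>ad\<^sup>q\<^sup>-\<^sup>1(u)\<close>, so the relations of \<open>A\<close> say precisely that \<open>u\<close> is in \<open>V\<close>
  and that \<open>\<tau> u = 0\<close> (\<open>derivation_value\<close>, \<open>derivation_exists\<close>).  The inner ones among them have
  \<open>u\<close> in \<open>ad V\<close>.  So every such derivation is inner iff the kernel of \<open>\<tau>\<close> is \<open>ad V\<close>.

  Separability.  This means that the tensor square has an element that commutes with \<open>A\<close> and is
  multiplied to \<open>1\<close>; it implies weak separability, and the point is to see that it is equivalent to
  \<open>1\<close> being in \<open>\<tau> V\<close>.  If \<open>\<tau> h = 1\<close>, then \<open>\<tau>\<close> of the tensor square, applied to \<open>h \<otimes> 1\<close>, yields such an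
  element (\<open>separable_if_tau_one\<close>).  Conversely let \<open>\<kappa>\<close> be the functional that reads off the
  coefficient of the highest power of \<open>x\<close>.  In the bimodule of the left \<open>K\<close>-linear maps of \<open>A\<close> it
  generates the identity: \<open>\<tau> \<kappa> = id\<close> (\<open>top_reconstruction_identity\<close>).  If \<open>E\<close>, the sum of the \<open>a\<^sub>i \<otimes> c\<^sub>i\<close>, is
  a separability element, then \<open>h\<close>, the sum of the \<open>a\<^sub>i \<kappa>(c\<^sub>i)\<close>, is in \<open>V\<close>, and \<open>\<tau> h\<close> is the product \<open>1\<close>
  of \<open>E\<close> (\<open>separable_imp_tau_one\<close>).\<close>


section \<open>Homomorphisms and products in Abelian sequence_groups\<close>

lemma (in comm_group) hom_finprod:
  assumes "comm_group H" "\<phi> \<in> hom G H" "finite I" "g \<in> I \<rightarrow> carrier G"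
  shows "\<phi> (finprod G g I) = finprod H (\<lambda>i. \<phi> (g i)) I"
proof -
  interpret H: comm_group H by fact
  show ?thesis
    using assms(3,4)
  proof (induction I)
    case empty
    then show ?case using hom_one[OF assms(2) is_group H.is_group] by simp
  next
    case (insert i I)
    then show ?case using assms(2)
      by (simp add: Pi_iff hom_in_carrier hom_mult)
  qed
qed

lemmas (in comm_group) endo_finprod = hom_finprod[OF comm_group_axioms]

lemma (in comm_group) endo_pow:
  assumes "\<phi> \<in> hom G G" "g \<in> carrier G"
  shows "\<phi> (g [^] (k::nat)) = \<phi> g [^] k"
  using hom_nat_pow[OF assms is_group is_group] .

lemma (in comm_group) endo_inv:
  assumes "\<phi> \<in> hom G G" "g \<in> carrier G"
  shows "\<phi> (inv g) = inv (\<phi> g)"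
  using assms by (meson group_hom.hom_inv group_hom.intro group_hom_axioms.intro is_group)

lemma (in comm_group) insert_inverse:
  assumes "a \<in> carrier G" "c \<in> carrier G" "w \<in> carrier G"
  shows "a \<otimes> w = c \<otimes> ((a \<otimes> inv c) \<otimes> w)"
proof -
  have "c \<otimes> ((a \<otimes> inv c) \<otimes> w) = (c \<otimes> inv c) \<otimes> (a \<otimes> w)"
    using assms by (metis inv_closed m_assoc m_comm m_closed)
  then show ?thesis using assms by simp
qed

lemma (in comm_group) finprod_inv:
  assumes "finite I" "g \<in> I \<rightarrow> carrier G"
  shows "finprod G (\<lambda>i. inv (g i)) I = inv (finprod G g I)"
  using assms
proof (induction I)
  case (insert i I)
  then show ?case by (simp add: Pi_iff inv_mult)
qed simp

section \<open>Derivations of rings\<close>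

lemma ring_derivationI:
  assumes "\<And>y. y \<in> carrier R \<Longrightarrow> d y \<in> carrier R"
    and "\<And>y z. \<lbrakk>y \<in> carrier R; z \<in> carrier R\<rbrakk> \<Longrightarrow> d (y \<oplus>\<^bsub>R\<^esub> z) = d y \<oplus>\<^bsub>R\<^esub> d z"
    and "\<And>y z. \<lbrakk>y \<in> carrier R; z \<in> carrier R\<rbrakk> \<Longrightarrow>
      d (y \<otimes>\<^bsub>R\<^esub> z) = d y \<otimes>\<^bsub>R\<^esub> z \<oplus>\<^bsub>R\<^esub> y \<otimes>\<^bsub>R\<^esub> d z"
  shows "ring_derivation R d"
  using assms by (auto simp: ring_derivation_def)

locale derivation = ring R for R (structure) +
  fixes d
  assumes derivation: "ring_derivation R d"
begin

lemma d_closed [simp]: "y \<in> carrier R \<Longrightarrow> d y \<in> carrier R"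
  using derivation by (auto simp: ring_derivation_def)

lemma d_add: "\<lbrakk>y \<in> carrier R; z \<in> carrier R\<rbrakk> \<Longrightarrow> d (y \<oplus> z) = d y \<oplus> d z"
  using derivation by (auto simp: ring_derivation_def)

lemma d_mult: "\<lbrakk>y \<in> carrier R; z \<in> carrier R\<rbrakk> \<Longrightarrow> d (y \<otimes> z) = d y \<otimes> z \<oplus> y \<otimes> d z"
  using derivation by (auto simp: ring_derivation_def)

lemma d_hom: "d \<in> hom (add_monoid R) (add_monoid R)"
  by (simp add: hom_def d_add)

lemma d_zero [simp]: "d \<zero> = \<zero>"
  using hom_one[OF d_hom] add.is_group by simp

lemma d_one [simp]: "d \<one> = \<zero>"
proof -
  have "d \<one> \<oplus> d \<one> = d \<one> \<oplus> \<zero>" using d_mult[of \<one> \<one>] by simp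
  then show ?thesis by (simp only: add.l_cancel d_closed one_closed zero_closed)
qed

lemma d_finsum: "\<lbrakk>finite I; g \<in> I \<rightarrow> carrier R\<rbrakk> \<Longrightarrow> d (finsum R g I) = (\<Oplus>i\<in>I. d (g i))"
  by (rule add.endo_finprod[OF d_hom])

end

section \<open>Two-sided modules and commutators with a fixed element\<close>

text \<open>The operators below are needed on the extension itself and on its tensor square.  Both are
  instances of this locale; the additive group is written multiplicatively, as in \<^type>\<open>bimodule\<close>.\<close>

locale two_sided_module = ring A + M: comm_group M
  for A :: "('a, 'r) ring_scheme" (structure) and M :: "('a, 'm, 'c) bimodule_scheme" +
  assumes lact_closed [simp]: "\<lbrakk>y \<in> carrier A; m \<in> carrier M\<rbrakk> \<Longrightarrow> lact M y m \<in> carrier M"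
    and ract_closed [simp]: "\<lbrakk>y \<in> carrier A; m \<in> carrier M\<rbrakk> \<Longrightarrow> ract M m y \<in> carrier M"
    and lact_mult: "\<lbrakk>y \<in> carrier A; m \<in> carrier M; m' \<in> carrier M\<rbrakk> \<Longrightarrow>
      lact M y (m \<otimes>\<^bsub>M\<^esub> m') = lact M y m \<otimes>\<^bsub>M\<^esub> lact M y m'"
    and ract_mult: "\<lbrakk>y \<in> carrier A; m \<in> carrier M; m' \<in> carrier M\<rbrakk> \<Longrightarrow>
      ract M (m \<otimes>\<^bsub>M\<^esub> m') y = ract M m y \<otimes>\<^bsub>M\<^esub> ract M m' y"
    and lact_add: "\<lbrakk>y \<in> carrier A; z \<in> carrier A; m \<in> carrier M\<rbrakk> \<Longrightarrow>
      lact M (y \<oplus> z) m = lact M y m \<otimes>\<^bsub>M\<^esub> lact M z m"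
    and ract_add: "\<lbrakk>y \<in> carrier A; z \<in> carrier A; m \<in> carrier M\<rbrakk> \<Longrightarrow>
      ract M m (y \<oplus> z) = ract M m y \<otimes>\<^bsub>M\<^esub> ract M m z"
    and lact_lact: "\<lbrakk>y \<in> carrier A; z \<in> carrier A; m \<in> carrier M\<rbrakk> \<Longrightarrow>
      lact M y (lact M z m) = lact M (y \<otimes> z) m"
    and ract_ract: "\<lbrakk>y \<in> carrier A; z \<in> carrier A; m \<in> carrier M\<rbrakk> \<Longrightarrow>
      ract M (ract M m y) z = ract M m (y \<otimes> z)"
    and ract_lact: "\<lbrakk>y \<in> carrier A; z \<in> carrier A; m \<in> carrier M\<rbrakk> \<Longrightarrow>
      ract M (lact M y m) z = lact M y (ract M m z)"
    and lact_one [simp]: "m \<in> carrier M \<Longrightarrow> lact M \<one> m = m"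
    and ract_one [simp]: "m \<in> carrier M \<Longrightarrow> ract M m \<one> = m"

context two_sided_module
begin

lemma lact_hom: "y \<in> carrier A \<Longrightarrow> lact M y \<in> hom M M"
  by (simp add: hom_def lact_mult)

lemma ract_hom: "y \<in> carrier A \<Longrightarrow> (\<lambda>m. ract M m y) \<in> hom M M"
  by (simp add: hom_def ract_mult)

lemma lact_inv: "\<lbrakk>y \<in> carrier A; m \<in> carrier M\<rbrakk> \<Longrightarrow> lact M y (inv\<^bsub>M\<^esub> m) = inv\<^bsub>M\<^esub> lact M y m"
  by (simp add: M.endo_inv lact_hom)

lemma ract_inv: "\<lbrakk>y \<in> carrier A; m \<in> carrier M\<rbrakk> \<Longrightarrow> ract M (inv\<^bsub>M\<^esub> m) y = inv\<^bsub>M\<^esub> ract M m y"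
  using M.endo_inv[OF ract_hom] by simp

lemma lact_unit: "y \<in> carrier A \<Longrightarrow> lact M y \<one>\<^bsub>M\<^esub> = \<one>\<^bsub>M\<^esub>"
  by (simp add: hom_one lact_hom)

lemma ract_unit: "y \<in> carrier A \<Longrightarrow> ract M \<one>\<^bsub>M\<^esub> y = \<one>\<^bsub>M\<^esub>"
  using hom_one[OF ract_hom] by simp

lemma scalar_hom:
  assumes "m \<in> carrier M"
  shows "(\<lambda>y. lact M y m) \<in> hom (add_monoid A) M" "(\<lambda>y. ract M m y) \<in> hom (add_monoid A) M"
  using assms by (auto simp: hom_def lact_add ract_add)

lemma lact_zero: "m \<in> carrier M \<Longrightarrow> lact M \<zero> m = \<one>\<^bsub>M\<^esub>"
  using hom_one[OF scalar_hom(1)] add.is_group M.is_group by force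

lemma ract_zero: "m \<in> carrier M \<Longrightarrow> ract M m \<zero> = \<one>\<^bsub>M\<^esub>"
  using hom_one[OF scalar_hom(2)] add.is_group M.is_group by force

lemma lact_uminus: "\<lbrakk>y \<in> carrier A; m \<in> carrier M\<rbrakk> \<Longrightarrow> lact M (\<ominus> y) m = inv\<^bsub>M\<^esub> lact M y m"
  by (rule M.inv_equality[symmetric]) (simp_all add: lact_add[symmetric] l_neg lact_zero)

lemma ract_uminus: "\<lbrakk>y \<in> carrier A; m \<in> carrier M\<rbrakk> \<Longrightarrow> ract M m (\<ominus> y) = inv\<^bsub>M\<^esub> ract M m y"
  by (rule M.inv_equality[symmetric]) (simp_all add: ract_add[symmetric] l_neg ract_zero)

lemma lact_finsum:
  assumes "finite I" "g \<in> I \<rightarrow> carrier A" "m \<in> carrier M"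
  shows "lact M (finsum A g I) m = finprod M (\<lambda>i. lact M (g i) m) I"
  using assms(1,2)
proof (induction I)
  case (insert i I)
  then show ?case using assms(3) by (simp add: Pi_iff lact_add)
qed (simp add: lact_zero assms)

lemma ract_finsum:
  assumes "finite I" "g \<in> I \<rightarrow> carrier A" "m \<in> carrier M"
  shows "ract M m (finsum A g I) = finprod M (\<lambda>i. ract M m (g i)) I"
  using assms(1,2)
proof (induction I)
  case (insert i I)
  then show ?case using assms(3) by (simp add: Pi_iff ract_add)
qed (simp add: ract_zero assms)

lemma pow_characteristic:
  assumes "[p] \<cdot> \<one> = \<zero>" "m \<in> carrier M"
  shows "m [^]\<^bsub>M\<^esub> (p::nat) = \<one>\<^bsub>M\<^esub>"
proof -
  have "lact M ([k] \<cdot> \<one>) m = m [^]\<^bsub>M\<^esub> k" for k :: nat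
    by (induction k) (simp_all add: assms lact_zero lact_add)
  from this[of p] show ?thesis by (simp add: assms lact_zero)
qed

text \<open>The sign is chosen such that \<open>ad X a = a X - X a = D a\<close> for a constant \<open>a\<close> of a skew polynomial ring.\<close>

definition ad :: "'a \<Rightarrow> 'm \<Rightarrow> 'm"
  where "ad x m = ract M m x \<otimes>\<^bsub>M\<^esub> inv\<^bsub>M\<^esub> lact M x m"

text \<open>The sum of the \<open>x\<^sup>i m x\<^sup>k\<^sup>-\<^sup>1\<^sup>-\<^sup>i\<close> over \<open>i < k\<close>.  The recursion is the Leibniz rule, so this is the value at \<open>x\<^sup>k\<close> of
  any derivation with value \<open>m\<close> at \<open>x\<close>.\<close>

primrec power_derivative :: "'a \<Rightarrow> 'm \<Rightarrow> nat \<Rightarrow> 'm"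
  where
    "power_derivative x m 0 = \<one>\<^bsub>M\<^esub>"
  | "power_derivative x m (Suc k) = ract M (power_derivative x m k) x \<otimes>\<^bsub>M\<^esub> lact M (x [^] k) m"

context
  fixes x assumes x [simp]: "x \<in> carrier A"
begin

lemma ad_closed [simp]: "m \<in> carrier M \<Longrightarrow> ad x m \<in> carrier M"
  by (simp add: ad_def)

lemma ad_hom: "ad x \<in> hom M M"
  by (auto simp: hom_def ad_def lact_mult ract_mult M.inv_mult M.m_ac)

lemma ad_funpow_closed [simp]: "m \<in> carrier M \<Longrightarrow> (ad x ^^ k) m \<in> carrier M"
  by (induction k) auto

lemma power_derivative_closed [simp]: "m \<in> carrier M \<Longrightarrow> power_derivative x m k \<in> carrier M"
  by (induction k) auto

lemma ad_mult: "\<lbrakk>m \<in> carrier M; m' \<in> carrier M\<rbrakk> \<Longrightarrow> ad x (m \<otimes>\<^bsub>M\<^esub> m') = ad x m \<otimes>\<^bsub>M\<^esub> ad x m'"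
  using ad_hom by (simp add: hom_def)

lemma ad_lact:
  assumes "y \<in> carrier A" "y \<otimes> x = x \<otimes> y" "m \<in> carrier M"
  shows "ad x (lact M y m) = lact M y (ad x m)"
  using assms by (simp add: ad_def ract_lact lact_lact lact_mult lact_inv)

lemma ad_ract:
  assumes "y \<in> carrier A" "y \<otimes> x = x \<otimes> y" "m \<in> carrier M"
  shows "ad x (ract M m y) = ract M (ad x m) y"
  using assms by (simp add: ad_def ract_lact[symmetric] ract_ract ract_mult ract_inv)

lemma pow_comm_self: "x [^] (k::nat) \<otimes> x = x \<otimes> x [^] k"
  by (simp add: nat_pow_comm[of x k 1, simplified])

text \<open>The telescoping sum \<open>(R - L) (\<Sum> L\<^sup>i R\<^sup>k\<^sup>-\<^sup>1\<^sup>-\<^sup>i) = R\<^sup>k - L\<^sup>k\<close> for the commuting operators \<open>L\<close> and \<open>R\<close> of left and right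
  multiplication by \<open>x\<close>.\<close>

lemma ad_power_derivative:
  assumes "m \<in> carrier M"
  shows "ad x (power_derivative x m k) = ract M m (x [^] k) \<otimes>\<^bsub>M\<^esub> inv\<^bsub>M\<^esub> lact M (x [^] k) m"
proof (induction k)
  case 0
  then show ?case using assms by (simp add: ad_def ract_unit lact_unit)
next
  case (Suc k)
  let ?q = "x [^] k"
  have "ad x (power_derivative x m (Suc k))
      = ract M (ad x (power_derivative x m k)) x \<otimes>\<^bsub>M\<^esub> lact M ?q (ad x m)"
    using assms by (simp add: ad_mult ad_ract ad_lact pow_comm_self)
  also have "\<dots> = (ract M m (?q \<otimes> x) \<otimes>\<^bsub>M\<^esub> inv\<^bsub>M\<^esub> lact M ?q (ract M m x)) \<otimes>\<^bsub>M\<^esub>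
      (lact M ?q (ract M m x) \<otimes>\<^bsub>M\<^esub> inv\<^bsub>M\<^esub> lact M (?q \<otimes> x) m)"
    unfolding Suc using assms
    by (simp add: ad_def ract_mult ract_inv lact_mult lact_inv ract_ract lact_lact ract_lact)
  also have "\<dots> = ract M m (?q \<otimes> x) \<otimes>\<^bsub>M\<^esub> inv\<^bsub>M\<^esub> lact M (?q \<otimes> x) m"
    using assms by (simp add: M.m_assoc M.inv_solve_left')
  finally show ?case by simp
qed

text \<open>With \<open>L\<close> and \<open>R\<close> as above and \<open>R = L + ad\<close>, dividing the binomial expansion of \<open>(L + ad)\<^sup>k\<^sup>+\<^sup>1 - L\<^sup>k\<^sup>+\<^sup>1\<close> by \<open>ad\<close> gives
  this formula.  The induction step is Pascal's rule.\<close>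

lemma power_derivative_expand:
  assumes m: "m \<in> carrier M"
  shows "power_derivative x m (Suc k) =
    (\<Otimes>\<^bsub>M\<^esub>i\<in>{..k}. lact M (x [^] (k - i)) ((ad x ^^ i) m) [^]\<^bsub>M\<^esub> (Suc k choose Suc i))"
proof (induction k)
  case 0
  then show ?case using m by (simp add: ract_unit)
next
  case (Suc k)
  let ?u = "\<lambda>i. lact M (x [^] (Suc k - i)) ((ad x ^^ i) m)"
  let ?S = "power_derivative x m (Suc k)"
  have S: "?S = (\<Otimes>\<^bsub>M\<^esub>i\<in>{..k}. lact M (x [^] (k - i)) ((ad x ^^ i) m) [^]\<^bsub>M\<^esub> (Suc k choose Suc i))"
    by (rule Suc)
  have "lact M x ?S = (\<Otimes>\<^bsub>M\<^esub>i\<in>{..k}. ?u i [^]\<^bsub>M\<^esub> (Suc k choose Suc i))"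
    unfolding S using m
    by (subst M.endo_finprod[OF lact_hom])
      (auto simp: M.endo_pow[OF lact_hom] lact_lact Suc_diff_le pow_comm_self intro!: M.finprod_cong')
  also have "\<dots> = (\<Otimes>\<^bsub>M\<^esub>i\<in>{..Suc k}. ?u i [^]\<^bsub>M\<^esub> (Suc k choose Suc i))"
    using m by (simp add: binomial_eq_0)
  finally have 1: "lact M x ?S = \<dots>" .
  have "ad x ?S = (\<Otimes>\<^bsub>M\<^esub>i\<in>{..k}. ?u (Suc i) [^]\<^bsub>M\<^esub> (Suc k choose Suc i))"
    unfolding S using m
    by (subst M.endo_finprod[OF ad_hom])
      (auto simp: M.endo_pow[OF ad_hom] ad_lact pow_comm_self intro!: M.finprod_cong')
  then have "ad x ?S \<otimes>\<^bsub>M\<^esub> lact M (x [^] Suc k) m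
      = (\<Otimes>\<^bsub>M\<^esub>i\<in>{..Suc k}. ?u i [^]\<^bsub>M\<^esub> (Suc k choose i))"
    using m by (subst M.finprod_Suc2) auto
  then have 2: "ad x ?S \<otimes>\<^bsub>M\<^esub> lact M (x [^] Suc k) m = \<dots>" .
  have "power_derivative x m (Suc (Suc k))
      = lact M x ?S \<otimes>\<^bsub>M\<^esub> (ad x ?S \<otimes>\<^bsub>M\<^esub> lact M (x [^] Suc k) m)"
    using m unfolding power_derivative.simps(2)[of x m "Suc k"] ad_def
    by (intro M.insert_inverse) (simp_all del: nat_pow_Suc power_derivative.simps)
  also have "\<dots> = (\<Otimes>\<^bsub>M\<^esub>i\<in>{..Suc k}. ?u i [^]\<^bsub>M\<^esub> (Suc k choose Suc i) \<otimes>\<^bsub>M\<^esub> ?u i [^]\<^bsub>M\<^esub> (Suc k choose i))"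
    unfolding 1 2 using m by (intro M.finprod_multf[symmetric]) auto
  also have "\<dots> = (\<Otimes>\<^bsub>M\<^esub>i\<in>{..Suc k}. ?u i [^]\<^bsub>M\<^esub> (Suc (Suc k) choose Suc i))"
    using m by (intro M.finprod_cong') (auto simp: M.nat_pow_mult add.commute)
  finally show ?case .
qed

end

end

text \<open>With \<open>q = p\<^sup>j\<close>, the number \<open>q\<close> divides \<open>i (q choose i)\<close>.  If \<open>p\<close> did not divide the binomial coefficient,
  then \<open>q\<close> would divide \<open>i < q\<close>.\<close>

lemma prime_dvd_choose_prime_power:
  assumes "Factorial_Ring.prime (p::nat)" "0 < i" "i < p ^ j"
  shows "p dvd (p ^ j choose i)"
proof (rule ccontr)
  assume "\<not> p dvd (p ^ j choose i)"
  then have "coprime (p ^ j) (p ^ j choose i)"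
    using assms(1) by (simp add: prime_imp_coprime)
  moreover have "p ^ j dvd i * (p ^ j choose i)"
    using times_binomial_minus1_eq[OF assms(2), of "p ^ j"] by simp
  ultimately have "p ^ j dvd i" using coprime_dvd_mult_left_iff by blast
  then show False using assms by (simp add: nat_dvd_not_less)
qed

text \<open>In the expansion above all binomial coefficients except the last one are divisible by \<open>p\<close>.\<close>

lemma (in two_sided_module) power_derivative_prime_power:
  assumes p: "Factorial_Ring.prime p" and char: "[p] \<cdot> \<one> = \<zero>"
    and x [simp]: "x \<in> carrier A" and m [simp]: "m \<in> carrier M"
  shows "power_derivative x m (p ^ j) = (ad x ^^ (p ^ j - 1)) m"
proof -
  obtain k where k: "p ^ j = Suc k"
    using p by (metis gr0_implies_Suc prime_gt_0_nat zero_less_power)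
  have divisible: "lact M (x [^] (k - i)) ((ad x ^^ i) m) [^]\<^bsub>M\<^esub> (Suc k choose Suc i) = \<one>\<^bsub>M\<^esub>"
    if i: "i < k" for i
  proof -
    obtain c where "Suc k choose Suc i = p * c"
      using prime_dvd_choose_prime_power[OF p, of "Suc i" j] i k by (auto elim: dvdE)
    then show ?thesis
      by (simp add: M.nat_pow_pow[symmetric] pow_characteristic[OF char])
  qed
  have "power_derivative x m (Suc k) = (\<Otimes>\<^bsub>M\<^esub>i\<in>{..k}. if i = k then (ad x ^^ i) m else \<one>\<^bsub>M\<^esub>)"
    unfolding power_derivative_expand[OF x m]
    by (intro M.finprod_cong') (auto simp: divisible binomial_eq_0 simp del: binomial_Suc_Suc)
  also have "\<dots> = (ad x ^^ k) m"
    by (subst M.finprod_singleton_swap) auto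
  finally show ?thesis using k by simp
qed

text \<open>Frobenius for the difference of the two commuting operators.\<close>

lemma (in two_sided_module) ad_prime_power:
  assumes p: "Factorial_Ring.prime p" and char: "[p] \<cdot> \<one> = \<zero>"
    and x [simp]: "x \<in> carrier A" and m [simp]: "m \<in> carrier M"
  shows "(ad x ^^ (p ^ j)) m = ract M m (x [^] (p ^ j)) \<otimes>\<^bsub>M\<^esub> inv\<^bsub>M\<^esub> lact M (x [^] (p ^ j)) m"
proof -
  have "p ^ j = Suc (p ^ j - 1)" using p by (simp add: prime_gt_0_nat)
  then have "(ad x ^^ (p ^ j)) m = ad x ((ad x ^^ (p ^ j - 1)) m)"
    by (metis funpow.simps(2) o_apply)
  then show ?thesis
    using ad_power_derivative[OF x m, of "p ^ j"] power_derivative_prime_power[OF assms, of j] by simp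
qed

lemma (in ring) regular_two_sided_module: "two_sided_module R (sub_bimodule R (carrier R))"
proof -
  interpret M: comm_group "sub_bimodule R (carrier R)"
    by (rule comm_groupI) (auto simp: sub_bimodule_def a_ac intro: exI[of _ "\<ominus> x" for x] l_neg)
  show ?thesis
    by unfold_locales (auto simp: sub_bimodule_def l_distr r_distr m_assoc)
qed

section \<open>Extensions generated by a root of a p-polynomial\<close>

lemma sub_bimodule_simps [simp]:
  "carrier (sub_bimodule A M) = M" "monoid.mult (sub_bimodule A M) = add A"
  "one (sub_bimodule A M) = \<zero>\<^bsub>A\<^esub>"
  "lact (sub_bimodule A M) = (\<otimes>\<^bsub>A\<^esub>)" "ract (sub_bimodule A M) = (\<otimes>\<^bsub>A\<^esub>)"
  by (simp_all add: sub_bimodule_def)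

lemma sub_bimodule_inv [simp]: "inv\<^bsub>sub_bimodule A (carrier A)\<^esub> y = \<ominus>\<^bsub>A\<^esub> y"
  by (simp add: m_inv_def a_inv_def)

lemma sub_bimodule_finprod [simp]: "finprod (sub_bimodule A (carrier A)) g I = finsum A g I"
  by (simp add: finprod_def finsum_def)

lemma (in abelian_group) diff_add_cancel:
  "\<lbrakk>a \<in> carrier G; b \<in> carrier G\<rbrakk> \<Longrightarrow> (a \<ominus> b) \<oplus> b = a"
  by (simp add: a_minus_def a_assoc l_neg)

text \<open>The properties of the quotient \<open>A\<close> that the argument uses: \<open>A\<close> has the right \<open>K\<close>-basis \<open>1, x, \<dots>, x\<^sup>n\<^sup>-\<^sup>1\<close>
  with \<open>n = p\<^sup>e\<close>, the commutator with \<open>x\<close> maps \<open>K\<close> to itself, and \<open>x\<close> is a root of the polynomial with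
  coefficient \<open>\<beta> (Suc j)\<close> at \<open>p\<^sup>j\<close> and constant term \<open>\<beta> 0\<close>.\<close>

locale p_polynomial_extension = ring A
  for A :: "('a, 'r) ring_scheme" (structure) +
  fixes K :: "'a set" and x :: 'a and p e :: nat and \<beta> :: "nat \<Rightarrow> 'a"
  assumes subring_K: "subring K A"
    and x_closed [simp]: "x \<in> carrier A"
    and commutator_K: "k \<in> K \<Longrightarrow> k \<otimes> x \<ominus> x \<otimes> k \<in> K"
    and prime_p: "Factorial_Ring.prime p"
    and char_p: "[p] \<cdot> \<one> = \<zero>"
    and e_pos: "e \<ge> 1"
    and beta_K: "j \<le> e \<Longrightarrow> \<beta> j \<in> K"
    and beta_last: "\<beta> (Suc e) = \<one>"
    and root: "(\<Oplus>j\<in>{..e}. x [^] (p ^ j) \<otimes> \<beta> (Suc j)) \<oplus> \<beta> 0 = \<zero>"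
    and expansion: "y \<in> carrier A \<Longrightarrow>
      \<exists>c\<in>{..<p ^ e} \<rightarrow> K. y = (\<Oplus>j\<in>{..<p ^ e}. x [^] j \<otimes> c j)"
    and independent: "\<lbrakk>c \<in> {..<p ^ e} \<rightarrow> K; (\<Oplus>j\<in>{..<p ^ e}. x [^] j \<otimes> c j) = \<zero>; j < p ^ e\<rbrakk>
      \<Longrightarrow> c j = \<zero>"
begin

sublocale reg: two_sided_module A "sub_bimodule A (carrier A)"
  by (rule regular_two_sided_module)

lemma reg_ad: "reg.ad x y = y \<otimes> x \<ominus> x \<otimes> y"
  by (simp add: reg.ad_def a_minus_def)

lemma K_carrier [simp]: "k \<in> K \<Longrightarrow> k \<in> carrier A"
  using subringE(1)[OF subring_K] by blast

lemma K_closed [simp]: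
  "\<zero> \<in> K" "\<one> \<in> K" "k \<in> K \<Longrightarrow> \<ominus> k \<in> K"
  "\<lbrakk>k \<in> K; k' \<in> K\<rbrakk> \<Longrightarrow> k \<oplus> k' \<in> K" "\<lbrakk>k \<in> K; k' \<in> K\<rbrakk> \<Longrightarrow> k \<otimes> k' \<in> K"
  "\<lbrakk>k \<in> K; k' \<in> K\<rbrakk> \<Longrightarrow> k \<ominus> k' \<in> K"
  using subringE[OF subring_K] by (auto simp: a_minus_def)

lemma K_finsum [simp]: "\<lbrakk>finite I; g \<in> I \<rightarrow> K\<rbrakk> \<Longrightarrow> finsum A g I \<in> K"
proof (induction I rule: finite_induct)
  case (insert i I)
  moreover have "g \<in> I \<rightarrow> carrier A" "g i \<in> carrier A" using insert by (auto simp: Pi_iff)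
  ultimately show ?case by simp
qed simp

lemma beta_in_K [simp]: "j \<le> Suc e \<Longrightarrow> \<beta> j \<in> K"
  using beta_K beta_last by (cases "j = Suc e") auto

lemma p_gt_1: "p > 1"
  using prime_p prime_gt_1_nat by blast

lemma degree_gt_1: "p ^ e > 1"
  using one_less_power[OF p_gt_1, of e] e_pos by simp

lemma ad_K: "k \<in> K \<Longrightarrow> reg.ad x k \<in> K"
  by (simp add: reg_ad commutator_K)

lemma ad_funpow_K: "k \<in> K \<Longrightarrow> (reg.ad x ^^ i) k \<in> K"
  by (induction i) (auto simp: ad_K)

lemma K_times_x: "k \<in> K \<Longrightarrow> k \<otimes> x = x \<otimes> k \<oplus> reg.ad x k"
  by (simp add: reg_ad a_minus_def a_ac r_neg)

lemma K_times_x_prime_power: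
  "k \<in> K \<Longrightarrow> k \<otimes> x [^] (p ^ j) = x [^] (p ^ j) \<otimes> k \<oplus> (reg.ad x ^^ (p ^ j)) k"
  using reg.ad_prime_power[OF prime_p char_p x_closed, of k j] by (simp add: a_ac r_neg)

text \<open>The independence of the powers of \<open>x\<close> for sums that involve only the exponents \<open>0\<close> and \<open>p\<^sup>j\<close>.  The
  coefficient at \<open>p\<^sup>e\<close> has to vanish, since this exponent lies outside the basis.\<close>

lemma sparse_independent:
  assumes \<gamma>: "\<gamma> \<in> {..e} \<rightarrow> K" "\<gamma> e = \<zero>" "\<gamma>' \<in> K"
    and sum0: "(\<Oplus>j\<in>{..e}. x [^] (p ^ j) \<otimes> \<gamma> j) \<oplus> \<gamma>' = \<zero>"
    and j: "j \<le> e"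
  shows "\<gamma> j = \<zero>"
proof (cases "j = e")
  case False
  \<comment> \<open>the coefficients of the same sum with respect to the whole basis\<close>
  define c where "c i = (if i = 0 then \<gamma>' else if i \<in> (\<lambda>j. p ^ j) ` {..<e}
    then \<gamma> (the_inv_into {..<e} (\<lambda>j. p ^ j) i) else \<zero>)" for i
  have inj: "inj_on (\<lambda>j. p ^ j) {..<e}"
    using p_gt_1 by (auto simp: inj_on_def)
  have c_pow: "c (p ^ j) = \<gamma> j" if "j < e" for j
    using that p_gt_1 the_inv_into_f_f[OF inj] by (auto simp: c_def)
  have c_K: "c i \<in> K" for i
    using \<gamma> the_inv_into_into[OF inj, of i "{..<e}"] unfolding c_def by auto
  have sub: "insert 0 ((\<lambda>j. p ^ j) ` {..<e}) \<subseteq> {..<p ^ e}"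
    using p_gt_1 by auto
  have "(\<Oplus>i\<in>{..<p ^ e}. x [^] i \<otimes> c i) = (\<Oplus>i\<in>insert 0 ((\<lambda>j. p ^ j) ` {..<e}). x [^] i \<otimes> c i)"
    by (rule add.finprod_mono_neutral_cong_right) (use sub c_K in \<open>auto simp: c_def\<close>)
  also have "\<dots> = \<gamma>' \<oplus> (\<Oplus>i\<in>(\<lambda>j. p ^ j) ` {..<e}. x [^] i \<otimes> c i)"
    using c_K p_gt_1 \<gamma>(3) by (subst finsum_insert) (auto simp: c_def[of 0])
  also have "(\<Oplus>i\<in>(\<lambda>j. p ^ j) ` {..<e}. x [^] i \<otimes> c i) = (\<Oplus>j\<in>{..<e}. x [^] (p ^ j) \<otimes> \<gamma> j)"
    using c_K \<gamma>(1) by (subst finsum_reindex[OF _ inj]) (auto intro!: finsum_cong' simp: c_pow Pi_iff)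
  also have "\<dots> = (\<Oplus>j\<in>{..e}. x [^] (p ^ j) \<otimes> \<gamma> j)"
    by (rule add.finprod_mono_neutral_cong_left) (use \<gamma> in \<open>auto simp: Pi_iff not_less\<close>)
  also have "\<gamma>' \<oplus> \<dots> = \<zero>"
    using sum0 \<gamma> by (subst a_comm) (auto simp: Pi_iff)
  finally have "c (p ^ j) = \<zero>"
    by (rule independent[rotated]) (use c_K False j p_gt_1 in \<open>auto intro!: power_strict_increasing\<close>)
  then show ?thesis using c_pow False j by simp
qed (simp add: \<gamma>)

text \<open>The non-constant part of the polynomial, evaluated at \<open>x\<close>.\<close>

abbreviation F where "F \<equiv> (\<Oplus>j\<in>{..e}. x [^] (p ^ j) \<otimes> \<beta> (Suc j))"

lemma F_closed [simp]: "F \<in> carrier A"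
  by (rule finsum_closed) auto

lemma F_eq: "F = \<ominus> \<beta> 0"
  using root by (intro minus_equality[symmetric]) auto

text \<open>Since \<open>f(x) = 0\<close>, also \<open>f(x) x - x f(x) = 0\<close>.  This is a polynomial in \<open>x\<close> with the coefficients
  \<open>\<beta>\<^sub>j x - x \<beta>\<^sub>j\<close>; the one at \<open>p\<^sup>e\<close> is zero because \<open>f\<close> is monic, so all of them are zero.\<close>

lemma beta_commutes_x: 
  assumes "j \<le> e"
  shows "\<beta> (Suc j) \<otimes> x = x \<otimes> \<beta> (Suc j)"
proof -
  define \<gamma> where "\<gamma> j = \<beta> (Suc j) \<otimes> x \<ominus> x \<otimes> \<beta> (Suc j)" for j
  have \<gamma>: "\<gamma> \<in> {..e} \<rightarrow> K" by (auto simp: \<gamma>_def commutator_K)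
  then have \<gamma>_car: "j \<le> e \<Longrightarrow> \<gamma> j \<in> carrier A" for j by (auto simp: Pi_iff)
  have "(\<Oplus>j\<in>{..e}. x [^] (p ^ j) \<otimes> \<gamma> j) \<oplus> x \<otimes> F
      = (\<Oplus>j\<in>{..e}. x [^] (p ^ j) \<otimes> \<gamma> j \<oplus> x \<otimes> (x [^] (p ^ j) \<otimes> \<beta> (Suc j)))"
    using \<gamma>_car by (subst finsum_rdistr, simp, simp, force, subst finsum_addf) auto
  also have "\<dots> = (\<Oplus>j\<in>{..e}. x [^] (p ^ j) \<otimes> \<beta> (Suc j) \<otimes> x)"
  proof (rule finsum_cong')
    fix j assume j: "j \<in> {..e}"
    have "\<beta> (Suc j) \<otimes> x = \<gamma> j \<oplus> x \<otimes> \<beta> (Suc j)"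
      using j by (simp add: \<gamma>_def diff_add_cancel)
    then show "x [^] (p ^ j) \<otimes> \<gamma> j \<oplus> x \<otimes> (x [^] (p ^ j) \<otimes> \<beta> (Suc j)) = x [^] (p ^ j) \<otimes> \<beta> (Suc j) \<otimes> x"
      using j \<gamma>_car by (simp add: m_assoc r_distr) (simp add: m_assoc[symmetric] reg.pow_comm_self)
  qed auto
  also have "\<dots> = F \<otimes> x"
    by (subst finsum_ldistr) auto
  finally have *: "(\<Oplus>j\<in>{..e}. x [^] (p ^ j) \<otimes> \<gamma> j) \<oplus> x \<otimes> F = F \<otimes> x" .
  have car: "(\<Oplus>j\<in>{..e}. x [^] (p ^ j) \<otimes> \<gamma> j) \<in> carrier A"
    using \<gamma>_car by (intro finsum_closed) auto
  have "(\<Oplus>j\<in>{..e}. x [^] (p ^ j) \<otimes> \<gamma> j) \<oplus> (\<beta> 0 \<otimes> x \<ominus> x \<otimes> \<beta> 0) = \<zero>"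
    using * car unfolding F_eq by (simp add: l_minus r_minus a_minus_def a_ac l_neg r_neg)
  moreover have "\<gamma> e = \<zero>" by (simp add: \<gamma>_def beta_last)
  moreover have "\<beta> 0 \<otimes> x \<ominus> x \<otimes> \<beta> 0 \<in> K" by (simp add: commutator_K)
  ultimately have "\<gamma> j = \<zero>"
    using sparse_independent[OF \<gamma>] assms by blast
  then show ?thesis
    using assms by (simp add: \<gamma>_def)
qed

text \<open>The same comparison for \<open>k f(x) - f(x) k = 0\<close>.  Moving \<open>k\<close> past \<open>x\<^sup>q\<close>, where \<open>q = p\<^sup>j\<close>, produces only the extra term
  \<open>ad\<^sup>q(k)\<close>, which changes only the constant coefficient; so \<open>\<beta> 0\<close> itself may fail to
  commute with \<open>K\<close>.\<close>

lemma beta_commutes_K: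
  assumes "j \<le> e" and k: "k \<in> K"
  shows "\<beta> (Suc j) \<otimes> k = k \<otimes> \<beta> (Suc j)"
proof -
  define \<gamma> where "\<gamma> j = k \<otimes> \<beta> (Suc j) \<ominus> \<beta> (Suc j) \<otimes> k" for j
  define d where "d j = (reg.ad x ^^ (p ^ j)) k \<otimes> \<beta> (Suc j)" for j
  have \<gamma>: "\<gamma> \<in> {..e} \<rightarrow> K" using k by (auto simp: \<gamma>_def)
  have d: "d \<in> {..e} \<rightarrow> K" using k by (auto simp: d_def ad_funpow_K)
  have \<gamma>_car: "j \<le> e \<Longrightarrow> \<gamma> j \<in> carrier A" and d_car: "j \<le> e \<Longrightarrow> d j \<in> carrier A" for j
    using \<gamma> d by (auto simp: Pi_iff)
  have dsum: "finsum A d {..e} \<in> K" using d by auto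
  have "(\<Oplus>j\<in>{..e}. x [^] (p ^ j) \<otimes> \<gamma> j) \<oplus> finsum A d {..e} \<oplus> F \<otimes> k
      = (\<Oplus>j\<in>{..e}. x [^] (p ^ j) \<otimes> \<gamma> j \<oplus> d j \<oplus> x [^] (p ^ j) \<otimes> \<beta> (Suc j) \<otimes> k)"
    using \<gamma>_car d_car k by (subst finsum_ldistr, simp, simp, force, (subst finsum_addf)+) auto
  also have "\<dots> = (\<Oplus>j\<in>{..e}. k \<otimes> (x [^] (p ^ j) \<otimes> \<beta> (Suc j)))"
  proof (rule finsum_cong')
    fix j assume j: "j \<in> {..e}"
    have "k \<otimes> \<beta> (Suc j) = \<gamma> j \<oplus> \<beta> (Suc j) \<otimes> k"
      using j k by (simp add: \<gamma>_def diff_add_cancel)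
    moreover have "k \<otimes> (x [^] (p ^ j) \<otimes> \<beta> (Suc j)) = x [^] (p ^ j) \<otimes> (k \<otimes> \<beta> (Suc j)) \<oplus> d j"
      using j k K_times_x_prime_power[OF k, of j] 
      by (simp add: m_assoc[symmetric] l_distr d_def ad_funpow_K)
    ultimately show "x [^] (p ^ j) \<otimes> \<gamma> j \<oplus> d j \<oplus> x [^] (p ^ j) \<otimes> \<beta> (Suc j) \<otimes> k
        = k \<otimes> (x [^] (p ^ j) \<otimes> \<beta> (Suc j))"
      using j k \<gamma>_car d_car by (simp add: m_assoc r_distr a_ac)
  qed (use k in auto)
  also have "\<dots> = k \<otimes> F"
    using k by (subst finsum_rdistr) auto
  finally have *: "(\<Oplus>j\<in>{..e}. x [^] (p ^ j) \<otimes> \<gamma> j) \<oplus> finsum A d {..e} \<oplus> F \<otimes> k = k \<otimes> F" .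
  have car: "(\<Oplus>j\<in>{..e}. x [^] (p ^ j) \<otimes> \<gamma> j) \<in> carrier A"
    using \<gamma>_car by (intro finsum_closed) auto
  have "(\<Oplus>j\<in>{..e}. x [^] (p ^ j) \<otimes> \<gamma> j) \<oplus> (finsum A d {..e} \<oplus> (k \<otimes> \<beta> 0 \<ominus> \<beta> 0 \<otimes> k))
      = ((\<Oplus>j\<in>{..e}. x [^] (p ^ j) \<otimes> \<gamma> j) \<oplus> finsum A d {..e} \<oplus> F \<otimes> k) \<oplus> k \<otimes> \<beta> 0"
    using k car dsum unfolding F_eq by (simp add: l_minus a_minus_def a_ac)
  also have "\<dots> = \<zero>"
    using k unfolding * unfolding F_eq by (simp add: r_minus l_neg)
  finally have "(\<Oplus>j\<in>{..e}. x [^] (p ^ j) \<otimes> \<gamma> j) \<oplus> (finsum A d {..e} \<oplus> (k \<otimes> \<beta> 0 \<ominus> \<beta> 0 \<otimes> k)) = \<zero>" .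
  moreover have "\<gamma> e = \<zero>" using k by (simp add: \<gamma>_def beta_last)
  moreover have "finsum A d {..e} \<oplus> (k \<otimes> \<beta> 0 \<ominus> \<beta> 0 \<otimes> k) \<in> K" using k dsum by simp
  ultimately have "\<gamma> j = \<zero>"
    using sparse_independent[OF \<gamma>] assms by blast
  then show ?thesis
    using assms by (simp add: \<gamma>_def)
qed

lemma basis_induct [consumes 1, case_names zero basis add]:
  assumes "y \<in> carrier A" "P \<zero>"
    and basis: "\<And>j k. \<lbrakk>j < p ^ e; k \<in> K\<rbrakk> \<Longrightarrow> P (x [^] j \<otimes> k)"
    and add: "\<And>y z. \<lbrakk>y \<in> carrier A; z \<in> carrier A; P y; P z\<rbrakk> \<Longrightarrow> P (y \<oplus> z)"
  shows "P y"
proof -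
  obtain c where c: "c \<in> {..<p ^ e} \<rightarrow> K" and y: "y = (\<Oplus>j\<in>{..<p ^ e}. x [^] j \<otimes> c j)"
    using expansion[OF assms(1)] by blast
  have "P (\<Oplus>j\<in>{..<k}. x [^] j \<otimes> c j)" if "k \<le> p ^ e" for k
    using that
  proof (induction k)
    case (Suc k)
    have ck: "c i \<in> K" if "i \<le> k" for i using c Suc.prems that by auto
    have "{..<Suc k} = insert k {..<k}" by auto
    moreover have "P (x [^] k \<otimes> c k \<oplus> (\<Oplus>j\<in>{..<k}. x [^] j \<otimes> c j))"
      using Suc ck by (intro add basis finsum_closed) auto
    ultimately show ?case
      using ck by (simp add: Pi_iff)
  qed (use \<open>P \<zero>\<close> in simp)
  then show ?thesis unfolding y by simp
qed

lemma generated_induct [consumes 1, case_names base x add mult]: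
  assumes y: "y \<in> carrier A"
    and base: "\<And>k. k \<in> K \<Longrightarrow> P k" and x: "P x"
    and add: "\<And>y z. \<lbrakk>y \<in> carrier A; z \<in> carrier A; P y; P z\<rbrakk> \<Longrightarrow> P (y \<oplus> z)"
    and mult: "\<And>y z. \<lbrakk>y \<in> carrier A; z \<in> carrier A; P y; P z\<rbrakk> \<Longrightarrow> P (y \<otimes> z)"
  shows "P y"
  using y
proof (induction rule: basis_induct)
  case (basis j k)
  have "P (x [^] j)"
    by (induction j) (simp_all add: base x mult)
  then show ?case using basis by (auto intro: mult base)
qed (auto intro: base add)

end

locale p_polynomial_module = p_polynomial_extension + two_sided_module
begin

definition V where "V = {m \<in> carrier M. \<forall>k\<in>K. lact M k m = ract M m k}"

definition tau where
  "tau m = (\<Otimes>\<^bsub>M\<^esub>j\<in>{..e}. ract M ((ad x ^^ (p ^ j - 1)) m) (\<beta> (Suc j)))"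

lemma V_carrier [simp]: "m \<in> V \<Longrightarrow> m \<in> carrier M"
  unfolding V_def by blast

lemma VI: "\<lbrakk>m \<in> carrier M; \<And>k. k \<in> K \<Longrightarrow> lact M k m = ract M m k\<rbrakk> \<Longrightarrow> m \<in> V"
  unfolding V_def by blast

lemma V_commutes: "\<lbrakk>m \<in> V; k \<in> K\<rbrakk> \<Longrightarrow> lact M k m = ract M m k"
  unfolding V_def by blast

text \<open>For \<open>k\<close> in \<open>K\<close> the elements \<open>k x\<close> and \<open>x k\<close> differ by an element of \<open>K\<close>, which commutes with \<open>m\<close> and
  cancels in \<open>m (k x) - (k x) m\<close>.\<close>

lemma ad_V: 
  assumes m: "m \<in> V"
  shows "ad x m \<in> V"
proof -
  have "lact M k (ad x m) = ract M (ad x m) k" if k: "k \<in> K" for k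
  proof -
    let ?d = "reg.ad x k"
    have d: "?d \<in> K" using k by (rule ad_K)
    have "lact M k (ad x m) = ract M (ract M m k) x \<otimes>\<^bsub>M\<^esub> inv\<^bsub>M\<^esub> lact M (k \<otimes> x) m"
      using m k V_commutes[OF m k]
      by (simp add: ad_def lact_mult lact_inv lact_lact ract_lact[symmetric])
    also have "\<dots> = ract M m (x \<otimes> k \<oplus> ?d) \<otimes>\<^bsub>M\<^esub> inv\<^bsub>M\<^esub> lact M (x \<otimes> k \<oplus> ?d) m"
      using m k by (simp add: ract_ract K_times_x)
    also have "\<dots> = ract M (ract M m x) k \<otimes>\<^bsub>M\<^esub> lact M ?d m \<otimes>\<^bsub>M\<^esub>
        inv\<^bsub>M\<^esub> (ract M (lact M x m) k \<otimes>\<^bsub>M\<^esub> lact M ?d m)"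
      using m k d by (simp add: ract_add lact_add ract_ract lact_lact[symmetric] V_commutes ract_lact)
    also have "\<dots> = ract M (ad x m) k"
      using m k d
      by (simp add: ad_def ract_mult ract_inv M.inv_mult M.m_ac)
    finally show ?thesis .
  qed
  then show ?thesis using m by (intro VI) auto
qed

lemma ad_funpow_V: "m \<in> V \<Longrightarrow> (ad x ^^ i) m \<in> V"
  by (induction i) (auto simp: ad_V)

lemma V_mult: "\<lbrakk>m \<in> V; m' \<in> V\<rbrakk> \<Longrightarrow> m \<otimes>\<^bsub>M\<^esub> m' \<in> V"
  by (rule VI) (simp_all add: lact_mult ract_mult V_commutes)

lemma V_one: "\<one>\<^bsub>M\<^esub> \<in> V"
  by (rule VI) (simp_all add: lact_unit ract_unit)

lemma V_finprod: "\<lbrakk>finite I; g \<in> I \<rightarrow> V\<rbrakk> \<Longrightarrow> finprod M g I \<in> V"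
proof (induction I rule: finite_induct)
  case (insert i I)
  moreover have "g \<in> I \<rightarrow> carrier M" "g i \<in> carrier M" using insert by (auto simp: Pi_iff)
  ultimately show ?case by (simp add: V_mult)
qed (simp add: V_one)

lemma ract_beta_V: 
  assumes m: "m \<in> V" and j: "j \<le> e"
  shows "ract M m (\<beta> (Suc j)) \<in> V"
proof -
  have "lact M k (ract M m (\<beta> (Suc j))) = ract M (ract M m (\<beta> (Suc j))) k" if k: "k \<in> K" for k
    using m j k by (simp add: ract_lact[symmetric] V_commutes ract_ract beta_commutes_K)
  then show ?thesis using m j by (intro VI) auto
qed

lemma tau_V: "m \<in> V \<Longrightarrow> tau m \<in> V"
  unfolding tau_def by (intro V_finprod) (auto simp: ract_beta_V ad_funpow_V)

lemma tau_closed [simp]: "m \<in> carrier M \<Longrightarrow> tau m \<in> carrier M"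
  unfolding tau_def by (intro M.finprod_closed) auto

lemma tau_mult:
  "\<lbrakk>m \<in> carrier M; m' \<in> carrier M\<rbrakk> \<Longrightarrow> tau (m \<otimes>\<^bsub>M\<^esub> m') = tau m \<otimes>\<^bsub>M\<^esub> tau m'"
proof -
  assume m: "m \<in> carrier M" "m' \<in> carrier M"
  have "(ad x ^^ i) (m \<otimes>\<^bsub>M\<^esub> m') = (ad x ^^ i) m \<otimes>\<^bsub>M\<^esub> (ad x ^^ i) m'" for i
    using m by (induction i) (auto simp: ad_mult)
  then show ?thesis
    using m unfolding tau_def
    by (subst M.finprod_multf[symmetric]) (auto simp: ract_mult simp del: M.finprod_multf intro!: M.finprod_cong')
qed

lemma Suc_pred_prime_power: "Suc (p ^ j - 1) = p ^ j"
  using p_gt_1 by simp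

text \<open>By the Frobenius formula the sum is \<open>m F - F m\<close>, and \<open>F = - \<beta>\<^sub>0\<close> commutes with \<open>m\<close>.\<close>

lemma ad_tau_sum:
  assumes m: "m \<in> V"
  shows "(\<Otimes>\<^bsub>M\<^esub>j\<in>{..e}. ract M ((ad x ^^ (p ^ j)) m) (\<beta> (Suc j))) = \<one>\<^bsub>M\<^esub>"
proof -
  have mc: "m \<in> carrier M" using m by simp
  have "(\<Otimes>\<^bsub>M\<^esub>j\<in>{..e}. ract M ((ad x ^^ (p ^ j)) m) (\<beta> (Suc j)))
      = (\<Otimes>\<^bsub>M\<^esub>j\<in>{..e}. ract M m (x [^] (p ^ j) \<otimes> \<beta> (Suc j)) \<otimes>\<^bsub>M\<^esub>
          inv\<^bsub>M\<^esub> lact M (x [^] (p ^ j) \<otimes> \<beta> (Suc j)) m)"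
    using mc m by (intro M.finprod_cong')
      (auto simp: ad_prime_power[OF prime_p char_p] ract_mult ract_inv ract_ract ract_lact
        lact_lact[symmetric] V_commutes)
  also have "\<dots> = ract M m F \<otimes>\<^bsub>M\<^esub> inv\<^bsub>M\<^esub> lact M F m"
    using mc by (subst M.finprod_multf) (auto simp: M.finprod_inv ract_finsum lact_finsum Pi_iff)
  also have "\<dots> = \<one>\<^bsub>M\<^esub>"
    using mc m by (simp add: F_eq ract_uminus lact_uminus V_commutes M.l_inv)
  finally show ?thesis .
qed

lemma ad_tau:
  assumes m: "m \<in> V"
  shows "ad x (tau m) = \<one>\<^bsub>M\<^esub>"
proof -
  have "ad x (tau m) = (\<Otimes>\<^bsub>M\<^esub>j\<in>{..e}. ract M ((ad x ^^ Suc (p ^ j - 1)) m) (\<beta> (Suc j)))"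
    unfolding tau_def using m
    by (subst M.endo_finprod[OF ad_hom]) (auto simp: ad_ract beta_commutes_x intro!: M.finprod_cong')
  then show ?thesis using ad_tau_sum[OF m] by (simp only: Suc_pred_prime_power)
qed

lemma tau_ad:
  assumes m: "m \<in> V"
  shows "tau (ad x m) = \<one>\<^bsub>M\<^esub>"
proof -
  have "(ad x ^^ (p ^ j - 1)) (ad x m) = (ad x ^^ (p ^ j)) m" for j
    using funpow_swap1[of "ad x" "p ^ j - 1" m] Suc_pred_prime_power[of j]
    by (metis funpow.simps(2) o_apply)
  then show ?thesis unfolding tau_def by (simp add: ad_tau_sum[OF m])
qed

lemma tau_power_derivative:
  assumes m: "m \<in> carrier M"
  shows "tau m = (\<Otimes>\<^bsub>M\<^esub>j\<in>{..e}. ract M (power_derivative x m (p ^ j)) (\<beta> (Suc j)))"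
  unfolding tau_def using m by (simp add: power_derivative_prime_power[OF prime_p char_p])

text \<open>The element \<open>\<tau> m\<close> commutes with \<open>K\<close> and, as \<open>ad (\<tau> m) = 0\<close>, with \<open>x\<close>; together they generate \<open>A\<close>.\<close>

lemma tau_commutes:
  assumes m: "m \<in> V" and y: "y \<in> carrier A"
  shows "lact M y (tau m) = ract M (tau m) y"
  using y
proof (induction rule: generated_induct)
  case (base k)
  then show ?case using tau_V[OF m] by (simp add: V_commutes)
next
  case x
  show ?case
    using ad_tau[OF m] m by (simp add: ad_def M.inv_solve_right')
next
  case (add y z)
  then show ?case using m by (simp add: lact_add ract_add)
next
  case (mult y z)
  then show ?case using m by (simp add: lact_lact[symmetric] ract_ract[symmetric] ract_lact[symmetric])
qed

end

sublocale p_polynomial_extension \<subseteq> reg: p_polynomial_module A K x p e \<beta> "sub_bimodule A (carrier A)"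
  by unfold_locales

section \<open>Derivations of the extension over its base ring\<close>

context p_polynomial_extension
begin

definition coordinates :: "'a \<Rightarrow> nat \<Rightarrow> 'a"
  where "coordinates y =
    (SOME c. c \<in> {..<p ^ e} \<rightarrow> K \<and> y = (\<Oplus>j\<in>{..<p ^ e}. x [^] j \<otimes> c j))"

lemma coordinates_expand:
  assumes "y \<in> carrier A"
  shows "coordinates y \<in> {..<p ^ e} \<rightarrow> K" "y = (\<Oplus>j\<in>{..<p ^ e}. x [^] j \<otimes> coordinates y j)"
proof -
  have "\<exists>c. c \<in> {..<p ^ e} \<rightarrow> K \<and> y = (\<Oplus>j\<in>{..<p ^ e}. x [^] j \<otimes> c j)"
    using expansion[OF assms] by blast
  then have "coordinates y \<in> {..<p ^ e} \<rightarrow> K \<and> y = (\<Oplus>j\<in>{..<p ^ e}. x [^] j \<otimes> coordinates y j)"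
    unfolding coordinates_def by (rule someI_ex)
  then show "coordinates y \<in> {..<p ^ e} \<rightarrow> K" "y = (\<Oplus>j\<in>{..<p ^ e}. x [^] j \<otimes> coordinates y j)"
    by blast+
qed

lemma coordinates_K [simp]: "\<lbrakk>y \<in> carrier A; j < p ^ e\<rbrakk> \<Longrightarrow> coordinates y j \<in> K"
  using coordinates_expand(1) by (auto simp: Pi_iff)

lemma coordinates_eqI:
  assumes c: "c \<in> {..<p ^ e} \<rightarrow> K" and y: "y = (\<Oplus>j\<in>{..<p ^ e}. x [^] j \<otimes> c j)" and j: "j < p ^ e"
  shows "coordinates y j = c j"
proof -
  have cc: "j < p ^ e \<Longrightarrow> c j \<in> K" for j using c by auto
  have yc: "y \<in> carrier A" unfolding y using cc by (intro finsum_closed) auto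
  define c' where "c' j = coordinates y j \<ominus> c j" for j
  have c'K: "j < p ^ e \<Longrightarrow> c' j \<in> K" for j
    using yc cc by (simp add: c'_def)
  have "(\<Oplus>j\<in>{..<p ^ e}. x [^] j \<otimes> c' j) \<oplus> y = (\<Oplus>j\<in>{..<p ^ e}. x [^] j \<otimes> c' j \<oplus> x [^] j \<otimes> c j)"
    unfolding y using cc c'K by (subst finsum_addf) auto
  also have "\<dots> = (\<Oplus>j\<in>{..<p ^ e}. x [^] j \<otimes> coordinates y j)"
    using yc cc by (intro finsum_cong') (auto simp: c'_def r_distr[symmetric] diff_add_cancel)
  also have "\<dots> = \<zero> \<oplus> y"
    using coordinates_expand(2)[OF yc] yc by simp
  finally have "(\<Oplus>j\<in>{..<p ^ e}. x [^] j \<otimes> c' j) = \<zero>"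
    using yc c'K by (subst (asm) add.r_cancel) (auto intro!: finsum_closed)
  then have "c' j = \<zero>"
    using c'K j by (intro independent[of c']) auto
  then show ?thesis using yc cc j by (simp add: c'_def)
qed

lemma coordinates_add:
  assumes y: "y \<in> carrier A" and z: "z \<in> carrier A" and j: "j < p ^ e"
  shows "coordinates (y \<oplus> z) j = coordinates y j \<oplus> coordinates z j"
proof (rule coordinates_eqI[OF _ _ j])
  have "y \<oplus> z = (\<Oplus>j\<in>{..<p ^ e}. x [^] j \<otimes> coordinates y j) \<oplus> (\<Oplus>j\<in>{..<p ^ e}. x [^] j \<otimes> coordinates z j)"
    using coordinates_expand(2) y z by simp
  also have "\<dots> = (\<Oplus>j\<in>{..<p ^ e}. x [^] j \<otimes> (coordinates y j \<oplus> coordinates z j))"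
    using y z by (subst finsum_addf[symmetric]) (auto simp: r_distr simp del: finsum_addf intro!: finsum_cong')
  finally show "y \<oplus> z = \<dots>" .
qed (use y z in auto)

lemma coordinates_ract:
  assumes y: "y \<in> carrier A" and k: "k \<in> K" and j: "j < p ^ e"
  shows "coordinates (y \<otimes> k) j = coordinates y j \<otimes> k"
proof (rule coordinates_eqI[OF _ _ j])
  have "y \<otimes> k = (\<Oplus>j\<in>{..<p ^ e}. x [^] j \<otimes> coordinates y j) \<otimes> k"
    using coordinates_expand(2) y by simp
  also have "\<dots> = (\<Oplus>j\<in>{..<p ^ e}. x [^] j \<otimes> (coordinates y j \<otimes> k))"
    using y k by (subst finsum_ldistr) (auto simp: m_assoc intro!: finsum_cong')
  finally show "y \<otimes> k = \<dots>" .
qed (use y k in auto)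

lemma coordinates_power:
  assumes i: "i < p ^ e" and j: "j < p ^ e"
  shows "coordinates (x [^] i) j = (if j = i then \<one> else \<zero>)"
proof (rule coordinates_eqI[OF _ _ j])
  have "(\<Oplus>j\<in>{..<p ^ e}. x [^] j \<otimes> (if j = i then \<one> else \<zero>)) = (\<Oplus>j\<in>{..<p ^ e}. if j = i then x [^] j else \<zero>)"
    by (intro finsum_cong') auto
  also have "\<dots> = x [^] i"
    using i by (subst add.finprod_singleton_swap) auto
  finally show "x [^] i = (\<Oplus>j\<in>{..<p ^ e}. x [^] j \<otimes> (if j = i then \<one> else \<zero>))" by simp
qed auto

definition right_linear :: "(nat \<Rightarrow> 'a) \<Rightarrow> 'a \<Rightarrow> 'a"
  where "right_linear s y = (\<Oplus>j\<in>{..<p ^ e}. s j \<otimes> coordinates y j)"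

context
  fixes s :: "nat \<Rightarrow> 'a"
  assumes s [simp]: "\<And>j. s j \<in> carrier A"
begin

lemma right_linear_closed [simp]: "y \<in> carrier A \<Longrightarrow> right_linear s y \<in> carrier A"
  unfolding right_linear_def by (intro finsum_closed) auto

lemma right_linear_add:
  "\<lbrakk>y \<in> carrier A; z \<in> carrier A\<rbrakk> \<Longrightarrow> right_linear s (y \<oplus> z) = right_linear s y \<oplus> right_linear s z"
  unfolding right_linear_def
  by (subst finsum_addf[symmetric]) (auto simp: coordinates_add r_distr simp del: finsum_addf intro!: finsum_cong')

lemma right_linear_ract:
  "\<lbrakk>y \<in> carrier A; k \<in> K\<rbrakk> \<Longrightarrow> right_linear s (y \<otimes> k) = right_linear s y \<otimes> k"
  unfolding right_linear_def
  by (subst finsum_ldistr) (auto simp: coordinates_ract m_assoc intro!: finsum_cong')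

lemma right_linear_power:
  assumes j: "j < p ^ e"
  shows "right_linear s (x [^] j) = s j"
proof -
  have "right_linear s (x [^] j) = (\<Oplus>i\<in>{..<p ^ e}. if i = j then s i else \<zero>)"
    unfolding right_linear_def
    by (intro finsum_cong') (auto simp: coordinates_power[OF j])
  also have "\<dots> = s j"
    using j by (subst add.finprod_singleton_swap) auto
  finally show ?thesis .
qed

lemma right_linear_finsum:
  "\<lbrakk>finite I; g \<in> I \<rightarrow> carrier A\<rbrakk> \<Longrightarrow> right_linear s (finsum A g I) = (\<Oplus>i\<in>I. right_linear s (g i))"
  using add.endo_finprod[of "right_linear s" I g] by (simp add: hom_def right_linear_add)

lemma right_linear_zero: "right_linear s \<zero> = \<zero>"
  using right_linear_finsum[of "{}" "\<lambda>_. \<zero>"] by simp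

end

lemma power_root:
  "x [^] (p ^ e) = \<ominus> ((\<Oplus>j\<in>{..<e}. x [^] (p ^ j) \<otimes> \<beta> (Suc j)) \<oplus> \<beta> 0)"
proof -
  have "{..e} = insert e {..<e}" by auto
  then have "F = x [^] (p ^ e) \<oplus> (\<Oplus>j\<in>{..<e}. x [^] (p ^ j) \<otimes> \<beta> (Suc j))"
    by (simp add: Pi_iff beta_last)
  then show ?thesis
    using root by (intro minus_equality[symmetric]) (auto simp: a_assoc intro!: finsum_closed add.m_closed)
qed

text \<open>A right linear map with prescribed values \<open>s j\<close> on the basis takes the value \<open>s n\<close> also at \<open>x\<^sup>n\<close>, for \<open>n = p\<^sup>e\<close>, as
  soon as the sequence \<open>s\<close> respects the relation \<open>f(x) = 0\<close>.\<close>

lemma right_linear_degree: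
  assumes s [simp]: "\<And>j. s j \<in> carrier A" and s0: "s 0 = \<zero>"
    and sum0: "(\<Oplus>j\<in>{..e}. s (p ^ j) \<otimes> \<beta> (Suc j)) = \<zero>"
  shows "right_linear s (x [^] (p ^ e)) = s (p ^ e)"
proof -
  let ?z = "(\<Oplus>j\<in>{..<e}. x [^] (p ^ j) \<otimes> \<beta> (Suc j))"
  let ?t = "(\<Oplus>j\<in>{..<e}. s (p ^ j) \<otimes> \<beta> (Suc j))"
  have z: "?z \<in> carrier A" by (intro finsum_closed) auto
  have t: "?t \<in> carrier A" by (intro finsum_closed) auto
  have "{..e} = insert e {..<e}" by auto
  then have "s (p ^ e) \<oplus> ?t = \<zero>"
    using sum0 by (simp add: Pi_iff beta_last)
  then have 1: "s (p ^ e) = \<ominus> ?t"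
    using t by (simp add: minus_equality)
  have pj: "p ^ j < p ^ e" if "j < e" for j
    using that p_gt_1 by simp
  have "right_linear s ?z = ?t"
    by (subst right_linear_finsum)
      (auto simp: right_linear_ract right_linear_power pj intro!: finsum_cong')
  moreover have "right_linear s (\<beta> 0) = \<zero>"
    using right_linear_ract[of s \<one> "\<beta> 0"] right_linear_power[of s 0] p_gt_1 by (simp add: s0)
  ultimately have "right_linear s (x [^] (p ^ e) \<oplus> (?z \<oplus> \<beta> 0)) = right_linear s (x [^] (p ^ e)) \<oplus> ?t"
    using z t by (simp add: right_linear_add)
  moreover have "x [^] (p ^ e) \<oplus> (?z \<oplus> \<beta> 0) = \<zero>"
    using z by (simp add: power_root l_neg)
  ultimately have "right_linear s (x [^] (p ^ e)) \<oplus> ?t = \<zero>"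
    by (simp add: right_linear_zero)
  then show ?thesis
    using t 1 by (simp add: minus_equality)
qed

text \<open>On the basis the derivation has to be given by the Leibniz rule.  The condition \<open>\<tau> u = 0\<close> makes this
  rule valid at \<open>x\<^sup>n\<close> too, hence right multiplication by \<open>x\<close> obeys the Leibniz rule, and \<open>u\<close> being in
  \<open>V\<close> is what is needed to pull it through the coefficients.  The general Leibniz rule follows
  because \<open>A\<close> is generated by \<open>K\<close> and \<open>x\<close>.\<close>

lemma derivation_exists:
  assumes u: "u \<in> reg.V" and tau: "reg.tau u = \<zero>"
  obtains \<delta> where "ring_derivation A \<delta>" "\<And>k. k \<in> K \<Longrightarrow> \<delta> k = \<zero>" "\<delta> x = u"
proof
  \<comment> \<open>the values that the Leibniz rule forces at the powers of x\<close>
  define s where "s j = reg.power_derivative x u j" for j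
  have uc [simp]: "u \<in> carrier A" using reg.V_carrier[OF u] by simp
  have s [simp]: "s j \<in> carrier A" for j
    using reg.power_derivative_closed[of x u j] by (simp add: s_def)
  have s0: "s 0 = \<zero>" and s_Suc: "s (Suc j) = s j \<otimes> x \<oplus> x [^] j \<otimes> u" for j
    by (simp_all add: s_def)
  have s1: "s 1 = u" using s_Suc[of 0] s0 by simp
  have s_deg: "right_linear s (x [^] (p ^ e)) = s (p ^ e)"
    using tau reg.tau_power_derivative[of u] by (intro right_linear_degree s s0) (simp add: s_def)
  have s_pow: "right_linear s (x [^] j) = s j" if "j \<le> p ^ e" for j
    using that s_deg right_linear_power[OF s, of j] by (cases "j = p ^ e") auto
  have s_pow_x: "right_linear s (x [^] j \<otimes> x) = s (Suc j)" if "j < p ^ e" for j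
    using s_pow[of "Suc j"] that by simp
  let ?\<delta> = "right_linear s"
  have K0: "?\<delta> k = \<zero>" if "k \<in> K" for k
    using right_linear_ract[OF s, of \<one> k] s_pow[of 0] that by (simp add: s0)
  have x1: "?\<delta> x = u"
    using s_pow[of 1] degree_gt_1 s1 by simp
  have mult_x: "?\<delta> (y \<otimes> x) = ?\<delta> y \<otimes> x \<oplus> y \<otimes> u" if "y \<in> carrier A" for y
    using that
  proof (induction rule: basis_induct)
    case zero
    then show ?case by (simp add: right_linear_zero)
  next
    case (basis j k)
    have d: "reg.ad x k \<in> K" using basis ad_K by simp
    have "x [^] j \<otimes> k \<otimes> x = x [^] Suc j \<otimes> k \<oplus> x [^] j \<otimes> reg.ad x k"
      using basis d by (simp add: m_assoc K_times_x r_distr)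
    then have "?\<delta> (x [^] j \<otimes> k \<otimes> x) = s (Suc j) \<otimes> k \<oplus> s j \<otimes> reg.ad x k"
      using basis d by (simp add: right_linear_add right_linear_ract s_pow s_pow_x)
    also have "\<dots> = s j \<otimes> (x \<otimes> k \<oplus> reg.ad x k) \<oplus> x [^] j \<otimes> (u \<otimes> k)"
      using basis d by (simp add: s_Suc l_distr r_distr m_assoc a_ac)
    also have "\<dots> = s j \<otimes> k \<otimes> x \<oplus> x [^] j \<otimes> k \<otimes> u"
      using basis d reg.V_commutes[OF u] by (simp add: K_times_x[symmetric] m_assoc)
    finally show ?case
      using basis by (simp add: right_linear_ract s_pow)
  next
    case (add y z)
    then show ?case by (simp add: l_distr right_linear_add a_ac)
  qed
  have "?\<delta> (y \<otimes> z) = ?\<delta> y \<otimes> z \<oplus> y \<otimes> ?\<delta> z" if y: "y \<in> carrier A" and z: "z \<in> carrier A" for y z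
    using z y
  proof (induction arbitrary: y rule: generated_induct)
    case (base k)
    then show ?case by (simp add: right_linear_ract K0)
  next
    case x
    then show ?case by (simp add: mult_x x1)
  next
    case (add z z')
    then show ?case by (simp add: r_distr right_linear_add a_ac)
  next
    case (mult z z')
    then have "?\<delta> (y \<otimes> z \<otimes> z') = (?\<delta> y \<otimes> z \<oplus> y \<otimes> ?\<delta> z) \<otimes> z' \<oplus> y \<otimes> z \<otimes> ?\<delta> z'"
      by simp
    moreover have "?\<delta> (z \<otimes> z') = ?\<delta> z \<otimes> z' \<oplus> z \<otimes> ?\<delta> z'"
      using mult by simp
    ultimately show ?case using mult.hyps mult.prems
      by (simp add: m_assoc l_distr r_distr a_ac)
  qed
  then show "ring_derivation A ?\<delta>"
    by (intro ring_derivationI) (auto simp: right_linear_add)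
  show "?\<delta> k = \<zero>" if "k \<in> K" for k using K0 that .
  show "?\<delta> x = u" by (rule x1)
qed

lemma reg_V: "reg.V = centralizer_in A K"
  unfolding reg.V_def centralizer_in_def sub_bimodule_simps by (rule refl)

text \<open>Apply the derivation to \<open>k x = x k + ad k\<close> and to \<open>f(x) = 0\<close>.\<close>

lemma derivation_value:
  assumes der: "ring_derivation A \<delta>" and K0: "\<And>k. k \<in> K \<Longrightarrow> \<delta> k = \<zero>"
  shows "\<delta> x \<in> reg.V" "reg.tau (\<delta> x) = \<zero>"
proof -
  interpret derivation A \<delta>
    by unfold_locales (rule der)
  show V: "\<delta> x \<in> reg.V"
  proof (rule reg.VI)
    fix k assume k: "k \<in> K"
    then have "\<delta> (k \<otimes> x) = \<delta> (x \<otimes> k \<oplus> reg.ad x k)" by (simp add: K_times_x)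
    then show "lact (sub_bimodule A (carrier A)) k (\<delta> x) = ract (sub_bimodule A (carrier A)) (\<delta> x) k"
      using k ad_K[OF k] by (simp add: d_mult d_add K0)
  qed simp
  have pow: "\<delta> (x [^] k) = reg.power_derivative x (\<delta> x) k" for k :: nat
    by (induction k) (simp_all add: d_mult K0)
  have "reg.tau (\<delta> x) = (\<Oplus>j\<in>{..e}. \<delta> (x [^] (p ^ j)) \<otimes> \<beta> (Suc j))"
    using V by (subst reg.tau_power_derivative) (simp_all add: pow)
  also have "\<dots> = (\<Oplus>j\<in>{..e}. \<delta> (x [^] (p ^ j) \<otimes> \<beta> (Suc j)))"
    by (intro finsum_cong') (auto simp: d_mult K0)
  also have "\<dots> = \<delta> F"
    by (rule d_finsum[symmetric]) auto
  also have "\<dots> = \<zero>"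
    by (simp add: F_eq K0)
  finally show "reg.tau (\<delta> x) = \<zero>" .
qed

text \<open>The derivation \<open>y \<mapsto> v y - y v\<close> vanishes on \<open>K\<close> iff \<open>v\<close> is in \<open>V\<close>, and its value at \<open>x\<close> is \<open>ad v\<close>.\<close>

theorem weakly_separable_iff:
  "weakly_separable_ext A K \<longleftrightarrow>
    (\<forall>u\<in>reg.V. reg.tau u = \<zero> \<longrightarrow> (\<exists>v\<in>reg.V. reg.ad x v = u))"
proof
  assume weak: "weakly_separable_ext A K"
  show "\<forall>u\<in>reg.V. reg.tau u = \<zero> \<longrightarrow> (\<exists>v\<in>reg.V. reg.ad x v = u)"
  proof (intro ballI impI)
    fix u assume "u \<in> reg.V" "reg.tau u = \<zero>"
    then obtain \<delta> where \<delta>: "ring_derivation A \<delta>" "\<And>k. k \<in> K \<Longrightarrow> \<delta> k = \<zero>" "\<delta> x = u"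
      using derivation_exists by blast
    have "\<exists>v\<in>carrier A. \<forall>y\<in>carrier A. \<delta> y = v \<otimes> y \<ominus> y \<otimes> v"
      using weak[unfolded weakly_separable_ext_def, rule_format, of \<delta>] \<delta>(1,2) by simp
    then obtain v where v: "v \<in> carrier A" "\<And>y. y \<in> carrier A \<Longrightarrow> \<delta> y = v \<otimes> y \<ominus> y \<otimes> v"
      by auto
    have "v \<in> reg.V"
    proof (rule reg.VI)
      fix k assume k: "k \<in> K"
      then have "v \<otimes> k \<ominus> k \<otimes> v = \<zero>" using \<delta>(2) v(2) by fastforce
      then show "lact (sub_bimodule A (carrier A)) k v = ract (sub_bimodule A (carrier A)) v k"
        using k v(1) by simp
    qed (simp add: v)
    moreover have "reg.ad x v = u"
      using v(2)[OF x_closed] \<delta>(3) by (simp add: reg_ad)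
    ultimately show "\<exists>v\<in>reg.V. reg.ad x v = u" by blast
  qed
next
  assume *: "\<forall>u\<in>reg.V. reg.tau u = \<zero> \<longrightarrow> (\<exists>v\<in>reg.V. reg.ad x v = u)"
  show "weakly_separable_ext A K"
    unfolding weakly_separable_ext_def
  proof (intro allI impI, elim conjE)
    fix \<delta> assume der: "ring_derivation A \<delta>" and "\<forall>k\<in>K. \<delta> k = \<zero>"
    then have K0: "\<And>k. k \<in> K \<Longrightarrow> \<delta> k = \<zero>" by blast
    interpret derivation A \<delta>
      by unfold_locales (rule der)
    obtain v where v: "v \<in> reg.V" "reg.ad x v = \<delta> x"
      using * derivation_value[OF der K0] by blast
    have vc: "v \<in> carrier A" using reg.V_carrier[OF v(1)] by simp
    have "\<delta> y \<oplus> y \<otimes> v = v \<otimes> y" if "y \<in> carrier A" for y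
      using that
    proof (induction rule: generated_induct)
      case (base k)
      then show ?case using vc reg.V_commutes[OF v(1)] by (simp add: K0)
    next
      case x
      then show ?case using vc v(2) by (simp add: reg_ad diff_add_cancel flip: v(2))
    next
      case (add y z)
      have "\<delta> (y \<oplus> z) \<oplus> (y \<oplus> z) \<otimes> v = (\<delta> y \<oplus> y \<otimes> v) \<oplus> (\<delta> z \<oplus> z \<otimes> v)"
        using add.hyps vc by (simp add: d_add l_distr a_ac)
      then show ?case using add vc by (simp add: r_distr)
    next
      case (mult y z)
      have "\<delta> (y \<otimes> z) \<oplus> y \<otimes> z \<otimes> v = \<delta> y \<otimes> z \<oplus> y \<otimes> (\<delta> z \<oplus> z \<otimes> v)"
        using mult.hyps vc by (simp add: d_mult r_distr m_assoc a_ac)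
      also have "\<dots> = (\<delta> y \<oplus> y \<otimes> v) \<otimes> z"
        using mult.hyps vc unfolding mult.IH(2) by (simp add: l_distr m_assoc)
      also have "\<dots> = v \<otimes> (y \<otimes> z)"
        using mult vc by (simp add: m_assoc)
      finally show ?case .
    qed
    then have "\<delta> y = v \<otimes> y \<ominus> y \<otimes> v" if "y \<in> carrier A" for y
      using that vc by (metis a_minus_def add.inv_solve_right' d_closed m_closed)
    then show "\<exists>u\<in>carrier A. \<forall>y\<in>carrier A. \<delta> y = u \<otimes> y \<ominus> y \<otimes> u"
      using vc by blast
  qed
qed

end

section \<open>The highest coordinate\<close>

context p_polynomial_extension
begin

text \<open>This is the functional \<open>\<kappa>\<close> of the introduction.\<close>

definition top_coeff :: "'a \<Rightarrow> 'a" where "top_coeff y = coordinates y (p ^ e - 1)"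

lemma degree_pred: "p ^ e - 1 < p ^ e"
  using degree_gt_1 by simp

lemma top_K [simp]: "y \<in> carrier A \<Longrightarrow> top_coeff y \<in> K"
  by (simp add: top_coeff_def degree_pred del: One_nat_def)

lemma top_add: "\<lbrakk>y \<in> carrier A; z \<in> carrier A\<rbrakk> \<Longrightarrow> top_coeff (y \<oplus> z) = top_coeff y \<oplus> top_coeff z"
  unfolding top_coeff_def by (rule coordinates_add[OF _ _ degree_pred])

lemma top_hom: "top_coeff \<in> hom (add_monoid A) (add_monoid A)"
  by (simp add: hom_def top_add)

lemma top_zero: "top_coeff \<zero> = \<zero>"
  using hom_one[OF top_hom] add.is_group by simp

lemma top_ract: "\<lbrakk>y \<in> carrier A; k \<in> K\<rbrakk> \<Longrightarrow> top_coeff (y \<otimes> k) = top_coeff y \<otimes> k"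
  unfolding top_coeff_def using degree_pred by (intro coordinates_ract)

lemma top_power: "j < p ^ e \<Longrightarrow> top_coeff (x [^] j) = (if j = p ^ e - 1 then \<one> else \<zero>)"
  unfolding top_coeff_def using degree_pred by (subst coordinates_power) auto

text \<open>The polynomials in \<open>x\<close> of degree less than \<open>j\<close>, described by closure properties so that they can be
  handled by rule induction.\<close>

inductive_set lower_terms :: "nat \<Rightarrow> 'a set" for j where
  low_zero: "\<zero> \<in> lower_terms j"
| low_basis: "\<lbrakk>i < j; k \<in> K\<rbrakk> \<Longrightarrow> x [^] i \<otimes> k \<in> lower_terms j"
| low_add: "\<lbrakk>y \<in> lower_terms j; z \<in> lower_terms j\<rbrakk> \<Longrightarrow> y \<oplus> z \<in> lower_terms j"

lemma low_carrier: "y \<in> lower_terms j \<Longrightarrow> y \<in> carrier A"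
  by (induction rule: lower_terms.induct) auto

lemma low_times_x:
  assumes "y \<in> lower_terms j"
  shows "y \<otimes> x \<in> lower_terms (Suc j)"
  using assms
proof (induction rule: lower_terms.induct)
  case (low_basis i k)
  then have "x [^] i \<otimes> k \<otimes> x = x [^] Suc i \<otimes> k \<oplus> x [^] i \<otimes> reg.ad x k"
    using ad_K[of k] by (simp add: m_assoc K_times_x r_distr)
  moreover have "x [^] Suc i \<otimes> k \<in> lower_terms (Suc j)" "x [^] i \<otimes> reg.ad x k \<in> lower_terms (Suc j)"
    using low_basis ad_K[of k] lower_terms.low_basis[of "Suc i" "Suc j" k] by (auto intro: lower_terms.intros)
  ultimately show ?case
    by (metis low_add)
qed (auto simp: l_distr low_carrier intro: lower_terms.intros)

text \<open>Moving a constant to the right of a power of \<open>x\<close> changes only the lower terms.  Therefore the highest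
  coefficient is left linear as well as right linear over \<open>K\<close>.\<close>

lemma K_times_power_low:
  assumes k: "k \<in> K"
  shows "\<exists>y\<in>lower_terms j. k \<otimes> x [^] j = x [^] j \<otimes> k \<oplus> y"
proof (induction j)
  case 0
  then show ?case using k by (auto intro!: bexI[of _ \<zero>] lower_terms.intros)
next
  case (Suc j)
  then obtain y where y: "y \<in> lower_terms j" "k \<otimes> x [^] j = x [^] j \<otimes> k \<oplus> y" by blast
  note c = low_carrier[OF y(1)] 
  have "k \<otimes> x [^] Suc j = (k \<otimes> x [^] j) \<otimes> x" using k by (simp add: m_assoc)
  also have "\<dots> = x [^] j \<otimes> (x \<otimes> k \<oplus> reg.ad x k) \<oplus> y \<otimes> x"
    unfolding y(2) using k c by (simp add: l_distr m_assoc K_times_x)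
  also have "\<dots> = x [^] Suc j \<otimes> k \<oplus> (x [^] j \<otimes> reg.ad x k \<oplus> y \<otimes> x)"
    using k c ad_K[OF k] by (simp add: r_distr m_assoc a_assoc)
  finally have "k \<otimes> x [^] Suc j = \<dots>" .
  moreover have "x [^] j \<otimes> reg.ad x k \<oplus> y \<otimes> x \<in> lower_terms (Suc j)"
    using low_times_x[OF y(1)] ad_K[OF k] by (auto intro: lower_terms.intros)
  ultimately show ?case by blast
qed

lemma top_low:
  assumes "y \<in> lower_terms j" "j \<le> p ^ e - 1"
  shows "top_coeff y = \<zero>"
  using assms
  by (induction rule: lower_terms.induct) (auto simp: top_zero top_add low_carrier top_ract top_power)

lemma top_lact:
  assumes "y \<in> carrier A" and k: "k \<in> K"
  shows "top_coeff (k \<otimes> y) = k \<otimes> top_coeff y"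
  using assms(1)
proof (induction rule: basis_induct)
  case (basis j c)
  obtain y where y: "y \<in> lower_terms j" "k \<otimes> x [^] j = x [^] j \<otimes> k \<oplus> y"
    using K_times_power_low[OF k] by blast
  have "top_coeff (k \<otimes> (x [^] j \<otimes> c)) = top_coeff ((k \<otimes> x [^] j) \<otimes> c)"
    using basis k by (simp add: m_assoc)
  also have "\<dots> = top_coeff (x [^] j) \<otimes> k \<otimes> c"
    unfolding y(2) using basis k low_carrier[OF y(1)] top_low[OF y(1)]
    by (simp add: top_ract top_add)
  also have "\<dots> = k \<otimes> top_coeff (x [^] j \<otimes> c)"
    using basis k by (simp add: top_ract top_power)
  finally show ?case .
qed (use k in \<open>auto simp: top_zero top_add r_distr\<close>)

text \<open>This is \<open>power_derivative\<close> in the bimodule of additive maps \<open>\<phi>\<close> of \<open>A\<close>, with \<open>(\<phi> z) y = \<phi>(y) z\<close> and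
  \<open>(z \<phi>) y = \<phi>(y z)\<close>, taken at the map \<open>top_coeff\<close> and evaluated at \<open>y\<close>.\<close>

primrec top_coeff_sum :: "'a \<Rightarrow> nat \<Rightarrow> 'a" where
  "top_coeff_sum y 0 = \<zero>"
| "top_coeff_sum y (Suc k) = top_coeff_sum y k \<otimes> x \<oplus> top_coeff (y \<otimes> x [^] k)"

lemma top_coeff_sum_closed [simp]: "y \<in> carrier A \<Longrightarrow> top_coeff_sum y k \<in> carrier A"
  by (induction k) auto

lemma top_coeff_sum_add:
  "\<lbrakk>y \<in> carrier A; z \<in> carrier A\<rbrakk> \<Longrightarrow> top_coeff_sum (y \<oplus> z) k = top_coeff_sum y k \<oplus> top_coeff_sum z k"
  by (induction k) (simp_all add: l_distr top_add a_ac)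

lemma top_coeff_sum_lact: "\<lbrakk>y \<in> carrier A; c \<in> K\<rbrakk> \<Longrightarrow> top_coeff_sum (c \<otimes> y) k = c \<otimes> top_coeff_sum y k"
  by (induction k) (simp_all add: top_lact r_distr m_assoc)

text \<open>The telescoping formula \<open>ad_power_derivative\<close> in this bimodule of maps.\<close>

lemma top_coeff_sum_x:
  assumes y: "y \<in> carrier A"
  shows "top_coeff_sum y k \<otimes> x \<oplus> top_coeff (y \<otimes> x [^] k) = top_coeff_sum (y \<otimes> x) k \<oplus> top_coeff y \<otimes> x [^] k"
proof (induction k)
  case 0
  then show ?case using y by simp
next
  case (Suc k)
  have "y \<otimes> x [^] Suc k = y \<otimes> x \<otimes> x [^] k"
    using y by (simp add: m_assoc reg.pow_comm_self)
  then have "top_coeff_sum y (Suc k) \<otimes> x \<oplus> top_coeff (y \<otimes> x [^] Suc k)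
      = (top_coeff_sum (y \<otimes> x) k \<oplus> top_coeff y \<otimes> x [^] k) \<otimes> x \<oplus> top_coeff (y \<otimes> x \<otimes> x [^] k)"
    using Suc by simp
  then show ?case
    using y by (simp add: l_distr m_assoc a_ac)
qed

lemma top_coeff_sum_one: "k \<le> p ^ e \<Longrightarrow> top_coeff_sum \<one> k = (if k = p ^ e then \<one> else \<zero>)"
  using p_gt_1 by (induction k) (auto simp: top_power)

text \<open>In the same bimodule this is \<open>\<tau>\<close> of the map \<open>top_coeff\<close>, evaluated at \<open>y\<close>.\<close>

definition top_reconstruction :: "'a \<Rightarrow> 'a" where
  "top_reconstruction y = (\<Oplus>j\<in>{..e}. top_coeff_sum y (p ^ j) \<otimes> \<beta> (Suc j))"

lemma top_reconstruction_closed [simp]: "y \<in> carrier A \<Longrightarrow> top_reconstruction y \<in> carrier A"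
  unfolding top_reconstruction_def by (intro finsum_closed) auto

lemma top_reconstruction_add:
  "\<lbrakk>y \<in> carrier A; z \<in> carrier A\<rbrakk> \<Longrightarrow> top_reconstruction (y \<oplus> z) = top_reconstruction y \<oplus> top_reconstruction z"
  unfolding top_reconstruction_def
  by (subst finsum_addf[symmetric])
    (auto simp: top_coeff_sum_add l_distr simp del: finsum_addf intro!: finsum_cong')

lemma top_reconstruction_lact: "\<lbrakk>y \<in> carrier A; c \<in> K\<rbrakk> \<Longrightarrow> top_reconstruction (c \<otimes> y) = c \<otimes> top_reconstruction y"
  unfolding top_reconstruction_def
  by (subst finsum_rdistr) (auto simp: top_coeff_sum_lact m_assoc intro!: finsum_cong')

text \<open>The map commutes with \<open>x\<close> for the reason that makes every value of \<open>\<tau>\<close> commute with \<open>x\<close>: the difference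
  of both sides is \<open>\<kappa>(y) F - \<kappa>(y F)\<close>, and \<open>F = - \<beta>\<^sub>0\<close> is in \<open>K\<close>.\<close>

lemma top_reconstruction_x:
  assumes y: "y \<in> carrier A"
  shows "top_reconstruction (y \<otimes> x) = top_reconstruction y \<otimes> x"
proof -
  have "top_reconstruction y \<otimes> x = (\<Oplus>j\<in>{..e}. top_coeff_sum y (p ^ j) \<otimes> x \<otimes> \<beta> (Suc j))"
    unfolding top_reconstruction_def using y
    by (subst finsum_ldistr) (auto simp: m_assoc beta_commutes_x intro!: finsum_cong')
  moreover have "top_coeff (y \<otimes> F) = (\<Oplus>j\<in>{..e}. top_coeff (y \<otimes> x [^] (p ^ j)) \<otimes> \<beta> (Suc j))"
    using y add.endo_finprod[OF top_hom, of "{..e}" "\<lambda>j. y \<otimes> (x [^] (p ^ j) \<otimes> \<beta> (Suc j))"]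
    by (subst finsum_rdistr) (auto simp: top_ract[symmetric] m_assoc Pi_iff intro!: finsum_cong')
  ultimately have "top_reconstruction y \<otimes> x \<oplus> top_coeff (y \<otimes> F)
      = (\<Oplus>j\<in>{..e}. top_coeff_sum y (p ^ j) \<otimes> x \<otimes> \<beta> (Suc j) \<oplus> top_coeff (y \<otimes> x [^] (p ^ j)) \<otimes> \<beta> (Suc j))"
    using y by (subst finsum_addf) auto
  also have "\<dots> = (\<Oplus>j\<in>{..e}. top_coeff_sum (y \<otimes> x) (p ^ j) \<otimes> \<beta> (Suc j) \<oplus> top_coeff y \<otimes> (x [^] (p ^ j) \<otimes> \<beta> (Suc j)))"
  proof (rule finsum_cong')
    fix j assume j: "j \<in> {..e}"
    then have "top_coeff_sum y (p ^ j) \<otimes> x \<otimes> \<beta> (Suc j) \<oplus> top_coeff (y \<otimes> x [^] (p ^ j)) \<otimes> \<beta> (Suc j)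
        = (top_coeff_sum y (p ^ j) \<otimes> x \<oplus> top_coeff (y \<otimes> x [^] (p ^ j))) \<otimes> \<beta> (Suc j)"
      using y by (simp add: l_distr)
    then show "top_coeff_sum y (p ^ j) \<otimes> x \<otimes> \<beta> (Suc j) \<oplus> top_coeff (y \<otimes> x [^] (p ^ j)) \<otimes> \<beta> (Suc j)
        = top_coeff_sum (y \<otimes> x) (p ^ j) \<otimes> \<beta> (Suc j) \<oplus> top_coeff y \<otimes> (x [^] (p ^ j) \<otimes> \<beta> (Suc j))"
      unfolding top_coeff_sum_x[OF y] using y j by (simp add: l_distr m_assoc)
  qed (use y in auto)
  also have "\<dots> = top_reconstruction (y \<otimes> x) \<oplus> top_coeff y \<otimes> F"
    unfolding top_reconstruction_def using y by (subst finsum_addf) (auto simp: finsum_rdistr Pi_iff)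
  finally have "top_reconstruction y \<otimes> x \<oplus> top_coeff (y \<otimes> F) = top_reconstruction (y \<otimes> x) \<oplus> top_coeff y \<otimes> F" .
  moreover have "top_coeff (y \<otimes> F) = top_coeff y \<otimes> F"
    unfolding F_eq using y by (simp add: top_ract)
  ultimately show ?thesis
    using y add.r_cancel[of "top_coeff y \<otimes> F" "top_reconstruction y \<otimes> x" "top_reconstruction (y \<otimes> x)"] by simp
qed

text \<open>Only \<open>j = e\<close> and the highest power contribute, by \<open>\<kappa>(x\<^sup>i) = 0\<close> for \<open>i < n - 1\<close>.\<close>

lemma top_reconstruction_one: "top_reconstruction \<one> = \<one>"
proof -
  have "top_reconstruction \<one> = (\<Oplus>j\<in>{..e}. if j = e then \<one> else \<zero>)"
    unfolding top_reconstruction_def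
  proof (rule finsum_cong')
    fix j assume "j \<in> {..e}"
    then show "top_coeff_sum \<one> (p ^ j) \<otimes> \<beta> (Suc j) = (if j = e then \<one> else \<zero>)"
      using p_gt_1 by (auto simp: top_coeff_sum_one power_increasing beta_last)
  qed auto
  also have "\<dots> = \<one>"
    by (subst add.finprod_singleton_swap) auto
  finally show ?thesis .
qed

text \<open>A left \<open>K\<close>-linear map that commutes with right multiplication by \<open>x\<close> and fixes \<open>1\<close> fixes every \<open>k x\<^sup>j\<close>,
  and these elements span \<open>A\<close>.\<close>

lemma top_reconstruction_identity:
  assumes "y \<in> carrier A"
  shows "top_reconstruction y = y"
proof -
  have fixed: "top_reconstruction (x [^] j \<otimes> k) = x [^] j \<otimes> k" if "k \<in> K" for j :: nat and k
    using that
  proof (induction j arbitrary: k)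
    case 0
    then show ?case using top_reconstruction_lact[of \<one> k] by (simp add: top_reconstruction_one)
  next
    case (Suc j)
    have d: "reg.ad x k \<in> K" using Suc.prems by (rule ad_K)
    have eq: "x [^] j \<otimes> k \<otimes> x = x [^] Suc j \<otimes> k \<oplus> x [^] j \<otimes> reg.ad x k"
      using Suc.prems d by (simp add: m_assoc K_times_x r_distr)
    have "top_reconstruction (x [^] Suc j \<otimes> k) \<oplus> x [^] j \<otimes> reg.ad x k
        = top_reconstruction (x [^] j \<otimes> k \<otimes> x)"
      unfolding eq using Suc.prems d Suc.IH[OF d] by (simp add: top_reconstruction_add)
    also have "\<dots> = x [^] j \<otimes> k \<otimes> x"
      using Suc.prems Suc.IH by (simp add: top_reconstruction_x)
    finally show ?case
      unfolding eq using Suc.prems d by (simp add: add.r_cancel)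
  qed
  show ?thesis
    using assms
  proof (induction rule: basis_induct)
    case zero
    show ?case using fixed[of \<zero> 0] by simp
  qed (auto simp: fixed top_reconstruction_add)
qed

end

section \<open>The tensor square of a ring extension\<close>

text \<open>The homomorphism on the free Abelian group that extends \<open>f\<close>, in the explicit form that occurs in
  \<^const>\<open>tensor_mult\<close>.\<close>

definition frag_sum :: "('g, 'x) monoid_scheme \<Rightarrow> ('s \<Rightarrow> 'g) \<Rightarrow> ('s \<Rightarrow>\<^sub>0 int) \<Rightarrow> 'g"
  where "frag_sum G f t = (\<Otimes>\<^bsub>G\<^esub>s\<in>Poly_Mapping.keys t. f s [^]\<^bsub>G\<^esub> Poly_Mapping.lookup t s)"

lemma (in comm_group) frag_sum_hom:
  assumes f: "f \<in> S \<rightarrow> carrier G"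
  shows "frag_sum G f \<in> hom (free_Abelian_group S) G"
proof (rule homI)
  fix t u assume "t \<in> carrier (free_Abelian_group S)" "u \<in> carrier (free_Abelian_group S)"
  then have tu: "Poly_Mapping.keys t \<subseteq> S" "Poly_Mapping.keys u \<subseteq> S" by simp_all
  let ?I = "Poly_Mapping.keys t \<union> Poly_Mapping.keys u"
  have ext: "frag_sum G f w = (\<Otimes>s\<in>?I. f s [^] Poly_Mapping.lookup w s)"
    if "Poly_Mapping.keys w \<subseteq> ?I" for w
    unfolding frag_sum_def
    by (rule finprod_mono_neutral_cong_left) (use that f tu in \<open>auto simp: in_keys_iff Pi_iff\<close>)
  have car: "\<And>s. s \<in> ?I \<Longrightarrow> f s \<in> carrier G" using f tu by auto
  have "frag_sum G f (t + u) = (\<Otimes>s\<in>?I. f s [^] Poly_Mapping.lookup t s \<otimes> f s [^] Poly_Mapping.lookup u s)"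
    using car keys_add[of t u] by (subst ext) (auto simp: lookup_add int_pow_mult simp del: finprod_multf intro!: finprod_cong')
  also have "\<dots> = frag_sum G f t \<otimes> frag_sum G f u"
    using car by (subst (1 2) ext) (auto intro!: finprod_multf)
  finally show "frag_sum G f (t \<otimes>\<^bsub>free_Abelian_group S\<^esub> u) = frag_sum G f t \<otimes> frag_sum G f u" by simp
qed (use f in \<open>auto simp: frag_sum_def Pi_iff intro!: finprod_closed\<close>)

lemma (in comm_group) frag_sum_of: "f s \<in> carrier G \<Longrightarrow> frag_sum G f (frag_of s) = f s"
  by (simp add: frag_sum_def)

lemma free_Abelian_group_hom_ext:
  assumes "group G" "\<phi> \<in> hom (free_Abelian_group S) G" "\<psi> \<in> hom (free_Abelian_group S) G"
    and "\<And>s. s \<in> S \<Longrightarrow> \<phi> (frag_of s) = \<psi> (frag_of s)"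
    and "t \<in> carrier (free_Abelian_group S)"
  shows "\<phi> t = \<psi> t"
proof -
  interpret \<phi>: group_hom "free_Abelian_group S" G \<phi>
    using assms by (simp add: group_hom_def group_hom_axioms_def)
  interpret \<psi>: group_hom "free_Abelian_group S" G \<psi>
    using assms by (simp add: group_hom_def group_hom_axioms_def)
  show ?thesis
  proof (rule free_Abelian_group_induct[of t S])
    show "\<phi> 0 = \<psi> 0" using \<phi>.hom_one \<psi>.hom_one by simp
  next
    fix t u
    assume tu: "Poly_Mapping.keys t \<subseteq> S" "Poly_Mapping.keys u \<subseteq> S" "\<phi> t = \<psi> t" "\<phi> u = \<psi> u"
    have "\<phi> (t - u) = \<phi> t \<otimes>\<^bsub>G\<^esub> inv\<^bsub>G\<^esub> \<phi> u"
      using tu \<phi>.hom_mult[of t "- u"] \<phi>.hom_inv[of u] by simp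
    moreover have "\<psi> (t - u) = \<psi> t \<otimes>\<^bsub>G\<^esub> inv\<^bsub>G\<^esub> \<psi> u"
      using tu \<psi>.hom_mult[of t "- u"] \<psi>.hom_inv[of u] by simp
    ultimately show "\<phi> (t - u) = \<psi> (t - u)" using tu by simp
  qed (use assms in auto)
qed

lemma comm_group_cong:
  assumes "comm_group G" "carrier H = carrier G" "monoid.mult H = monoid.mult G" "\<one>\<^bsub>H\<^esub> = \<one>\<^bsub>G\<^esub>"
  shows "comm_group H"
proof -
  interpret comm_group G by fact
  show ?thesis
    by (rule comm_groupI) (use l_inv_ex in \<open>auto simp: assms(2-4) m_assoc intro: m_comm\<close>)
qed

lemma tensor_relE:
  assumes "r \<in> tensor_rel A K"
  obtains (left) a a' c where "a \<in> carrier A" "a' \<in> carrier A" "c \<in> carrier A"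
      "r = frag_of (a \<oplus>\<^bsub>A\<^esub> a', c) - frag_of (a, c) - frag_of (a', c)"
  | (right) a c c' where "a \<in> carrier A" "c \<in> carrier A" "c' \<in> carrier A"
      "r = frag_of (a, c \<oplus>\<^bsub>A\<^esub> c') - frag_of (a, c) - frag_of (a, c')"
  | (balanced) a k c where "a \<in> carrier A" "k \<in> K" "c \<in> carrier A"
      "r = frag_of (a \<otimes>\<^bsub>A\<^esub> k, c) - frag_of (a, k \<otimes>\<^bsub>A\<^esub> c)"
  using assms unfolding tensor_rel_def by blast

lemma tensor_relI:
  "\<lbrakk>a \<in> carrier A; a' \<in> carrier A; c \<in> carrier A\<rbrakk> \<Longrightarrow>
    frag_of (a \<oplus>\<^bsub>A\<^esub> a', c) - frag_of (a, c) - frag_of (a', c) \<in> tensor_rel A K"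
  "\<lbrakk>a \<in> carrier A; c \<in> carrier A; c' \<in> carrier A\<rbrakk> \<Longrightarrow>
    frag_of (a, c \<oplus>\<^bsub>A\<^esub> c') - frag_of (a, c) - frag_of (a, c') \<in> tensor_rel A K"
  "\<lbrakk>a \<in> carrier A; k \<in> K; c \<in> carrier A\<rbrakk> \<Longrightarrow>
    frag_of (a \<otimes>\<^bsub>A\<^esub> k, c) - frag_of (a, k \<otimes>\<^bsub>A\<^esub> c) \<in> tensor_rel A K"
  unfolding tensor_rel_def by blast+

locale ring_extension = ring A for A :: "('a, 'r) ring_scheme" (structure) +
  fixes K :: "'a set"
  assumes K_sub: "K \<subseteq> carrier A"
begin

lemma base_carrier [simp]: "k \<in> K \<Longrightarrow> k \<in> carrier A"
  using K_sub by blast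

abbreviation Free where "Free \<equiv> tensor_free A"
abbreviation Null where "Null \<equiv> tensor_null A K"
abbreviation T where "T \<equiv> tensor_bimodule A K"

definition tensor_class :: "('a \<times> 'a \<Rightarrow>\<^sub>0 int) \<Rightarrow> ('a \<times> 'a \<Rightarrow>\<^sub>0 int) set"
  where "tensor_class t = Null #>\<^bsub>Free\<^esub> t"

definition pure_tensor :: "'a \<Rightarrow> 'a \<Rightarrow> ('a \<times> 'a \<Rightarrow>\<^sub>0 int) set"
  where "pure_tensor a c = tensor_class (frag_of (a, c))"

sublocale Free: comm_group Free
  by (simp add: tensor_free_def abelian_free_Abelian_group)

lemma Free_mult [simp]: "t \<otimes>\<^bsub>Free\<^esub> u = t + u" and Free_one [simp]: "\<one>\<^bsub>Free\<^esub> = 0"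
  by (simp_all add: tensor_free_def)

lemma Free_carrier: "t \<in> carrier Free \<longleftrightarrow> Poly_Mapping.keys t \<subseteq> carrier A \<times> carrier A"
  by (simp add: tensor_free_def)

lemma frag_of_Free [simp]: "\<lbrakk>a \<in> carrier A; c \<in> carrier A\<rbrakk> \<Longrightarrow> frag_of (a, c) \<in> carrier Free"
  by (simp add: Free_carrier)

lemma Free_add [simp]: "\<lbrakk>t \<in> carrier Free; u \<in> carrier Free\<rbrakk> \<Longrightarrow> t + u \<in> carrier Free"
  using Free.m_closed by simp

lemma Free_hom_add:
  "\<lbrakk>\<phi> \<in> hom Free G; t \<in> carrier Free; u \<in> carrier Free\<rbrakk> \<Longrightarrow> \<phi> (t + u) = \<phi> t \<otimes>\<^bsub>G\<^esub> \<phi> u"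
  using hom_mult[of \<phi> Free G t u] by simp

lemma Free_diff: "\<lbrakk>t \<in> carrier Free; u \<in> carrier Free\<rbrakk> \<Longrightarrow> t - u \<in> carrier Free"
  unfolding Free_carrier using keys_diff[of t u] by blast

lemma rel_Free: "tensor_rel A K \<subseteq> carrier Free"
proof
  fix r assume "r \<in> tensor_rel A K"
  then show "r \<in> carrier Free" by (cases rule: tensor_relE) (simp_all add: Free_diff)
qed

lemma Null_subgroup: "subgroup Null Free"
  unfolding tensor_null_def by (rule Free.generate_is_subgroup[OF rel_Free])

lemma Null_normal: "Null \<lhd> Free"
  by (rule Free.subgroup_imp_normal[OF Null_subgroup])

lemma rel_Null: "r \<in> tensor_rel A K \<Longrightarrow> r \<in> Null"
  unfolding tensor_null_def by (rule generate.incl)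

lemma T_carrier: "carrier T = tensor_class ` carrier Free"
  by (auto simp: tensor_bimodule_def Let_def FactGroup_def RCOSETS_def tensor_class_def)

lemma tensor_class_T [simp]: "t \<in> carrier Free \<Longrightarrow> tensor_class t \<in> carrier T"
  by (simp add: T_carrier)

lemma tensor_class_add: "\<lbrakk>t \<in> carrier Free; u \<in> carrier Free\<rbrakk> \<Longrightarrow> tensor_class t \<otimes>\<^bsub>T\<^esub> tensor_class u = tensor_class (t + u)"
  using normal.rcos_sum[OF Null_normal, of t u] unfolding tensor_class_def
  by (simp add: tensor_bimodule_def Let_def FactGroup_def)

lemma tensor_class_null: "t \<in> Null \<Longrightarrow> tensor_class t = \<one>\<^bsub>T\<^esub>"
  using Free.coset_join2[OF _ Null_subgroup] subgroup.subset[OF Null_subgroup]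
  by (auto simp: tensor_class_def tensor_bimodule_def Let_def FactGroup_def)

sublocale T: comm_group T
proof -
  have "comm_group (Free Mod Null)"
    by (rule Free.abelian_FactGroup[OF Null_subgroup])
  then show "comm_group T"
    by (rule comm_group_cong) (simp_all add: tensor_bimodule_def Let_def)
qed

lemma tensor_class_eqI:
  assumes "t \<in> carrier Free" "u \<in> carrier Free" "t - u \<in> Null"
  shows "tensor_class t = tensor_class u"
  using tensor_class_add[of "t - u" u] assms tensor_class_null[OF assms(3)] T.l_one[of "tensor_class u"] Free_diff[of t u] by simp

lemma tensor_class_hom: "tensor_class \<in> hom Free T"
  by (rule homI) (auto simp: tensor_class_add)

text \<open>A homomorphism that kills the relations is constant on the cosets, so \<^const>\<open>the_elem\<close> returns its value.\<close>

lemma tensor_descend: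
  assumes G: "group G" and \<phi>: "\<phi> \<in> hom Free G"
    and rel: "\<And>r. r \<in> tensor_rel A K \<Longrightarrow> \<phi> r = \<one>\<^bsub>G\<^esub>"
    and t: "t \<in> carrier Free"
  shows "the_elem (\<phi> ` tensor_class t) = \<phi> t"
proof -
  interpret \<phi>: group_hom Free G \<phi>
    using assms Free.is_group by (simp add: group_hom_def group_hom_axioms_def)
  have "\<phi> n = \<one>\<^bsub>G\<^esub>" if "n \<in> Null" for n
    using that unfolding tensor_null_def
  proof (induction rule: generate.induct)
    case one
    then show ?case by (rule \<phi>.hom_one)
  next
    case (inv h)
    then show ?case using rel rel_Free by (subst \<phi>.hom_inv) auto
  next
    case (eng g h)
    have "g \<in> carrier Free" "h \<in> carrier Free"
      using eng.hyps Free.generate_in_carrier[OF rel_Free] by auto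
    then show ?case using eng.IH by (simp add: Free_hom_add[OF \<phi>])
  qed (rule rel)
  then have "\<phi> (n + t) = \<phi> t" if "n \<in> Null" for n
    using that t subgroup.mem_carrier[OF Null_subgroup that] Free_hom_add[OF \<phi>, of n t] by simp
  moreover have "tensor_class t = (\<lambda>n. n + t) ` Null"
    unfolding tensor_class_def by (auto simp: r_coset_def)
  moreover have "Null \<noteq> {}"
    using subgroup.one_closed[OF Null_subgroup] by blast
  ultimately have "\<phi> ` tensor_class t = {\<phi> t}"
    by (auto simp: image_iff)
  then show ?thesis by simp
qed

lemma tensor_descend_hom:
  assumes "group G" "\<phi> \<in> hom Free G" "\<And>r. r \<in> tensor_rel A K \<Longrightarrow> \<phi> r = \<one>\<^bsub>G\<^esub>"
  shows "(\<lambda>C. the_elem (\<phi> ` C)) \<in> hom T G"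
proof (rule homI)
  note d = tensor_descend[OF assms]
  fix C C' assume "C \<in> carrier T" "C' \<in> carrier T"
  then obtain t u where tu: "C = tensor_class t" "C' = tensor_class u" "t \<in> carrier Free" "u \<in> carrier Free"
    by (auto simp: T_carrier)
  have "\<phi> (t + u) = \<phi> t \<otimes>\<^bsub>G\<^esub> \<phi> u"
    using hom_mult[OF assms(2) tu(3,4)] by simp
  then show "the_elem (\<phi> ` (C \<otimes>\<^bsub>T\<^esub> C')) = the_elem (\<phi> ` C) \<otimes>\<^bsub>G\<^esub> the_elem (\<phi> ` C')"
    using tu Free.m_closed[of t u] by (simp add: tensor_class_add d)
qed (use assms in \<open>auto simp: T_carrier tensor_descend hom_in_carrier\<close>)

lemma pure_tensor_closed [simp]: "\<lbrakk>a \<in> carrier A; c \<in> carrier A\<rbrakk> \<Longrightarrow> pure_tensor a c \<in> carrier T"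
  by (simp add: pure_tensor_def)

lemma pure_tensor_add_left:
  assumes "a \<in> carrier A" "a' \<in> carrier A" "c \<in> carrier A"
  shows "pure_tensor (a \<oplus> a') c = pure_tensor a c \<otimes>\<^bsub>T\<^esub> pure_tensor a' c"
  unfolding pure_tensor_def using assms
  by (subst tensor_class_add; (intro tensor_class_eqI rel_Null)?)
    (simp_all add: tensor_relI diff_diff_eq[symmetric] Free.m_closed)

lemma pure_tensor_add_right:
  assumes "a \<in> carrier A" "c \<in> carrier A" "c' \<in> carrier A"
  shows "pure_tensor a (c \<oplus> c') = pure_tensor a c \<otimes>\<^bsub>T\<^esub> pure_tensor a c'"
  unfolding pure_tensor_def using assms
  by (subst tensor_class_add; (intro tensor_class_eqI rel_Null)?)
    (simp_all add: tensor_relI diff_diff_eq[symmetric] Free.m_closed)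

lemma pure_tensor_balanced:
  assumes "a \<in> carrier A" "c \<in> carrier A" "k \<in> K"
  shows "pure_tensor (a \<otimes> k) c = pure_tensor a (k \<otimes> c)"
  unfolding pure_tensor_def using assms by (intro tensor_class_eqI rel_Null) (simp_all add: tensor_relI)

text \<open>Identities between additive maps on the tensor square need to be checked on pure tensors only; this is
  how all the bimodule axioms are proved.\<close>

lemma T_hom_ext:
  assumes G: "group G" and \<phi>: "\<phi> \<in> hom T G" and \<psi>: "\<psi> \<in> hom T G"
    and eq: "\<And>a c. \<lbrakk>a \<in> carrier A; c \<in> carrier A\<rbrakk> \<Longrightarrow> \<phi> (pure_tensor a c) = \<psi> (pure_tensor a c)"
    and C: "C \<in> carrier T"
  shows "\<phi> C = \<psi> C"
proof -
  obtain t where t: "C = tensor_class t" "t \<in> carrier Free" using C by (auto simp: T_carrier)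
  have "(\<phi> \<circ> tensor_class) t = (\<psi> \<circ> tensor_class) t"
  proof (rule free_Abelian_group_hom_ext[OF G, of _ "carrier A \<times> carrier A"])
    show "\<phi> \<circ> tensor_class \<in> hom (free_Abelian_group (carrier A \<times> carrier A)) G"
      "\<psi> \<circ> tensor_class \<in> hom (free_Abelian_group (carrier A \<times> carrier A)) G"
      using hom_compose[OF tensor_class_hom \<phi>] hom_compose[OF tensor_class_hom \<psi>] by (simp_all add: tensor_free_def)
    show "t \<in> carrier (free_Abelian_group (carrier A \<times> carrier A))"
      using t(2) by (simp add: tensor_free_def)
    fix s assume "s \<in> carrier A \<times> carrier A"
    then show "(\<phi> \<circ> tensor_class) (frag_of s) = (\<psi> \<circ> tensor_class) (frag_of s)"
      using eq by (auto simp: pure_tensor_def)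
  qed
  then show ?thesis using t by simp
qed

text \<open>The universal property of the tensor product for biadditive balanced maps, with an explicit choice of
  the induced homomorphism.\<close>

lemma tensor_lift:
  assumes G: "comm_group G"
    and f: "\<And>a c. \<lbrakk>a \<in> carrier A; c \<in> carrier A\<rbrakk> \<Longrightarrow> f (a, c) \<in> carrier G"
    and left: "\<And>a a' c. \<lbrakk>a \<in> carrier A; a' \<in> carrier A; c \<in> carrier A\<rbrakk> \<Longrightarrow>
      f (a \<oplus> a', c) = f (a, c) \<otimes>\<^bsub>G\<^esub> f (a', c)"
    and right: "\<And>a c c'. \<lbrakk>a \<in> carrier A; c \<in> carrier A; c' \<in> carrier A\<rbrakk> \<Longrightarrow>
      f (a, c \<oplus> c') = f (a, c) \<otimes>\<^bsub>G\<^esub> f (a, c')"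
    and bal: "\<And>a k c. \<lbrakk>a \<in> carrier A; k \<in> K; c \<in> carrier A\<rbrakk> \<Longrightarrow> f (a \<otimes> k, c) = f (a, k \<otimes> c)"
  shows "(\<lambda>C. the_elem (frag_sum G f ` C)) \<in> hom T G"
    "\<And>a c. \<lbrakk>a \<in> carrier A; c \<in> carrier A\<rbrakk> \<Longrightarrow> the_elem (frag_sum G f ` pure_tensor a c) = f (a, c)"
proof -
  interpret G: comm_group G by (rule G)
  have hom: "frag_sum G f \<in> hom Free G"
    unfolding tensor_free_def using f by (intro G.frag_sum_hom) auto
  interpret \<phi>: group_hom Free G "frag_sum G f"
    using hom Free.is_group G.is_group by (simp add: group_hom_def group_hom_axioms_def)
  have diff: "frag_sum G f (t - u) = frag_sum G f t \<otimes>\<^bsub>G\<^esub> inv\<^bsub>G\<^esub> frag_sum G f u"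
    if "t \<in> carrier Free" "u \<in> carrier Free" for t u
  proof -
    have "frag_sum G f (t - u) \<otimes>\<^bsub>G\<^esub> frag_sum G f u = frag_sum G f t"
      using that Free_hom_add[OF hom, of "t - u" u] Free_diff by simp
    then show ?thesis using that Free_diff[OF that] by (metis G.inv_solve_right \<phi>.hom_closed)
  qed
  have kill: "frag_sum G f r = \<one>\<^bsub>G\<^esub>" if "r \<in> tensor_rel A K" for r
    using that
  proof (cases rule: tensor_relE)
    case (left a a' c)
    then show ?thesis
      by (simp add: diff Free_diff G.frag_sum_of f assms(3) G.m_assoc)
        (simp add: f G.m_comm[of "inv\<^bsub>G\<^esub> f (a, c)"] flip: G.m_assoc)
  next
    case (right a c c')
    then show ?thesis
      by (simp add: diff Free_diff G.frag_sum_of f assms(4) G.m_assoc)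
        (simp add: f G.m_comm[of "inv\<^bsub>G\<^esub> f (a, c)"] flip: G.m_assoc)
  next
    case (balanced a k c)
    then show ?thesis
      by (simp add: diff Free_diff G.frag_sum_of f bal)
  qed
  show "(\<lambda>C. the_elem (frag_sum G f ` C)) \<in> hom T G"
    by (rule tensor_descend_hom[OF G.is_group hom kill])
  show "the_elem (frag_sum G f ` pure_tensor a c) = f (a, c)" if "a \<in> carrier A" "c \<in> carrier A" for a c
    unfolding pure_tensor_def using that
    by (subst tensor_descend[OF G.is_group hom kill]) (auto simp: G.frag_sum_of f)
qed

lemma frag_extend_Free:
  assumes g: "\<And>a c. \<lbrakk>a \<in> carrier A; c \<in> carrier A\<rbrakk> \<Longrightarrow> g (a, c) \<in> carrier Free"
  shows "(\<lambda>t. tensor_class (frag_extend g t)) \<in> hom Free T"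
proof -
  have car: "frag_extend g t \<in> carrier Free" if "t \<in> carrier Free" for t
  proof -
    have "Poly_Mapping.keys (g s) \<subseteq> carrier A \<times> carrier A" if "s \<in> Poly_Mapping.keys t" for s
    proof -
      have "s \<in> carrier A \<times> carrier A"
        using that \<open>t \<in> carrier Free\<close> unfolding Free_carrier by blast
      then have "g s \<in> carrier Free"
        using g[of "fst s" "snd s"] by auto
      then show ?thesis unfolding Free_carrier .
    qed
    then show ?thesis
      using keys_frag_extend[of g t] unfolding Free_carrier by blast
  qed
  show ?thesis
    by (rule homI) (auto simp: car tensor_class_add frag_extend_add)
qed

lemma lact_pure_tensor:
  assumes y: "y \<in> carrier A"
  shows "lact T y \<in> hom T T"
    "\<And>a c. \<lbrakk>a \<in> carrier A; c \<in> carrier A\<rbrakk> \<Longrightarrow> lact T y (pure_tensor a c) = pure_tensor (y \<otimes> a) c"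
proof -
  let ?g = "\<lambda>(a, c). frag_of (y \<otimes> a, c)"
  have eq: "lact T y = (\<lambda>C. the_elem ((\<lambda>t. tensor_class (frag_extend ?g t)) ` C))"
    by (auto simp: tensor_bimodule_def Let_def tensor_class_def)
  have hom: "(\<lambda>t. tensor_class (frag_extend ?g t)) \<in> hom Free T"
    using y by (intro frag_extend_Free) auto
  have kill: "tensor_class (frag_extend ?g r) = \<one>\<^bsub>T\<^esub>" if r: "r \<in> tensor_rel A K" for r
  proof (rule tensor_class_null, rule rel_Null)
    show "frag_extend ?g r \<in> tensor_rel A K"
      using r
    proof (cases rule: tensor_relE)
      case (left a a' c)
      then show ?thesis using y by (simp add: frag_extend_diff r_distr tensor_relI)
    next
      case (right a c c')
      then show ?thesis using y by (simp add: frag_extend_diff tensor_relI)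
    next
      case (balanced a k c)
      then show ?thesis
        using y tensor_relI(3)[of "y \<otimes> a" A k K c] by (simp add: frag_extend_diff m_assoc)
    qed
  qed
  show "lact T y \<in> hom T T"
    unfolding eq by (rule tensor_descend_hom[OF T.is_group hom kill])
  show "lact T y (pure_tensor a c) = pure_tensor (y \<otimes> a) c" if "a \<in> carrier A" "c \<in> carrier A" for a c
    unfolding eq pure_tensor_def using that by (subst tensor_descend[OF T.is_group hom kill]) auto
qed

lemma ract_pure_tensor:
  assumes y: "y \<in> carrier A"
  shows "(\<lambda>C. ract T C y) \<in> hom T T"
    "\<And>a c. \<lbrakk>a \<in> carrier A; c \<in> carrier A\<rbrakk> \<Longrightarrow> ract T (pure_tensor a c) y = pure_tensor a (c \<otimes> y)"
proof -
  let ?g = "\<lambda>(a, c). frag_of (a, c \<otimes> y)"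
  have eq: "(\<lambda>C. ract T C y) = (\<lambda>C. the_elem ((\<lambda>t. tensor_class (frag_extend ?g t)) ` C))"
    by (auto simp: tensor_bimodule_def Let_def tensor_class_def)
  have hom: "(\<lambda>t. tensor_class (frag_extend ?g t)) \<in> hom Free T"
    using y by (intro frag_extend_Free) auto
  have kill: "tensor_class (frag_extend ?g r) = \<one>\<^bsub>T\<^esub>" if r: "r \<in> tensor_rel A K" for r
  proof (rule tensor_class_null, rule rel_Null)
    show "frag_extend ?g r \<in> tensor_rel A K"
      using r
    proof (cases rule: tensor_relE)
      case (left a a' c)
      then show ?thesis using y by (simp add: frag_extend_diff tensor_relI)
    next
      case (right a c c')
      then show ?thesis using y by (simp add: frag_extend_diff l_distr tensor_relI)
    next
      case (balanced a k c)
      then show ?thesis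
        using y tensor_relI(3)[of a A k K "c \<otimes> y"] by (simp add: frag_extend_diff m_assoc)
    qed
  qed
  show "(\<lambda>C. ract T C y) \<in> hom T T"
    unfolding eq by (rule tensor_descend_hom[OF T.is_group hom kill])
  show "ract T (pure_tensor a c) y = pure_tensor a (c \<otimes> y)" if "a \<in> carrier A" "c \<in> carrier A" for a c
    using that tensor_descend[OF T.is_group hom kill, of "frag_of (a, c)"] fun_cong[OF eq, of "pure_tensor a c"]
    by (simp add: pure_tensor_def)
qed

sublocale T: two_sided_module A T
proof
  note ext = T_hom_ext[OF T.is_group]
  note comp = hom_compose[unfolded comp_def]
  note L = lact_pure_tensor(1) and R = ract_pure_tensor(1)
  have mult_hom: "(\<lambda>C. \<phi> C \<otimes>\<^bsub>T\<^esub> \<psi> C) \<in> hom T T" if "\<phi> \<in> hom T T" "\<psi> \<in> hom T T" for \<phi> \<psi>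
    using that by (auto simp: hom_def Pi_iff T.m_ac)
  fix y assume y: "y \<in> carrier A"
  fix m assume m: "m \<in> carrier T"
  show "lact T y m \<in> carrier T" "ract T m y \<in> carrier T"
    using hom_in_carrier[OF L[OF y] m] hom_in_carrier[OF R[OF y] m] by auto
  { fix m' assume m': "m' \<in> carrier T"
    show "lact T y (m \<otimes>\<^bsub>T\<^esub> m') = lact T y m \<otimes>\<^bsub>T\<^esub> lact T y m'"
      "ract T (m \<otimes>\<^bsub>T\<^esub> m') y = ract T m y \<otimes>\<^bsub>T\<^esub> ract T m' y"
      using hom_mult[OF L[OF y] m m'] hom_mult[OF R[OF y] m m'] by auto }
  { fix z assume z: "z \<in> carrier A"
    show "lact T (y \<oplus> z) m = lact T y m \<otimes>\<^bsub>T\<^esub> lact T z m"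
      by (rule ext[OF L mult_hom[OF L L]])
        (use y z m in \<open>auto simp: lact_pure_tensor(2) l_distr pure_tensor_add_left\<close>)
    show "ract T m (y \<oplus> z) = ract T m y \<otimes>\<^bsub>T\<^esub> ract T m z"
      by (rule ext[OF R mult_hom[OF R R]])
        (use y z m in \<open>auto simp: ract_pure_tensor(2) r_distr pure_tensor_add_right\<close>)
    show "lact T y (lact T z m) = lact T (y \<otimes> z) m"
      by (rule ext[OF comp[OF L L] L]) (use y z m in \<open>auto simp: lact_pure_tensor(2) m_assoc\<close>)
    show "ract T (ract T m y) z = ract T m (y \<otimes> z)"
      by (rule ext[OF comp[OF R R] R]) (use y z m in \<open>auto simp: ract_pure_tensor(2) m_assoc\<close>)
    show "ract T (lact T y m) z = lact T y (ract T m z)"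
      by (rule ext[OF comp[OF L R] comp[OF R L]])
        (use y z m in \<open>auto simp: lact_pure_tensor(2) ract_pure_tensor(2)\<close>) }
next
  have id: "(\<lambda>m. m) \<in> hom T T" by (simp add: hom_def)
  fix m assume m: "m \<in> carrier T"
  show "lact T \<one> m = m"
    by (rule T_hom_ext[OF T.is_group lact_pure_tensor(1) id]) (use m in \<open>auto simp: lact_pure_tensor(2)\<close>)
  show "ract T m \<one> = m"
    by (rule T_hom_ext[OF T.is_group ract_pure_tensor(1) id]) (use m in \<open>auto simp: ract_pure_tensor(2)\<close>)
qed

lemma tensor_mult_pure_tensor:
  "tensor_mult A \<in> hom T (add_monoid A)"
  "\<And>a c. \<lbrakk>a \<in> carrier A; c \<in> carrier A\<rbrakk> \<Longrightarrow> tensor_mult A (pure_tensor a c) = a \<otimes> c"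
proof -
  have eq: "tensor_mult A = (\<lambda>C. the_elem (frag_sum (add_monoid A) (\<lambda>s. fst s \<otimes> snd s) ` C))"
    by (simp add: fun_eq_iff tensor_mult_def frag_sum_def finsum_def add_pow_def)
  show "tensor_mult A \<in> hom T (add_monoid A)"
    "\<And>a c. \<lbrakk>a \<in> carrier A; c \<in> carrier A\<rbrakk> \<Longrightarrow> tensor_mult A (pure_tensor a c) = a \<otimes> c"
    unfolding eq
    using tensor_lift[OF add.comm_group_axioms, of "\<lambda>s. fst s \<otimes> snd s"] 
    by (auto simp: l_distr r_distr m_assoc)
qed

definition separability_element :: "('a \<times> 'a \<Rightarrow>\<^sub>0 int) set \<Rightarrow> bool" where
  "separability_element E \<longleftrightarrow> E \<in> carrier T \<and> (\<forall>y\<in>carrier A. lact T y E = ract T E y) \<and> tensor_mult A E = \<one>"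

lemma tensor_mult_lact:
  assumes "y \<in> carrier A" "C \<in> carrier T"
  shows "tensor_mult A (lact T y C) = y \<otimes> tensor_mult A C"
proof -
  have hom: "(\<lambda>C. y \<otimes> tensor_mult A C) \<in> hom T (add_monoid A)"
    using assms tensor_mult_pure_tensor(1) by (auto simp: hom_def Pi_iff r_distr)
  show ?thesis
    by (rule T_hom_ext[OF add.is_group hom_compose[OF lact_pure_tensor(1) tensor_mult_pure_tensor(1), unfolded comp_def] hom])
      (use assms in \<open>auto simp: lact_pure_tensor(2) tensor_mult_pure_tensor(2) m_assoc\<close>)
qed

lemma tensor_mult_ract:
  assumes "y \<in> carrier A" "C \<in> carrier T"
  shows "tensor_mult A (ract T C y) = tensor_mult A C \<otimes> y"
proof -
  have hom: "(\<lambda>C. tensor_mult A C \<otimes> y) \<in> hom T (add_monoid A)"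
    using assms tensor_mult_pure_tensor(1) by (auto simp: hom_def Pi_iff l_distr)
  show ?thesis
    by (rule T_hom_ext[OF add.is_group hom_compose[OF ract_pure_tensor(1) tensor_mult_pure_tensor(1), unfolded comp_def] hom])
      (use assms in \<open>auto simp: ract_pure_tensor(2) tensor_mult_pure_tensor(2) m_assoc\<close>)
qed

text \<open>A splitting is determined by its value \<open>E\<close> at \<open>1\<close>, which commutes with \<open>A\<close>; conversely \<open>z \<mapsto> z E\<close> is a
  splitting.\<close>

lemma separable_iff_separability_element:
  "separable_ext A K \<longleftrightarrow> (\<exists>E. separability_element E)"
proof
  assume "separable_ext A K"
  then obtain \<sigma> where \<sigma>: "\<sigma> \<in> bimodule_hom (carrier A) (sub_bimodule A (carrier A)) T"
    and split: "\<And>z. z \<in> carrier A \<Longrightarrow> tensor_mult A (\<sigma> z) = z"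
    unfolding separable_ext_def by blast
  have act: "\<sigma> (s \<otimes> m) = lact T s (\<sigma> m)" "\<sigma> (m \<otimes> s) = ract T (\<sigma> m) s"
    if "s \<in> carrier A" "m \<in> carrier A" for s m
  proof -
    have "\<forall>s\<in>carrier A. \<forall>m\<in>carrier A. \<sigma> (s \<otimes> m) = lact T s (\<sigma> m) \<and> \<sigma> (m \<otimes> s) = ract T (\<sigma> m) s"
      using \<sigma> unfolding bimodule_hom_def mem_Collect_eq sub_bimodule_simps by (rule conjunct2)
    then show "\<sigma> (s \<otimes> m) = lact T s (\<sigma> m)" "\<sigma> (m \<otimes> s) = ract T (\<sigma> m) s"
      using that by blast+
  qed
  have "lact T y (\<sigma> \<one>) = ract T (\<sigma> \<one>) y" if "y \<in> carrier A" for y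
    using act(1)[OF that one_closed] act(2)[OF that one_closed] that by simp
  moreover have "\<sigma> \<one> \<in> carrier T"
    using \<sigma> unfolding bimodule_hom_def by (auto simp: hom_def)
  ultimately have "separability_element (\<sigma> \<one>)"
    unfolding separability_element_def using split by auto
  then show "\<exists>E. separability_element E" ..
next
  assume "\<exists>E. separability_element E"
  then obtain E where E: "E \<in> carrier T" "\<And>y. y \<in> carrier A \<Longrightarrow> lact T y E = ract T E y" "tensor_mult A E = \<one>"
    unfolding separability_element_def by blast
  have hom: "(\<lambda>z. lact T z E) \<in> bimodule_hom (carrier A) (sub_bimodule A (carrier A)) T"
    unfolding bimodule_hom_def mem_Collect_eq sub_bimodule_simps
  proof (intro conjI ballI)
    show "(\<lambda>z. lact T z E) \<in> hom (sub_bimodule A (carrier A)) T"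
      using E(1) by (simp add: hom_def T.lact_add)
    fix s m assume sm: "s \<in> carrier A" "m \<in> carrier A"
    show "lact T (s \<otimes> m) E = lact T s (lact T m E)"
      using sm E(1) by (simp add: T.lact_lact)
    have "lact T (m \<otimes> s) E = lact T m (lact T s E)"
      using sm E(1) by (simp add: T.lact_lact)
    also have "\<dots> = ract T (lact T m E) s"
      unfolding E(2)[OF sm(1)] using sm E(1) by (simp add: T.ract_lact)
    finally show "lact T (m \<otimes> s) E = ract T (lact T m E) s" .
  qed
  have "tensor_mult A (lact T z E) = z" if "z \<in> carrier A" for z
    using that E(1,3) by (simp add: tensor_mult_lact)
  then show "separable_ext A K"
    unfolding separable_ext_def by (intro bexI[OF _ hom]) simp
qed

text \<open>If \<open>E\<close>, the sum of the \<open>a\<^sub>i \<otimes> c\<^sub>i\<close>, is a separability element, then applying the map \<open>a \<otimes> c \<mapsto> \<delta>(a) c\<close>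
  to \<open>y E = E y\<close> gives \<open>\<delta>(y) + y u = u y\<close>, where \<open>u\<close> is the sum of the \<open>\<delta>(a\<^sub>i) c\<^sub>i\<close>.\<close>

theorem separable_imp_weakly_separable:
  assumes "separable_ext A K"
  shows "weakly_separable_ext A K"
  unfolding weakly_separable_ext_def
proof (intro allI impI, elim conjE)
  fix \<delta> assume der: "ring_derivation A \<delta>" and K0: "\<forall>k\<in>K. \<delta> k = \<zero>"
  interpret derivation A \<delta> by unfold_locales (rule der)
  obtain E where E: "E \<in> carrier T" "\<And>y. y \<in> carrier A \<Longrightarrow> lact T y E = ract T E y" "tensor_mult A E = \<one>"
    using assms unfolding separable_iff_separability_element separability_element_def by blast
  define \<Lambda> where "\<Lambda> C = the_elem (frag_sum (add_monoid A) (\<lambda>s. \<delta> (fst s) \<otimes> snd s) ` C)" for C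
  have hom: "\<Lambda> \<in> hom T (add_monoid A)"
    and pure_tensor: "\<And>a c. \<lbrakk>a \<in> carrier A; c \<in> carrier A\<rbrakk> \<Longrightarrow> \<Lambda> (pure_tensor a c) = \<delta> a \<otimes> c"
    unfolding \<Lambda>_def using tensor_lift[OF add.comm_group_axioms, of "\<lambda>s. \<delta> (fst s) \<otimes> snd s"] K0
    by (auto simp: d_add d_mult l_distr r_distr m_assoc)
  have car: "\<Lambda> C \<in> carrier A" "tensor_mult A C \<in> carrier A" if "C \<in> carrier T" for C
    using hom_in_carrier[OF hom that] hom_in_carrier[OF tensor_mult_pure_tensor(1) that] by auto
  have add: "\<Lambda> (C \<otimes>\<^bsub>T\<^esub> C') = \<Lambda> C \<oplus> \<Lambda> C'" "tensor_mult A (C \<otimes>\<^bsub>T\<^esub> C') = tensor_mult A C \<oplus> tensor_mult A C'"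
    if "C \<in> carrier T" "C' \<in> carrier T" for C C'
    using hom_mult[OF hom that] hom_mult[OF tensor_mult_pure_tensor(1) that] by auto
  have R: "\<Lambda> (ract T C y) = \<Lambda> C \<otimes> y" if "y \<in> carrier A" "C \<in> carrier T" for y C
  proof (rule T_hom_ext[OF add.is_group hom_compose[OF ract_pure_tensor(1) hom, unfolded comp_def]])
    show "(\<lambda>C. \<Lambda> C \<otimes> y) \<in> hom T (add_monoid A)"
      using that by (auto simp: hom_def car add l_distr)
  qed (use that in \<open>auto simp: ract_pure_tensor(2) pure_tensor m_assoc\<close>)
  have L: "\<Lambda> (lact T y C) = \<delta> y \<otimes> tensor_mult A C \<oplus> y \<otimes> \<Lambda> C" if "y \<in> carrier A" "C \<in> carrier T" for y C
  proof (rule T_hom_ext[OF add.is_group hom_compose[OF lact_pure_tensor(1) hom, unfolded comp_def]])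
    show "(\<lambda>C. \<delta> y \<otimes> tensor_mult A C \<oplus> y \<otimes> \<Lambda> C) \<in> hom T (add_monoid A)"
      using that by (auto simp: hom_def car add r_distr a_ac)
  qed (use that in \<open>auto simp: lact_pure_tensor(2) tensor_mult_pure_tensor(2) pure_tensor d_mult m_assoc l_distr\<close>)
  have "\<delta> y = \<Lambda> E \<otimes> y \<ominus> y \<otimes> \<Lambda> E" if y: "y \<in> carrier A" for y
  proof -
    have "\<delta> y \<oplus> y \<otimes> \<Lambda> E = \<Lambda> E \<otimes> y"
      using L[OF y E(1)] R[OF y E(1)] E y by simp
    then show ?thesis
      using y car(1)[OF E(1)] by (metis a_minus_def add.inv_solve_right' d_closed m_closed)
  qed
  then show "\<exists>u\<in>carrier A. \<forall>y\<in>carrier A. \<delta> y = u \<otimes> y \<ominus> y \<otimes> u"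
    using car(1)[OF E(1)] by blast
qed

end

section \<open>Separability of the extension\<close>

sublocale p_polynomial_extension \<subseteq> ring_extension A K
  by unfold_locales auto

sublocale p_polynomial_extension \<subseteq> T: p_polynomial_module A K x p e \<beta> "tensor_bimodule A K"
  by unfold_locales

context p_polynomial_extension
begin

lemma tensor_mult_ad:
  assumes "C \<in> carrier T"
  shows "tensor_mult A ((T.ad x ^^ i) C) = (reg.ad x ^^ i) (tensor_mult A C)"
proof (induction i)
  case (Suc i)
  have mc: "tensor_mult A C \<in> carrier A" if "C \<in> carrier T" for C
    using hom_in_carrier[OF tensor_mult_pure_tensor(1) that] by simp
  have "tensor_mult A (T.ad x C) = reg.ad x (tensor_mult A C)" if C: "C \<in> carrier T" for C
  proof -
    have "T.ad x C \<otimes>\<^bsub>T\<^esub> lact T x C = ract T C x"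
      using C by (simp add: T.ad_def T.m_assoc)
    then have "tensor_mult A (T.ad x C) \<oplus> tensor_mult A (lact T x C) = tensor_mult A (ract T C x)"
      using hom_mult[OF tensor_mult_pure_tensor(1), of "T.ad x C" "lact T x C"] C by simp
    then have "tensor_mult A (T.ad x C) \<oplus> x \<otimes> tensor_mult A C = tensor_mult A C \<otimes> x"
      using C by (simp add: tensor_mult_lact tensor_mult_ract)
    then show ?thesis
      using C mc[OF C] mc[of "T.ad x C"] by (simp add: reg_ad a_minus_def add.inv_solve_right)
  qed
  then show ?case using assms Suc by simp
qed simp

lemma tensor_mult_tau:
  assumes "C \<in> carrier T"
  shows "tensor_mult A (T.tau C) = reg.tau (tensor_mult A C)"
proof -
  have mc: "tensor_mult A C \<in> carrier (sub_bimodule A (carrier A))"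
    using hom_in_carrier[OF tensor_mult_pure_tensor(1) assms] by simp
  have "tensor_mult A (T.tau C)
      = (\<Oplus>j\<in>{..e}. tensor_mult A (ract T ((T.ad x ^^ (p ^ j - 1)) C) (\<beta> (Suc j))))"
    unfolding T.tau_def using assms
    by (subst T.hom_finprod[OF add.comm_group_axioms tensor_mult_pure_tensor(1)])
      (auto simp: finsum_def)
  also have "\<dots> = reg.tau (tensor_mult A C)"
    unfolding reg.tau_def sub_bimodule_finprod
    using assms reg.ad_funpow_closed[OF x_closed mc]
    by (intro finsum_cong') (auto simp: tensor_mult_ract tensor_mult_ad simp del: One_nat_def)
  finally show ?thesis .
qed

text \<open>Multiplication is a bimodule homomorphism, so it is compatible with \<open>\<tau>\<close> and sends \<open>\<tau> (h \<otimes> 1)\<close>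
  to \<open>\<tau> h = 1\<close>.\<close>

theorem separable_if_tau_one:
  assumes h: "h \<in> reg.V" and tau: "reg.tau h = \<one>"
  shows "separable_ext A K"
proof -
  have hc: "h \<in> carrier A" using reg.V_carrier[OF h] by simp
  have w: "pure_tensor h \<one> \<in> T.V"
  proof (rule T.VI)
    fix k assume k: "k \<in> K"
    have "lact T k (pure_tensor h \<one>) = pure_tensor (k \<otimes> h) \<one>"
      using k hc by (simp add: lact_pure_tensor)
    also have "k \<otimes> h = h \<otimes> k"
      using reg.V_commutes[OF h k] by simp
    also have "pure_tensor (h \<otimes> k) \<one> = ract T (pure_tensor h \<one>) k"
      using k hc by (simp add: ract_pure_tensor pure_tensor_balanced)
    finally show "lact T k (pure_tensor h \<one>) = ract T (pure_tensor h \<one>) k" .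
  qed (simp add: hc)
  have "separability_element (T.tau (pure_tensor h \<one>))"
    unfolding separability_element_def using w hc tau
    by (auto simp: T.tau_commutes tensor_mult_tau tensor_mult_pure_tensor)
  then show ?thesis
    using separable_iff_separability_element by blast
qed

text \<open>Each left \<open>K\<close>-linear map \<open>\<phi>\<close> of \<open>A\<close> induces \<open>a \<otimes> c \<mapsto> a \<phi>(c)\<close> on the tensor square.  Evaluating at a
  separability element \<open>E\<close> is a bimodule homomorphism in \<open>\<phi>\<close>, because \<open>E\<close> commutes with \<open>A\<close>.  It therefore
  carries the identity \<open>\<tau> \<kappa> = id\<close> to \<open>\<tau> h = 1\<close>, where \<open>h\<close> is the value at \<open>\<phi> = \<kappa>\<close>.\<close>

theorem separable_imp_tau_one:
  assumes "separable_ext A K"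
  obtains h where "h \<in> reg.V" "reg.tau h = \<one>"
proof -
  obtain E where E: "E \<in> carrier T" "\<And>y. y \<in> carrier A \<Longrightarrow> lact T y E = ract T E y" "tensor_mult A E = \<one>"
    using assms unfolding separable_iff_separability_element separability_element_def by blast
  define \<Lambda> where "\<Lambda> C = the_elem (frag_sum (add_monoid A) (\<lambda>s. fst s \<otimes> top_coeff (snd s)) ` C)" for C
  have hom: "\<Lambda> \<in> hom T (add_monoid A)"
    and pure_tensor: "\<And>a c. \<lbrakk>a \<in> carrier A; c \<in> carrier A\<rbrakk> \<Longrightarrow> \<Lambda> (pure_tensor a c) = a \<otimes> top_coeff c"
    unfolding \<Lambda>_def using tensor_lift[OF add.comm_group_axioms, of "\<lambda>s. fst s \<otimes> top_coeff (snd s)"]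
    by (auto simp: top_add top_lact l_distr r_distr m_assoc)
  have car [simp]: "\<Lambda> C \<in> carrier A" if "C \<in> carrier T" for C
    using hom_in_carrier[OF hom that] by simp
  have add: "\<Lambda> (C \<otimes>\<^bsub>T\<^esub> C') = \<Lambda> C \<oplus> \<Lambda> C'" if "C \<in> carrier T" "C' \<in> carrier T" for C C'
    using hom_mult[OF hom that] by simp
  have L: "\<Lambda> (lact T y C) = y \<otimes> \<Lambda> C" if "y \<in> carrier A" "C \<in> carrier T" for y C
  proof (rule T_hom_ext[OF add.is_group hom_compose[OF lact_pure_tensor(1) hom, unfolded comp_def]])
    show "(\<lambda>C. y \<otimes> \<Lambda> C) \<in> hom T (add_monoid A)"
      using that by (auto simp: hom_def add r_distr)
  qed (use that in \<open>auto simp: lact_pure_tensor(2) pure_tensor m_assoc\<close>)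
  have R: "\<Lambda> (ract T C k) = \<Lambda> C \<otimes> k" if "k \<in> K" "C \<in> carrier T" for k C
  proof (rule T_hom_ext[OF add.is_group hom_compose[OF ract_pure_tensor(1) hom, unfolded comp_def]])
    show "(\<lambda>C. \<Lambda> C \<otimes> k) \<in> hom T (add_monoid A)"
      using that by (auto simp: hom_def add l_distr)
  qed (use that in \<open>auto simp: ract_pure_tensor(2) pure_tensor top_ract m_assoc\<close>)
  define h where "h = \<Lambda> E"
  have hc [simp]: "h \<in> carrier A" using E by (simp add: h_def)
  have h: "h \<in> reg.V"
  proof (rule reg.VI)
    fix k assume k: "k \<in> K"
    then show "lact (sub_bimodule A (carrier A)) k h = ract (sub_bimodule A (carrier A)) h k"
      using L[of k E] R[OF k E(1)] E(1) E(2)[of k] by (simp add: h_def)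
  qed simp
  \<comment> \<open>the images under evaluation at C of the maps top_coeff_sum\<close>
  define W where "W C = rec_nat \<zero> (\<lambda>k w. w \<otimes> x \<oplus> \<Lambda> (ract T C (x [^] k)))" for C
  have W0: "W C 0 = \<zero>" and W_Suc: "W C (Suc k) = W C k \<otimes> x \<oplus> \<Lambda> (ract T C (x [^] k))" for C k
    by (simp_all add: W_def)
  have W_car [simp]: "W C k \<in> carrier A" if "C \<in> carrier T" for C k
    using that by (induction k) (simp_all add: W0 W_Suc)
  have W_add: "W (C \<otimes>\<^bsub>T\<^esub> C') k = W C k \<oplus> W C' k" if "C \<in> carrier T" "C' \<in> carrier T" for C C' k
    using that by (induction k) (simp_all add: W0 W_Suc T.ract_mult add l_distr a_ac)
  have W_pure: "W (pure_tensor a c) k = a \<otimes> top_coeff_sum c k" if "a \<in> carrier A" "c \<in> carrier A" for a c k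
    using that by (induction k) (simp_all add: W0 W_Suc ract_pure_tensor(2) pure_tensor m_assoc r_distr)
  have W_E: "W E k = reg.power_derivative x h k" for k
  proof (induction k)
    case (Suc k)
    have "\<Lambda> (ract T E (x [^] k)) = x [^] k \<otimes> h"
      using E(1) E(2)[of "x [^] k"] L[of "x [^] k" E] by (simp add: h_def)
    then show ?case using Suc by (simp add: W_Suc)
  qed (simp add: W0)
  let ?\<Sigma> = "\<lambda>C. \<Oplus>j\<in>{..e}. W C (p ^ j) \<otimes> \<beta> (Suc j)"
  have "?\<Sigma> \<in> hom T (add_monoid A)"
  proof (rule homI)
    fix C C' assume C: "C \<in> carrier T" "C' \<in> carrier T"
    have "?\<Sigma> (C \<otimes>\<^bsub>T\<^esub> C') = ?\<Sigma> C \<oplus> ?\<Sigma> C'"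
      using C by (subst finsum_addf[symmetric])
        (auto simp: W_add l_distr simp del: finsum_addf intro!: finsum_cong')
    then show "?\<Sigma> (C \<otimes>\<^bsub>T\<^esub> C') = ?\<Sigma> C \<otimes>\<^bsub>add_monoid A\<^esub> ?\<Sigma> C'"
      by simp
  qed (auto intro!: finsum_closed)
  then have "tensor_mult A E = ?\<Sigma> E"
  proof (rule T_hom_ext[OF add.is_group tensor_mult_pure_tensor(1)])
    fix a c assume ac: "a \<in> carrier A" "c \<in> carrier A"
    then have "?\<Sigma> (pure_tensor a c) = a \<otimes> top_reconstruction c"
      unfolding top_reconstruction_def
      by (subst finsum_rdistr) (auto simp: W_pure m_assoc intro!: finsum_cong')
    then show "tensor_mult A (pure_tensor a c) = ?\<Sigma> (pure_tensor a c)"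
      using ac by (simp add: top_reconstruction_identity tensor_mult_pure_tensor(2))
  qed (rule E)
  also have "\<dots> = reg.tau h"
    by (subst reg.tau_power_derivative) (simp_all add: W_E)
  finally have "reg.tau h = \<one>" using E(3) by simp
  with h show ?thesis by (rule that)
qed

end

section \<open>Exact sequences\<close>

context p_polynomial_extension
begin

definition VD where "VD = {v \<in> reg.V. reg.ad x v = \<zero>}"

lemma V_in [simp]: "v \<in> reg.V \<Longrightarrow> v \<in> carrier A"
  using reg.V_carrier by simp

lemma ad_derivation:
  "\<lbrakk>y \<in> carrier A; z \<in> carrier A\<rbrakk> \<Longrightarrow> reg.ad x (y \<otimes> z) = reg.ad x y \<otimes> z \<oplus> y \<otimes> reg.ad x z"
proof -
  assume yz: "y \<in> carrier A" "z \<in> carrier A"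
  have cancel: "a \<ominus> c = (b \<ominus> c) \<oplus> (a \<ominus> b)"
    if "a \<in> carrier A" "b \<in> carrier A" "c \<in> carrier A" for a b c
  proof -
    have "(b \<ominus> c) \<oplus> (a \<ominus> b) = (a \<ominus> c) \<oplus> (b \<ominus> b)"
      using that unfolding a_minus_def by (simp only: a_ac a_closed a_inv_closed)
    then show ?thesis using that by simp
  qed
  show ?thesis
    using yz cancel[of "y \<otimes> z \<otimes> x" "y \<otimes> x \<otimes> z" "x \<otimes> y \<otimes> z"]
    by (simp add: reg_ad a_minus_def l_distr r_distr l_minus r_minus m_assoc)
qed

lemma ad_in [simp]: "y \<in> carrier A \<Longrightarrow> reg.ad x y \<in> carrier A"
  by (simp add: reg_ad)

lemma ad_pow_in [simp]: "y \<in> carrier A \<Longrightarrow> (reg.ad x ^^ i) y \<in> carrier A"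
  by (induction i) auto

lemma VD_V [simp]: "v \<in> VD \<Longrightarrow> v \<in> reg.V" and VD_ad: "v \<in> VD \<Longrightarrow> reg.ad x v = \<zero>"
  unfolding VD_def by blast+

lemma VDI: "\<lbrakk>v \<in> reg.V; reg.ad x v = \<zero>\<rbrakk> \<Longrightarrow> v \<in> VD"
  unfolding VD_def by blast

lemma V_closed:
  "\<zero> \<in> reg.V" "\<one> \<in> reg.V" "\<lbrakk>v \<in> reg.V; w \<in> reg.V\<rbrakk> \<Longrightarrow> v \<oplus> w \<in> reg.V"
  "v \<in> reg.V \<Longrightarrow> \<ominus> v \<in> reg.V" "\<lbrakk>v \<in> reg.V; w \<in> reg.V\<rbrakk> \<Longrightarrow> v \<otimes> w \<in> reg.V"
proof -
  have comm: "k \<otimes> v = v \<otimes> k" if "v \<in> reg.V" "k \<in> K" for v k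
    using reg.V_commutes[OF that] by simp
  show "\<zero> \<in> reg.V" "\<one> \<in> reg.V" by (rule reg.VI; simp)+
  show "v \<oplus> w \<in> reg.V" if "v \<in> reg.V" "w \<in> reg.V"
    using reg.V_mult[OF that] by simp
  show "\<ominus> v \<in> reg.V" if "v \<in> reg.V"
    by (rule reg.VI) (use that comm[OF that] in \<open>simp_all add: l_minus r_minus\<close>)
  show "v \<otimes> w \<in> reg.V" if "v \<in> reg.V" "w \<in> reg.V"
  proof (rule reg.VI)
    fix k assume k: "k \<in> K"
    have "k \<otimes> (v \<otimes> w) = v \<otimes> (k \<otimes> w)"
      using that k comm[of v k] by (simp add: m_assoc[symmetric])
    then show "lact (sub_bimodule A (carrier A)) k (v \<otimes> w) = ract (sub_bimodule A (carrier A)) (v \<otimes> w) k"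
      using that k comm[of w k] by (simp add: m_assoc)
  qed (use that in simp)
qed

lemma ad_zero: "reg.ad x \<zero> = \<zero>"
  by (simp add: reg_ad)

lemma ad_add: "\<lbrakk>y \<in> carrier A; z \<in> carrier A\<rbrakk> \<Longrightarrow> reg.ad x (y \<oplus> z) = reg.ad x y \<oplus> reg.ad x z"
  using reg.ad_mult[OF x_closed, of y z] by simp

lemma ad_minus: "y \<in> carrier A \<Longrightarrow> reg.ad x (\<ominus> y) = \<ominus> reg.ad x y"
  by (simp add: reg_ad a_minus_def l_minus r_minus minus_add)

lemma VD_closed:
  "\<zero> \<in> VD" "\<one> \<in> VD" "\<lbrakk>v \<in> VD; w \<in> VD\<rbrakk> \<Longrightarrow> v \<oplus> w \<in> VD"
  "v \<in> VD \<Longrightarrow> \<ominus> v \<in> VD" "\<lbrakk>v \<in> VD; w \<in> VD\<rbrakk> \<Longrightarrow> v \<otimes> w \<in> VD"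
  by (auto intro!: VDI V_closed simp: VD_ad ad_zero ad_add ad_minus ad_derivation) (simp add: reg_ad)

lemma ad_VD_linear:
  assumes "s \<in> VD" "v \<in> carrier A"
  shows "(reg.ad x ^^ i) (s \<otimes> v) = s \<otimes> (reg.ad x ^^ i) v" "(reg.ad x ^^ i) (v \<otimes> s) = (reg.ad x ^^ i) v \<otimes> s"
  using assms by (induction i) (simp_all add: ad_derivation VD_ad)

lemma tau_eq: "reg.tau v = (\<Oplus>j\<in>{..e}. (reg.ad x ^^ (p ^ j - 1)) v \<otimes> \<beta> (Suc j))"
  by (simp add: reg.tau_def)

lemma tau_VD_linear:
  assumes s: "s \<in> VD" and v: "v \<in> carrier A"
  shows "reg.tau (s \<otimes> v) = s \<otimes> reg.tau v" "reg.tau (v \<otimes> s) = reg.tau v \<otimes> s"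
proof -
  have sc: "s \<in> carrier A" using s by simp
  have comm: "s \<otimes> \<beta> (Suc j) = \<beta> (Suc j) \<otimes> s" if "j \<le> e" for j
    using reg.V_commutes[OF VD_V[OF s], of "\<beta> (Suc j)"] that by simp
  show "reg.tau (s \<otimes> v) = s \<otimes> reg.tau v"
    unfolding tau_eq using sc v
    by (subst finsum_rdistr) (auto simp: ad_VD_linear[OF s] m_assoc simp del: One_nat_def intro!: finsum_cong')
  show "reg.tau (v \<otimes> s) = reg.tau v \<otimes> s"
    unfolding tau_eq using sc v
    by (subst finsum_ldistr) (auto simp: ad_VD_linear[OF s] m_assoc comm simp del: One_nat_def intro!: finsum_cong')
qed

lemma tau_in_VD: "v \<in> reg.V \<Longrightarrow> reg.tau v \<in> VD"
  using reg.tau_V[of v] reg.ad_tau[of v] by (intro VDI) auto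

lemma sub_bimodule_group:
  assumes "S \<subseteq> carrier A" "\<zero> \<in> S" "\<And>v w. \<lbrakk>v \<in> S; w \<in> S\<rbrakk> \<Longrightarrow> v \<oplus> w \<in> S" "\<And>v. v \<in> S \<Longrightarrow> \<ominus> v \<in> S"
  shows "group (monoid.truncate (sub_bimodule A S))"
proof (rule groupI)
  have [simp]: "v \<in> S \<Longrightarrow> v \<in> carrier A" for v using assms(1) by blast
  fix v w u
  assume v: "v \<in> carrier (monoid.truncate (sub_bimodule A S))"
  show "\<exists>y\<in>carrier (monoid.truncate (sub_bimodule A S)).
      y \<otimes>\<^bsub>monoid.truncate (sub_bimodule A S)\<^esub> v = \<one>\<^bsub>monoid.truncate (sub_bimodule A S)\<^esub>"
    using v assms by (intro bexI[of _ "\<ominus> v"]) (auto simp: monoid.truncate_def l_neg)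
qed (use assms in \<open>auto simp: monoid.truncate_def subset_eq a_assoc\<close>)

context
  fixes D' \<tau> :: "'a \<Rightarrow> 'a"
  assumes D': "\<And>v. v \<in> reg.V \<Longrightarrow> D' v = reg.ad x v"
    and \<tau>: "\<And>v. v \<in> reg.V \<Longrightarrow> \<tau> v = reg.tau v"
begin

abbreviation "bV \<equiv> sub_bimodule A reg.V"
abbreviation "bVD \<equiv> sub_bimodule A VD"
abbreviation "bO \<equiv> sub_bimodule A {\<zero>}"

lemma truncate_sub_bimodule [simp]:
  "carrier (monoid.truncate (sub_bimodule A S)) = S"
  "monoid.mult (monoid.truncate (sub_bimodule A S)) = add A"
  "\<one>\<^bsub>monoid.truncate (sub_bimodule A S)\<^esub> = \<zero>"
  by (simp_all add: monoid.truncate_def)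

lemma sequence_groups:
  "group (monoid.truncate bV)" "group (monoid.truncate bVD)" "group (monoid.truncate bO)"
  by (rule sub_bimodule_group; auto intro: V_closed VD_closed)+

lemma sequence_maps_hom:
  "\<tau> \<in> hom (monoid.truncate bV) (monoid.truncate bVD)" "D' \<in> hom (monoid.truncate bV) (monoid.truncate bV)"
  "(\<lambda>v. v) \<in> hom (monoid.truncate bVD) (monoid.truncate bV)"
  "(\<lambda>_. \<zero>) \<in> hom (monoid.truncate bO) (monoid.truncate bVD)"
  "(\<lambda>_. \<zero>) \<in> hom (monoid.truncate bVD) (monoid.truncate bO)"
  using reg.tau_mult
  by (auto simp: hom_def \<tau> D' tau_in_VD reg.ad_V V_closed VD_closed ad_add)

lemma sequence_maps_bimodule_hom:
  "\<tau> \<in> bimodule_hom VD bV bVD" "D' \<in> bimodule_hom VD bV bV"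
  "(\<lambda>v. v) \<in> bimodule_hom VD bVD bV"
  "(\<lambda>_. \<zero>) \<in> bimodule_hom VD bO bVD" "(\<lambda>_. \<zero>) \<in> bimodule_hom VD bVD bO"
  using sequence_maps_hom ad_VD_linear[of _ _ 1]
  by (auto simp: bimodule_hom_def hom_def \<tau> D' V_closed tau_VD_linear)

text \<open>All conditions but the exactness at the last \<open>V\<close> hold automatically, and there the image of
  \<open>ad\<close> is contained in the kernel of \<open>\<tau>\<close>.\<close>

lemma exact_left_iff:
  "exact_bimodule_seq VD [bVD, bV, bV, bVD, bO] [\<tau>, D', (\<lambda>v. v), (\<lambda>_. \<zero>)] \<longleftrightarrow>
    (\<forall>u\<in>reg.V. reg.tau u = \<zero> \<longrightarrow> (\<exists>v\<in>reg.V. reg.ad x v = u))"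
proof -
  have "kernel (monoid.truncate bV) (monoid.truncate bVD) \<tau> = D' ` reg.V \<longleftrightarrow>
      (\<forall>u\<in>reg.V. reg.tau u = \<zero> \<longrightarrow> (\<exists>v\<in>reg.V. reg.ad x v = u))"
  proof -
    have ker: "kernel (monoid.truncate bV) (monoid.truncate bVD) \<tau> = {u \<in> reg.V. reg.tau u = \<zero>}"
      unfolding kernel_def truncate_sub_bimodule by (rule Collect_cong) (auto simp: \<tau>)
    have im: "D' ` reg.V = reg.ad x ` reg.V" by (intro image_cong) (auto simp: D')
    have "reg.ad x ` reg.V \<subseteq> {u \<in> reg.V. reg.tau u = \<zero>}"
      using reg.tau_ad by (auto simp: reg.ad_V)
    then have "{u \<in> reg.V. reg.tau u = \<zero>} = reg.ad x ` reg.V \<longleftrightarrow>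
        {u \<in> reg.V. reg.tau u = \<zero>} \<subseteq> reg.ad x ` reg.V"
      by (simp add: set_eq_subset)
    also have "\<dots> \<longleftrightarrow> (\<forall>u\<in>reg.V. reg.tau u = \<zero> \<longrightarrow> (\<exists>v\<in>reg.V. u = reg.ad x v))"
      by (simp add: subset_iff image_iff Ball_def imp_conjL)
    finally show ?thesis unfolding ker im by (simp only: eq_commute)
  qed
  moreover have "kernel (monoid.truncate bV) (monoid.truncate bV) D' = VD"
    unfolding kernel_def VD_def truncate_sub_bimodule by (intro Collect_cong) (auto simp: D')
  moreover have "kernel (monoid.truncate bVD) (monoid.truncate bV) (\<lambda>v. v) = {\<zero>}"
    using VD_closed(1) by (auto simp: kernel_def)
  ultimately show ?thesis
    using sequence_groups sequence_maps_hom sequence_maps_bimodule_hom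
    by (simp add: exact_bimodule_seq_def All_less_Suc2 group_hom_def group_hom_axioms_def)
qed

text \<open>Since \<open>\<tau>\<close> is linear over its codomain, it is surjective iff it attains \<open>1\<close>.\<close>

lemma exact_full_iff:
  "exact_bimodule_seq VD [bO, bVD, bV, bV, bVD, bO] [(\<lambda>_. \<zero>), \<tau>, D', (\<lambda>v. v), (\<lambda>_. \<zero>)] \<longleftrightarrow>
    exact_bimodule_seq VD [bVD, bV, bV, bVD, bO] [\<tau>, D', (\<lambda>v. v), (\<lambda>_. \<zero>)] \<and>
    (\<exists>h\<in>reg.V. reg.tau h = \<one>)"
proof -
  have "kernel (monoid.truncate bVD) (monoid.truncate bO) (\<lambda>_. \<zero>) = VD"
    by (auto simp: kernel_def)
  moreover have "VD = \<tau> ` reg.V \<longleftrightarrow> (\<exists>h\<in>reg.V. reg.tau h = \<one>)"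
  proof
    assume "VD = \<tau> ` reg.V"
    then have "\<one> \<in> \<tau> ` reg.V" using VD_closed(2) by simp
    then show "\<exists>h\<in>reg.V. reg.tau h = \<one>" by (auto simp: \<tau>)
  next
    assume "\<exists>h\<in>reg.V. reg.tau h = \<one>"
    then obtain h where h: "h \<in> reg.V" "reg.tau h = \<one>" by blast
    have "v \<in> \<tau> ` reg.V" if v: "v \<in> VD" for v
    proof (rule image_eqI)
      show "h \<otimes> v \<in> reg.V" using h v by (simp add: V_closed)
      then show "v = \<tau> (h \<otimes> v)" using h v by (simp add: \<tau> tau_VD_linear)
    qed
    moreover have "\<tau> ` reg.V \<subseteq> VD" by (auto simp: \<tau> tau_in_VD)
    ultimately show "VD = \<tau> ` reg.V" by blast
  qed
  ultimately show ?thesis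
    using sequence_groups sequence_maps_hom sequence_maps_bimodule_hom
    by (auto simp: exact_bimodule_seq_def All_less_Suc2 group_hom_def group_hom_axioms_def)
qed

theorem separability_iff_exact:
  "weakly_separable_ext A K \<longleftrightarrow>
     exact_bimodule_seq VD [bVD, bV, bV, bVD, bO] [\<tau>, D', (\<lambda>v. v), (\<lambda>_. \<zero>)]" (is ?weak)
  "separable_ext A K \<longleftrightarrow>
     exact_bimodule_seq VD [bO, bVD, bV, bV, bVD, bO] [(\<lambda>_. \<zero>), \<tau>, D', (\<lambda>v. v), (\<lambda>_. \<zero>)]"
proof -
  show weak: ?weak
    unfolding exact_left_iff by (rule weakly_separable_iff)
  show "separable_ext A K \<longleftrightarrow>
     exact_bimodule_seq VD [bO, bVD, bV, bV, bVD, bO] [(\<lambda>_. \<zero>), \<tau>, D', (\<lambda>v. v), (\<lambda>_. \<zero>)]"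
    unfolding exact_full_iff weak[symmetric]
    using separable_imp_weakly_separable separable_imp_tau_one separable_if_tau_one by metis
qed

end

end

section \<open>Skew polynomials\<close>

locale skew_polynomials = derivation B D
  for B :: "('a, 'm) ring_scheme" (structure) and D :: "'a \<Rightarrow> 'a"
begin

abbreviation P where "P \<equiv> skew_poly B D"
abbreviation TX where "TX \<equiv> skew_timesX B D"

lemma upI: "\<lbrakk>\<And>n. g n \<in> carrier B; \<And>n. n \<ge> N \<Longrightarrow> g n = \<zero>\<rbrakk> \<Longrightarrow> g \<in> up B"
  unfolding up_def bound_def by (auto intro!: exI[of _ N])

lemma upE:
  assumes "g \<in> up B"
  obtains N where "\<And>n. n \<ge> N \<Longrightarrow> g n = \<zero>"
proof -
  obtain n where "bound \<zero> n g" using assms by (auto simp: up_def)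
  then have "g m = \<zero>" if "m \<ge> Suc n" for m
    using that by (auto simp: bound_def)
  then show ?thesis by (rule that)
qed

lemma up_coeff [simp]: "g \<in> up B \<Longrightarrow> g n \<in> carrier B"
  by (auto simp: up_def)

lemma P_simps [simp]:
  "carrier P = up B" "\<zero>\<^bsub>P\<^esub> = (\<lambda>n. \<zero>)" "\<one>\<^bsub>P\<^esub> = skew_const B \<one>"
  "g \<oplus>\<^bsub>P\<^esub> h = (\<lambda>n. g n \<oplus> h n)"
  by (simp_all add: skew_poly_def)

lemma up_add [simp]: "\<lbrakk>g \<in> up B; h \<in> up B\<rbrakk> \<Longrightarrow> (\<lambda>n. g n \<oplus> h n) \<in> up B"
  by (rule up_add_closed)

lemma up_zero [simp]: "(\<lambda>n. \<zero>) \<in> up B"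
  by (rule upI) auto

lemma up_ract [simp]:
  assumes "g \<in> up B" "a \<in> carrier B"
  shows "(\<lambda>n. g n \<otimes> a) \<in> up B"
proof -
  obtain N where "\<And>n. n \<ge> N \<Longrightarrow> g n = \<zero>" using upE[OF assms(1)] by blast
  then show ?thesis using assms by (intro upI[of _ N]) auto
qed

lemma TX_vanish:
  assumes "\<And>n. n \<ge> N \<Longrightarrow> g n = \<zero>" "n \<ge> N + j"
  shows "(TX ^^ j) g n = \<zero>"
  using assms(2)
proof (induction j arbitrary: n)
  case (Suc j)
  then show ?case by (simp add: skew_timesX_def)
qed (use assms(1) in simp)

lemma TX_coeff [simp]: "(\<And>n. g n \<in> carrier B) \<Longrightarrow> TX g n \<in> carrier B"
  by (simp add: skew_timesX_def)

lemma TX_pow_coeff [simp]: "(\<And>n. g n \<in> carrier B) \<Longrightarrow> (TX ^^ j) g n \<in> carrier B"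
  by (induction j arbitrary: n) auto

lemma TX_pow_up [simp]: 
  assumes "g \<in> up B"
  shows "(TX ^^ j) g \<in> up B"
proof -
  obtain N where "\<And>n. n \<ge> N \<Longrightarrow> g n = \<zero>" using upE[OF assms] by blast
  then show ?thesis
    using assms by (intro upI[of _ "N + j"] TX_vanish) auto
qed

lemma TX_up [simp]: "g \<in> up B \<Longrightarrow> TX g \<in> up B"
  using TX_pow_up[of g 1] by simp

lemma TX_add:
  "\<lbrakk>g \<in> up B; h \<in> up B\<rbrakk> \<Longrightarrow> TX (\<lambda>n. g n \<oplus> h n) = (\<lambda>n. TX g n \<oplus> TX h n)"
  by (auto simp: skew_timesX_def d_add a_ac fun_eq_iff)

lemma TX_pow_add:
  "\<lbrakk>g \<in> up B; h \<in> up B\<rbrakk> \<Longrightarrow> (TX ^^ j) (\<lambda>n. g n \<oplus> h n) = (\<lambda>n. (TX ^^ j) g n \<oplus> (TX ^^ j) h n)"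
  by (induction j) (simp_all add: TX_add)

text \<open>Right multiplication by \<open>X\<close> moves the leading coefficient up without changing it; the derivation
  contributes only to lower terms.\<close>

lemma TX_pow_leading:
  assumes g: "g \<in> up B" and van: "\<And>i. i > n \<Longrightarrow> g i = \<zero>"
  shows "(TX ^^ j) g (n + j) = g n"
proof (induction j)
  case (Suc j)
  have "(TX ^^ j) g (Suc (n + j)) = \<zero>"
    using van by (intro TX_vanish[of "Suc n"]) auto
  then show ?case
    using Suc g by (simp add: skew_timesX_def[of B D "(TX ^^ j) g" "Suc (n + j)"])
qed simp

lemma mult_eq:
  assumes "g \<in> up B" "h \<in> up B" "\<And>j. j \<ge> N \<Longrightarrow> h j = \<zero>"
  shows "(g \<otimes>\<^bsub>P\<^esub> h) n = (\<Oplus>j\<in>{..<N}. (TX ^^ j) g n \<otimes> h j)"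
proof -
  have "{j. h j \<noteq> \<zero>} \<subseteq> {..<N}" using assms(3) not_less by blast
  then show ?thesis
    unfolding skew_poly_def using assms
    by (simp, intro add.finprod_mono_neutral_cong_left) auto
qed

lemma mult_up [simp]:
  assumes g: "g \<in> up B" and h: "h \<in> up B"
  shows "g \<otimes>\<^bsub>P\<^esub> h \<in> up B"
proof -
  obtain M where M: "\<And>n. n \<ge> M \<Longrightarrow> g n = \<zero>" using upE[OF g] by blast
  obtain N where N: "\<And>n. n \<ge> N \<Longrightarrow> h n = \<zero>" using upE[OF h] by blast
  show ?thesis
  proof (rule upI[of _ "M + N"])
    show "(g \<otimes>\<^bsub>P\<^esub> h) n \<in> carrier B" for n
      using g h by (subst mult_eq[OF g h N]) (auto intro!: finsum_closed)
    show "(g \<otimes>\<^bsub>P\<^esub> h) n = \<zero>" if "n \<ge> M + N" for n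
    proof -
      have "(TX ^^ j) g n \<otimes> h j = \<zero>" if "j < N" for j
        using that \<open>n \<ge> M + N\<close> h TX_vanish[OF M, where n=n and j=j] by simp
      then show ?thesis by (subst mult_eq[OF g h N]) (auto intro!: add.finprod_one_eqI)
    qed
  qed
qed

lemma mult_add_left:
  assumes "g \<in> up B" "g' \<in> up B" "h \<in> up B"
  shows "(\<lambda>n. g n \<oplus> g' n) \<otimes>\<^bsub>P\<^esub> h = (\<lambda>n. (g \<otimes>\<^bsub>P\<^esub> h) n \<oplus> (g' \<otimes>\<^bsub>P\<^esub> h) n)"
proof
  fix n
  obtain N where N: "\<And>n. n \<ge> N \<Longrightarrow> h n = \<zero>" using upE[OF assms(3)] by blast
  show "((\<lambda>n. g n \<oplus> g' n) \<otimes>\<^bsub>P\<^esub> h) n = (g \<otimes>\<^bsub>P\<^esub> h) n \<oplus> (g' \<otimes>\<^bsub>P\<^esub> h) n"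
    using assms
    by (simp add: mult_eq[OF _ _ N] TX_pow_add del: finsum_addf)
      (subst finsum_addf[symmetric], auto simp: l_distr simp del: finsum_addf intro!: finsum_cong')
qed

lemma mult_add_right:
  assumes "g \<in> up B" "h \<in> up B" "h' \<in> up B"
  shows "g \<otimes>\<^bsub>P\<^esub> (\<lambda>n. h n \<oplus> h' n) = (\<lambda>n. (g \<otimes>\<^bsub>P\<^esub> h) n \<oplus> (g \<otimes>\<^bsub>P\<^esub> h') n)"
proof
  fix n
  obtain N1 where N1: "\<And>n. n \<ge> N1 \<Longrightarrow> h n = \<zero>" using upE[OF assms(2)] by blast
  obtain N2 where N2: "\<And>n. n \<ge> N2 \<Longrightarrow> h' n = \<zero>" using upE[OF assms(3)] by blast
  let ?N = "max N1 N2"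
  have "(g \<otimes>\<^bsub>P\<^esub> (\<lambda>n. h n \<oplus> h' n)) n = (\<Oplus>j\<in>{..<?N}. (TX ^^ j) g n \<otimes> (h j \<oplus> h' j))"
    using assms N1 N2 by (intro mult_eq) auto
  moreover have "(g \<otimes>\<^bsub>P\<^esub> h) n = (\<Oplus>j\<in>{..<?N}. (TX ^^ j) g n \<otimes> h j)"
    using assms N1 by (intro mult_eq) auto
  moreover have "(g \<otimes>\<^bsub>P\<^esub> h') n = (\<Oplus>j\<in>{..<?N}. (TX ^^ j) g n \<otimes> h' j)"
    using assms N2 by (intro mult_eq) auto
  ultimately show "(g \<otimes>\<^bsub>P\<^esub> (\<lambda>n. h n \<oplus> h' n)) n = (g \<otimes>\<^bsub>P\<^esub> h) n \<oplus> (g \<otimes>\<^bsub>P\<^esub> h') n"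
    using assms
    by (simp del: finsum_addf)
      (subst finsum_addf[symmetric], auto simp: r_distr simp del: finsum_addf intro!: finsum_cong')
qed

lemma mult_ract:
  assumes "g \<in> up B" "h \<in> up B" "a \<in> carrier B"
  shows "g \<otimes>\<^bsub>P\<^esub> (\<lambda>n. h n \<otimes> a) = (\<lambda>n. (g \<otimes>\<^bsub>P\<^esub> h) n \<otimes> a)"
proof
  fix n
  obtain N where N: "\<And>n. n \<ge> N \<Longrightarrow> h n = \<zero>" using upE[OF assms(2)] by blast
  have "(g \<otimes>\<^bsub>P\<^esub> (\<lambda>n. h n \<otimes> a)) n = (\<Oplus>j\<in>{..<N}. (TX ^^ j) g n \<otimes> (h j \<otimes> a))"
    using assms N by (intro mult_eq) auto
  also have "\<dots> = (g \<otimes>\<^bsub>P\<^esub> h) n \<otimes> a"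
    using assms
    by (subst mult_eq[OF assms(1,2) N], simp, subst finsum_ldistr)
      (auto simp: m_assoc intro!: finsum_cong')
  finally show "(g \<otimes>\<^bsub>P\<^esub> (\<lambda>n. h n \<otimes> a)) n = (g \<otimes>\<^bsub>P\<^esub> h) n \<otimes> a" .
qed

text \<open>The rule \<open>g (h X) = (g h) X\<close>.  Together with \<open>g (h a) = (g h) a\<close> it gives associativity, because every
  polynomial is built from \<open>1\<close> by addition and these two right multiplications.\<close>

lemma mult_TX:
  assumes g: "g \<in> up B" and h: "h \<in> up B"
  shows "g \<otimes>\<^bsub>P\<^esub> TX h = TX (g \<otimes>\<^bsub>P\<^esub> h)"
proof
  fix n
  obtain N where N: "\<And>n. n \<ge> N \<Longrightarrow> h n = \<zero>" using upE[OF h] by blast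
  have van: "j \<ge> Suc N \<Longrightarrow> TX h j = \<zero>" for j using N by (simp add: skew_timesX_def)
  let ?g = "\<lambda>j. (TX ^^ j) g"
  let ?S = "\<lambda>f. \<Oplus>j\<in>{..<N}. f j"
  have "(g \<otimes>\<^bsub>P\<^esub> TX h) n = (\<Oplus>j\<in>{..<Suc N}. ?g j n \<otimes> TX h j)"
    by (rule mult_eq[OF g TX_up[OF h] van])
  also have "\<dots> = (\<Oplus>j\<in>{..<Suc N}. ?g j n \<otimes> (if j = 0 then \<zero> else h (j - 1)) \<oplus> ?g j n \<otimes> D (h j))"
    using g h by (intro finsum_cong') (auto simp: skew_timesX_def r_distr)
  also have "\<dots> = (\<Oplus>j\<in>{..<Suc N}. ?g j n \<otimes> (if j = 0 then \<zero> else h (j - 1))) \<oplus>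
      (\<Oplus>j\<in>{..<Suc N}. ?g j n \<otimes> D (h j))"
    using g h by (subst finsum_addf) auto
  also have "(\<Oplus>j\<in>{..<Suc N}. ?g j n \<otimes> (if j = 0 then \<zero> else h (j - 1))) = (\<Oplus>j\<in>{..<N}. ?g (Suc j) n \<otimes> h j)"
  proof (cases N)
    case 0
    then show ?thesis using g by (simp add: lessThan_Suc)
  next
    case (Suc N')
    show ?thesis unfolding Suc lessThan_Suc_atMost
      using g h by (subst finsum_Suc2) auto
  qed
  also have "(\<Oplus>j\<in>{..<Suc N}. ?g j n \<otimes> D (h j)) = (\<Oplus>j\<in>{..<N}. ?g j n \<otimes> D (h j))"
    using g h N by (simp add: lessThan_Suc Pi_iff)
  also have "(\<Oplus>j\<in>{..<N}. ?g (Suc j) n \<otimes> h j) \<oplus> (\<Oplus>j\<in>{..<N}. ?g j n \<otimes> D (h j))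
      = (\<Oplus>j\<in>{..<N}. (if n = 0 then \<zero> else ?g j (n - 1)) \<otimes> h j \<oplus> D (?g j n \<otimes> h j))"
    using g h
    by (subst finsum_addf[symmetric])
      (auto simp: skew_timesX_def[of B D "(TX ^^ j) g" for j] d_mult l_distr a_ac simp del: finsum_addf intro!: finsum_cong')
  also have "\<dots> = (if n = 0 then \<zero> else (g \<otimes>\<^bsub>P\<^esub> h) (n - 1)) \<oplus> D ((g \<otimes>\<^bsub>P\<^esub> h) n)"
    using g h by (subst finsum_addf) (auto simp: mult_eq[OF g h N] d_finsum Pi_iff)
  finally show "(g \<otimes>\<^bsub>P\<^esub> TX h) n = TX (g \<otimes>\<^bsub>P\<^esub> h) n"
    by (simp only: skew_timesX_def[of B D "g \<otimes>\<^bsub>P\<^esub> h" n])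
qed

lemma mult_TX_pow: "\<lbrakk>g \<in> up B; h \<in> up B\<rbrakk> \<Longrightarrow> g \<otimes>\<^bsub>P\<^esub> (TX ^^ j) h = (TX ^^ j) (g \<otimes>\<^bsub>P\<^esub> h)"
  by (induction j) (simp_all add: mult_TX)

lemma mult_zero_right: "g \<in> up B \<Longrightarrow> g \<otimes>\<^bsub>P\<^esub> (\<lambda>n. \<zero>) = (\<lambda>n. \<zero>)"
  using mult_eq[of g "\<lambda>n. \<zero>" 0] by (auto simp: fun_eq_iff)

text \<open>Induction on the number of terms of the right factor.\<close>

lemma mult_assoc:
  assumes g: "g \<in> up B" and h: "h \<in> up B" and k: "k \<in> up B"
  shows "(g \<otimes>\<^bsub>P\<^esub> h) \<otimes>\<^bsub>P\<^esub> k = g \<otimes>\<^bsub>P\<^esub> (h \<otimes>\<^bsub>P\<^esub> k)"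
proof -
  obtain N where N: "\<And>n. n \<ge> N \<Longrightarrow> k n = \<zero>" using upE[OF k] by blast
  define S where "S f m = (\<lambda>n. \<Oplus>j\<in>{..<m}. (TX ^^ j) f n \<otimes> k j)" for f m
  have S_Suc: "S f (Suc m) = (\<lambda>n. (TX ^^ m) f n \<otimes> k m \<oplus> S f m n)" if "f \<in> up B" for f m
    using that k by (simp add: S_def lessThan_Suc Pi_iff)
  have S_up: "S f m \<in> up B" if "f \<in> up B" for f m
    using that k by (induction m) (simp_all add: S_Suc, simp add: S_def)
  have "g \<otimes>\<^bsub>P\<^esub> S h m = S (g \<otimes>\<^bsub>P\<^esub> h) m" for m
  proof (induction m)
    case 0
    then show ?case using g by (simp add: S_def mult_zero_right)
  next
    case (Suc m)
    then show ?case
      using g h k by (simp add: S_Suc S_up mult_add_right mult_ract mult_TX_pow)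
  qed
  moreover have "f \<otimes>\<^bsub>P\<^esub> k = S f N" if "f \<in> up B" for f
    using mult_eq[OF that k N] by (auto simp: S_def fun_eq_iff)
  ultimately show ?thesis using g h by simp
qed

lemma const_up [simp]: "a \<in> carrier B \<Longrightarrow> skew_const B a \<in> up B"
  by (rule upI[of _ 1]) (auto simp: skew_const_def)

lemma const_apply: "skew_const B a n = (if n = 0 then a else \<zero>)"
  by (simp add: skew_const_def)

lemma mult_const: "\<lbrakk>g \<in> up B; a \<in> carrier B\<rbrakk> \<Longrightarrow> g \<otimes>\<^bsub>P\<^esub> skew_const B a = (\<lambda>n. g n \<otimes> a)"
  by (rule ext, subst mult_eq[where N = 1]) (auto simp: const_apply lessThan_Suc)

lemma TX_pow_one: "(TX ^^ j) (skew_const B \<one>) = (\<lambda>n. if n = j then \<one> else \<zero>)"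
  by (induction j) (auto simp: skew_const_def skew_timesX_def fun_eq_iff)

lemma const_one_mult: 
  assumes h: "h \<in> up B"
  shows "skew_const B \<one> \<otimes>\<^bsub>P\<^esub> h = h"
proof
  fix n
  obtain N where N: "\<And>n. n \<ge> N \<Longrightarrow> h n = \<zero>" using upE[OF h] by blast
  have "(skew_const B \<one> \<otimes>\<^bsub>P\<^esub> h) n = (\<Oplus>j\<in>{..<max N (Suc n)}. if n = j then h j else \<zero>)"
    using h by (subst mult_eq[where N = "max N (Suc n)"]) (auto simp: N TX_pow_one intro!: finsum_cong')
  also have "\<dots> = h n"
    using h by (subst finsum_singleton) auto
  finally show "(skew_const B \<one> \<otimes>\<^bsub>P\<^esub> h) n = h n" .
qed

lemma ring_P: "ring P"
proof (rule ringI)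
  show "abelian_group P"
  proof (rule abelian_groupI)
    fix g assume g: "g \<in> carrier P"
    have "(\<lambda>n. \<ominus> g n) \<in> up B"
    proof -
      obtain N where "\<And>n. n \<ge> N \<Longrightarrow> g n = \<zero>" using upE g by auto
      then show ?thesis using g by (intro upI[of _ N]) auto
    qed
    then show "\<exists>h\<in>carrier P. h \<oplus>\<^bsub>P\<^esub> g = \<zero>\<^bsub>P\<^esub>"
      using g by (intro bexI[of _ "\<lambda>n. \<ominus> g n"]) (auto simp: l_neg)
  qed (auto simp: a_ac)
  show "monoid P"
    by (rule monoidI) (auto simp: mult_assoc const_one_mult mult_const)
qed (auto simp: mult_add_left mult_add_right)

sublocale P: ring P by (rule ring_P)

lemma X_eq: "skew_X B = TX (skew_const B \<one>)"
  using TX_pow_one[of 1] by (simp add: skew_X_def fun_eq_iff)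

lemma X_up [simp]: "skew_X B \<in> up B"
  by (simp add: X_eq)

lemma mult_X: "g \<in> up B \<Longrightarrow> g \<otimes>\<^bsub>P\<^esub> skew_X B = TX g"
  by (simp add: X_eq mult_TX mult_const)

lemma X_pow: "skew_X B [^]\<^bsub>P\<^esub> j = (TX ^^ j) (skew_const B \<one>)"
  by (induction j) (simp_all add: mult_X)

lemma monomial: 
  "a \<in> carrier B \<Longrightarrow> skew_X B [^]\<^bsub>P\<^esub> j \<otimes>\<^bsub>P\<^esub> skew_const B a = (\<lambda>n. if n = j then a else \<zero>)"
  by (simp add: X_pow mult_const) (auto simp: TX_pow_one fun_eq_iff)

lemma const_X:
  assumes a: "a \<in> carrier B"
  shows "skew_const B a \<otimes>\<^bsub>P\<^esub> skew_X B = skew_X B \<otimes>\<^bsub>P\<^esub> skew_const B a \<oplus>\<^bsub>P\<^esub> skew_const B (D a)"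
  using a by (simp add: mult_X mult_const) (auto simp: skew_timesX_def const_apply skew_X_def fun_eq_iff)

lemma const_hom:
  "\<lbrakk>a \<in> carrier B; c \<in> carrier B\<rbrakk> \<Longrightarrow> skew_const B (a \<oplus> c) = skew_const B a \<oplus>\<^bsub>P\<^esub> skew_const B c"
  "\<lbrakk>a \<in> carrier B; c \<in> carrier B\<rbrakk> \<Longrightarrow> skew_const B (a \<otimes> c) = skew_const B a \<otimes>\<^bsub>P\<^esub> skew_const B c"
  by (auto simp: mult_const const_apply fun_eq_iff)

lemma monomial_sum_coeff:
  assumes "finite I" "c \<in> I \<rightarrow> carrier B"
  shows "(\<Oplus>\<^bsub>P\<^esub>j\<in>I. skew_X B [^]\<^bsub>P\<^esub> \<phi> j \<otimes>\<^bsub>P\<^esub> skew_const B (c j)) n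
    = (\<Oplus>j\<in>I. if n = \<phi> j then c j else \<zero>)"
  using assms
proof (induction I)
  case (insert i I)
  then have "(\<lambda>j. skew_X B [^]\<^bsub>P\<^esub> \<phi> j \<otimes>\<^bsub>P\<^esub> skew_const B (c j)) \<in> I \<rightarrow> carrier P"
    "skew_X B [^]\<^bsub>P\<^esub> \<phi> i \<otimes>\<^bsub>P\<^esub> skew_const B (c i) \<in> carrier P"
    by (auto simp: X_pow Pi_iff simp del: P_simps(4))
  then show ?case
    using insert by (subst P.finsum_insert) (auto simp: monomial Pi_iff)
qed simp

lemma truncated_expansion:
  assumes "r \<in> up B" "\<And>j. j \<ge> n \<Longrightarrow> r j = \<zero>"
  shows "r = (\<Oplus>\<^bsub>P\<^esub>j\<in>{..<n}. skew_X B [^]\<^bsub>P\<^esub> j \<otimes>\<^bsub>P\<^esub> skew_const B (r j))"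
proof
  fix i
  have "(\<Oplus>j\<in>{..<n}. if i = j then r j else \<zero>) = r i"
  proof (cases "i < n")
    case True
    then show ?thesis using assms by (subst finsum_singleton) auto
  next
    case False
    then have "(\<Oplus>j\<in>{..<n}. if i = j then r j else \<zero>) = \<zero>"
      by (intro add.finprod_one_eqI) auto
    then show ?thesis using assms False by simp
  qed
  then show "r i = (\<Oplus>\<^bsub>P\<^esub>j\<in>{..<n}. skew_X B [^]\<^bsub>P\<^esub> j \<otimes>\<^bsub>P\<^esub> skew_const B (r j)) i"
    using assms by (subst monomial_sum_coeff) auto
qed

context
  fixes f n
  assumes f: "f \<in> up B" and monic: "f n = \<one>" and degree: "\<And>i. i > n \<Longrightarrow> f i = \<zero>"
begin

text \<open>As \<open>f\<close> is monic, a right multiple of \<open>f\<close> by a monomial cancels the leading term of \<open>g\<close>.\<close>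

lemma monic_division:
  assumes "g \<in> up B"
  obtains q r where "q \<in> up B" "r \<in> up B" "g = f \<otimes>\<^bsub>P\<^esub> q \<oplus>\<^bsub>P\<^esub> r" "\<And>i. i \<ge> n \<Longrightarrow> r i = \<zero>"
proof -
  have "\<exists>q\<in>up B. \<exists>r\<in>up B. g = f \<otimes>\<^bsub>P\<^esub> q \<oplus>\<^bsub>P\<^esub> r \<and> (\<forall>i\<ge>n. r i = \<zero>)"
    if "g \<in> up B" "\<And>i. i \<ge> N \<Longrightarrow> g i = \<zero>" for N g
    using that
  proof (induction N arbitrary: g)
    case 0
    then have "g = (\<lambda>n. \<zero>)" by auto
    then show ?case
      using f by (intro bexI[of _ "\<lambda>n. \<zero>"]) (auto simp: mult_zero_right)
  next
    case (Suc N)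
    show ?case
    proof (cases "N < n")
      case True
      then show ?thesis
        using Suc.prems f by (intro bexI[of _ "\<lambda>n. \<zero>"] bexI[of _ g]) (auto simp: mult_zero_right)
    next
      case False
      define q0 where "q0 = skew_X B [^]\<^bsub>P\<^esub> (N - n) \<otimes>\<^bsub>P\<^esub> skew_const B (g N)"
      have q0: "q0 \<in> up B" using Suc.prems by (simp add: q0_def X_pow)
      have fq: "f \<otimes>\<^bsub>P\<^esub> q0 = (\<lambda>i. (TX ^^ (N - n)) f i \<otimes> g N)"
        using Suc.prems f by (simp add: q0_def X_pow mult_TX_pow mult_ract mult_const)
      define g' where "g' = g \<ominus>\<^bsub>P\<^esub> f \<otimes>\<^bsub>P\<^esub> q0"
      have g': "g' \<in> up B" using Suc.prems f q0 P.minus_closed[of g "f \<otimes>\<^bsub>P\<^esub> q0"] by (simp add: g'_def)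
      have g: "g' \<oplus>\<^bsub>P\<^esub> f \<otimes>\<^bsub>P\<^esub> q0 = g"
        using Suc.prems f q0 P.diff_add_cancel[of g "f \<otimes>\<^bsub>P\<^esub> q0"] by (simp add: g'_def)
      have "g' i = \<zero>" if i: "i \<ge> N" for i
      proof -
        have "(f \<otimes>\<^bsub>P\<^esub> q0) i = g i"
        proof (cases "i = N")
          case True
          then have "(TX ^^ (N - n)) f i = \<one>"
            using TX_pow_leading[of f n "N - n"] f degree False monic by simp
          then show ?thesis using True Suc.prems by (simp add: fq)
        next
          case ne: False
          then have "(TX ^^ (N - n)) f i = \<zero>"
            using False i degree by (intro TX_vanish[of "Suc n"]) auto
          then show ?thesis using ne i Suc.prems by (simp add: fq)
        qed
        then have "g' i \<oplus> g i = \<zero> \<oplus> g i"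
          using fun_cong[OF g, of i] Suc.prems by simp
        then show ?thesis
          using g' Suc.prems add.r_cancel[of "g i" "g' i" \<zero>] by simp
      qed
      then obtain q r where qr: "q \<in> up B" "r \<in> up B" "g' = f \<otimes>\<^bsub>P\<^esub> q \<oplus>\<^bsub>P\<^esub> r" "\<forall>i\<ge>n. r i = \<zero>"
        using Suc.IH[OF g'] by blast
      have "g = f \<otimes>\<^bsub>P\<^esub> (q \<oplus>\<^bsub>P\<^esub> q0) \<oplus>\<^bsub>P\<^esub> r"
        unfolding g[symmetric] qr(3) using f q0 qr(1,2)
        by (simp add: mult_add_right a_ac)
      then show ?thesis using qr q0 by (intro bexI[of _ "q \<oplus>\<^bsub>P\<^esub> q0"] bexI[of _ r]) auto
    qed
  qed
  moreover obtain N where "\<And>i. i \<ge> N \<Longrightarrow> g i = \<zero>" using upE[OF assms] by blast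
  ultimately obtain q r where "q \<in> up B" "r \<in> up B" "g = f \<otimes>\<^bsub>P\<^esub> q \<oplus>\<^bsub>P\<^esub> r" "\<forall>i\<ge>n. r i = \<zero>"
    using assms by metis
  then show ?thesis using that by blast
qed

text \<open>As \<open>f\<close> is monic, the leading coefficient of \<open>q\<close> is also that of \<open>f q\<close>.\<close>

lemma monic_multiple_zero:
  assumes q: "q \<in> up B" and van: "\<And>i. i \<ge> n \<Longrightarrow> (f \<otimes>\<^bsub>P\<^esub> q) i = \<zero>"
  shows "f \<otimes>\<^bsub>P\<^esub> q = (\<lambda>i. \<zero>)"
proof -
  have "q = (\<lambda>i. \<zero>)" if "\<And>i. i \<ge> N \<Longrightarrow> q i = \<zero>" for N
    using that
  proof (induction N)
    case (Suc N)
    have "(f \<otimes>\<^bsub>P\<^esub> q) (n + N) = (\<Oplus>j\<in>{..<Suc N}. (TX ^^ j) f (n + N) \<otimes> q j)"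
      using Suc.prems by (intro mult_eq f q) auto
    also have "\<dots> = (\<Oplus>j\<in>{..<Suc N}. if j = N then q N else \<zero>)"
    proof (rule finsum_cong')
      fix j assume j: "j \<in> {..<Suc N}"
      show "(TX ^^ j) f (n + N) \<otimes> q j = (if j = N then q N else \<zero>)"
      proof (cases "j = N")
        case True
        then show ?thesis using TX_pow_leading[of f n N] f degree monic q by simp
      next
        case False
        then have "(TX ^^ j) f (n + N) = \<zero>"
          using j degree by (intro TX_vanish[of "Suc n"]) auto
        then show ?thesis using False q by simp
      qed
    qed (use q in auto)
    also have "\<dots> = q N"
      using q by (subst add.finprod_singleton_swap) auto
    finally have "q N = \<zero>" using van by simp
    then have "\<And>i. i \<ge> N \<Longrightarrow> q i = \<zero>"
      using Suc.prems by (metis le_antisym not_less_eq_eq)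
    then show ?case by (rule Suc.IH)
  qed auto
  moreover obtain N where "\<And>i. i \<ge> N \<Longrightarrow> q i = \<zero>" using upE[OF q] by blast
  ultimately have "q = (\<lambda>i. \<zero>)" by blast
  then show ?thesis using f by (simp add: mult_zero_right)
qed

end

end

section \<open>The quotient by a normal monic skew polynomial\<close>

text \<open>Normality makes the right ideal generated by \<open>f\<close> two-sided; being monic makes the quotient free.\<close>

locale monic_normal_quotient = skew_polynomials B D for B :: "('a, 'm) ring_scheme" (structure) and D +
  fixes f :: "nat \<Rightarrow> 'a" and n :: nat
  assumes f_up: "f \<in> up B" and f_monic: "f n = \<one>" and f_degree: "\<And>i. i > n \<Longrightarrow> f i = \<zero>"
    and f_normal: "f <#\<^bsub>P\<^esub> carrier P = carrier P #>\<^bsub>P\<^esub> f"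
begin

abbreviation I where "I \<equiv> skew_ideal B D f"
abbreviation Q where "Q \<equiv> skew_quot B D f"
abbreviation qx where "qx \<equiv> quot_x B D f"
abbreviation qc where "qc \<equiv> quot_const B D f"
abbreviation \<pi> where "\<pi> g \<equiv> I +>\<^bsub>P\<^esub> g"

lemma skew_ideal_eq_image: "I = (\<lambda>q. f \<otimes>\<^bsub>P\<^esub> q) ` up B" "I = (\<lambda>q. q \<otimes>\<^bsub>P\<^esub> f) ` up B"
proof -
  show "I = (\<lambda>q. f \<otimes>\<^bsub>P\<^esub> q) ` up B"
    by (auto simp: skew_ideal_def l_coset_def)
  show "I = (\<lambda>q. q \<otimes>\<^bsub>P\<^esub> f) ` up B"
    unfolding skew_ideal_def f_normal by (auto simp: r_coset_def)
qed

lemma ideal_I: "ideal I P"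
proof (rule idealI[OF ring_P])
  show "subgroup I (add_monoid P)"
  proof (rule group.subgroupI[OF P.add.is_group])
    show "I \<subseteq> carrier (add_monoid P)" using f_up by (auto simp: skew_ideal_eq_image(1))
    show "I \<noteq> {}" using f_up up_zero by (auto simp: skew_ideal_eq_image(1))
  next
    fix y assume "y \<in> I"
    then obtain q where q: "q \<in> up B" "y = f \<otimes>\<^bsub>P\<^esub> q" by (auto simp: skew_ideal_eq_image(1))
    then have "\<ominus>\<^bsub>P\<^esub> y = f \<otimes>\<^bsub>P\<^esub> (\<ominus>\<^bsub>P\<^esub> q)" using f_up by (simp add: P.r_minus)
    then show "inv\<^bsub>add_monoid P\<^esub> y \<in> I"
      using q P.a_inv_closed[of q] by (auto simp: skew_ideal_eq_image(1) a_inv_def)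
  next
    fix y z assume "y \<in> I" "z \<in> I"
    then obtain q r where q: "q \<in> up B" "y = f \<otimes>\<^bsub>P\<^esub> q" and r: "r \<in> up B" "z = f \<otimes>\<^bsub>P\<^esub> r"
      by (auto simp: skew_ideal_eq_image(1))
    then have "y \<oplus>\<^bsub>P\<^esub> z = f \<otimes>\<^bsub>P\<^esub> (q \<oplus>\<^bsub>P\<^esub> r)" using f_up P.r_distr[of q r f] by simp
    moreover have "q \<oplus>\<^bsub>P\<^esub> r \<in> up B" using q r by simp
    ultimately show "y \<otimes>\<^bsub>add_monoid P\<^esub> z \<in> I" unfolding skew_ideal_eq_image(1) by (simp del: P_simps)
  qed
next
  fix y z assume y: "y \<in> I" and z: "z \<in> carrier P"
  obtain q where q: "q \<in> up B" "y = f \<otimes>\<^bsub>P\<^esub> q" using y by (auto simp: skew_ideal_eq_image(1))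
  show "y \<otimes>\<^bsub>P\<^esub> z \<in> I"
    using q z f_up by (auto simp: skew_ideal_eq_image(1) mult_assoc)
  obtain r where r: "r \<in> up B" "y = r \<otimes>\<^bsub>P\<^esub> f" using y by (auto simp: skew_ideal_eq_image(2))
  show "z \<otimes>\<^bsub>P\<^esub> y \<in> I"
    using r z f_up by (auto simp: skew_ideal_eq_image(2) mult_assoc[symmetric])
qed

sublocale I: ideal I P by (rule ideal_I)

sublocale Q: ring Q
  unfolding skew_quot_def by (rule I.quotient_is_ring)

sublocale \<pi>: ring_hom_ring P Q "\<lambda>g. \<pi> g"
  unfolding skew_quot_def by (rule I.rcos_ring_hom_ring)

lemma Q_carrier: "carrier Q = \<pi> ` up B"
  by (auto simp: skew_quot_def FactRing_def A_RCOSETS_def' P_simps)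

lemma \<pi>_zero_iff: "g \<in> up B \<Longrightarrow> \<pi> g = \<zero>\<^bsub>Q\<^esub> \<longleftrightarrow> g \<in> I"
  using I.rcos_const_imp_mem[of g] I.a_rcos_const[of g] by (auto simp: skew_quot_def FactRing_def)

lemma qc_closed [simp]: "a \<in> carrier B \<Longrightarrow> qc a \<in> carrier Q"
  using \<pi>.hom_closed[of "skew_const B a"] by (simp add: quot_const_def)

lemma qx_closed [simp]: "qx \<in> carrier Q"
  using \<pi>.hom_closed[of "skew_X B"] by (simp add: quot_x_def)

lemma qc_hom: "qc \<in> ring_hom B Q"
proof (rule ring_hom_memI)
  fix a c assume a: "a \<in> carrier B" "c \<in> carrier B"
  show "qc (a \<otimes> c) = qc a \<otimes>\<^bsub>Q\<^esub> qc c"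
    using a \<pi>.hom_mult[of "skew_const B a" "skew_const B c"] by (simp add: quot_const_def const_hom)
  show "qc (a \<oplus> c) = qc a \<oplus>\<^bsub>Q\<^esub> qc c"
    using a \<pi>.hom_add[of "skew_const B a" "skew_const B c"] by (simp add: quot_const_def const_hom)
next
  show "qc \<one> = \<one>\<^bsub>Q\<^esub>"
    using \<pi>.hom_one by (simp add: quot_const_def)
qed simp

sublocale qc: ring_hom_ring B Q qc
  using ring_hom_ringI2[OF ring_axioms Q.ring_axioms qc_hom] .

lemma qc_x: 
  assumes a: "a \<in> carrier B"
  shows "qc a \<otimes>\<^bsub>Q\<^esub> qx = qx \<otimes>\<^bsub>Q\<^esub> qc a \<oplus>\<^bsub>Q\<^esub> qc (D a)"
proof -
  have "\<pi> (skew_const B a \<otimes>\<^bsub>P\<^esub> skew_X B) = \<pi> (skew_X B \<otimes>\<^bsub>P\<^esub> skew_const B a \<oplus>\<^bsub>P\<^esub> skew_const B (D a))"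
    using const_X[OF a] by (rule arg_cong)
  then show ?thesis
    using a \<pi>.hom_mult[of "skew_const B a" "skew_X B"]
      \<pi>.hom_add[of "skew_X B \<otimes>\<^bsub>P\<^esub> skew_const B a" "skew_const B (D a)"]
      \<pi>.hom_mult[of "skew_X B" "skew_const B a"]
    by (simp add: quot_const_def quot_x_def del: P_simps(4))
qed

lemma \<pi>_monomial_sum:
  assumes "finite J" "c \<in> J \<rightarrow> carrier B"
  shows "\<pi> (\<Oplus>\<^bsub>P\<^esub>j\<in>J. skew_X B [^]\<^bsub>P\<^esub> \<phi> j \<otimes>\<^bsub>P\<^esub> skew_const B (c j))
    = (\<Oplus>\<^bsub>Q\<^esub>j\<in>J. qx [^]\<^bsub>Q\<^esub> (\<phi> j :: nat) \<otimes>\<^bsub>Q\<^esub> qc (c j))"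
proof -
  have summand: "\<pi> (skew_X B [^]\<^bsub>P\<^esub> \<phi> j \<otimes>\<^bsub>P\<^esub> skew_const B (c j)) = qx [^]\<^bsub>Q\<^esub> \<phi> j \<otimes>\<^bsub>Q\<^esub> qc (c j)"
    if "j \<in> J" for j
    using that assms \<pi>.hom_mult[of "skew_X B [^]\<^bsub>P\<^esub> \<phi> j" "skew_const B (c j)"] \<pi>.hom_nat_pow[of "skew_X B" "\<phi> j"]
      P.nat_pow_closed[of "skew_X B" "\<phi> j"]
    by (auto simp: quot_const_def quot_x_def Pi_iff)
  let ?t = "\<lambda>j. skew_X B [^]\<^bsub>P\<^esub> \<phi> j \<otimes>\<^bsub>P\<^esub> skew_const B (c j)"
  have hom: "(\<lambda>g. \<pi> g) \<in> hom (add_monoid P) (add_monoid Q)"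
    using \<pi>.hom_add \<pi>.hom_closed by (auto simp: hom_def simp del: P_simps(4))
  have car: "?t \<in> J \<rightarrow> carrier P"
    using assms by (auto simp: X_pow Pi_iff)
  have "\<pi> (finsum P ?t J) = (\<Oplus>\<^bsub>Q\<^esub>j\<in>J. \<pi> (?t j))"
    unfolding finsum_def
    by (rule comm_group.hom_finprod[OF P.add.comm_group_axioms Q.add.comm_group_axioms hom assms(1)])
      (use car in simp)
  also have "\<dots> = (\<Oplus>\<^bsub>Q\<^esub>j\<in>J. qx [^]\<^bsub>Q\<^esub> \<phi> j \<otimes>\<^bsub>Q\<^esub> qc (c j))"
    using assms summand by (intro Q.finsum_cong') (auto simp: Pi_iff)
  finally show ?thesis .
qed

lemma quot_expansion:
  assumes "y \<in> carrier Q"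
  obtains c where "c \<in> {..<n} \<rightarrow> carrier B" "y = quot_sum B D f n c"
proof -
  obtain g where g: "g \<in> up B" "y = \<pi> g" using assms by (auto simp: Q_carrier)
  obtain q r where qr: "q \<in> up B" "r \<in> up B" "g = f \<otimes>\<^bsub>P\<^esub> q \<oplus>\<^bsub>P\<^esub> r" "\<And>i. i \<ge> n \<Longrightarrow> r i = \<zero>"
    using monic_division[OF f_up f_monic f_degree g(1)] by blast
  have "\<pi> (f \<otimes>\<^bsub>P\<^esub> q) = \<zero>\<^bsub>Q\<^esub>"
    using qr(1) f_up by (subst \<pi>_zero_iff) (auto simp: skew_ideal_eq_image(1))
  then have "y = \<pi> r"
    using g(2) qr f_up \<pi>.hom_add[of "f \<otimes>\<^bsub>P\<^esub> q" r] \<pi>.hom_closed[of r] by (simp del: P_simps(4))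
  also have "\<dots> = quot_sum B D f n r"
    unfolding quot_sum_def using qr(2) \<pi>_monomial_sum[of "{..<n}" r "\<lambda>j. j"]
    by (subst truncated_expansion[OF qr(2,4)]) auto
  finally show ?thesis using qr(2) by (intro that[of r]) auto
qed

lemma quot_independent:
  assumes c: "c \<in> {..<n} \<rightarrow> carrier B" and zero: "quot_sum B D f n c = \<zero>\<^bsub>Q\<^esub>" and j: "j < n"
  shows "c j = \<zero>"
proof -
  define r where "r j = (if j < n then c j else \<zero>)" for j
  have r: "r \<in> up B" by (rule upI[of _ n]) (use c in \<open>auto simp: r_def\<close>)
  have van: "\<And>i. i \<ge> n \<Longrightarrow> r i = \<zero>" by (simp add: r_def)
  have "\<pi> r = (\<Oplus>\<^bsub>Q\<^esub>j\<in>{..<n}. qx [^]\<^bsub>Q\<^esub> j \<otimes>\<^bsub>Q\<^esub> qc (r j))"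
    using r \<pi>_monomial_sum[of "{..<n}" r "\<lambda>j. j"]
    by (subst truncated_expansion[OF r van]) auto
  also have "\<dots> = quot_sum B D f n c"
    unfolding quot_sum_def using c by (intro Q.finsum_cong') (auto simp: r_def Pi_iff)
  finally have "r \<in> I" using zero r \<pi>_zero_iff by simp
  then obtain q where q: "q \<in> up B" "r = f \<otimes>\<^bsub>P\<^esub> q" by (auto simp: skew_ideal_eq_image(1))
  then have "r = (\<lambda>i. \<zero>)"
    using monic_multiple_zero[OF f_up f_monic f_degree q(1)] van by auto
  then have "r j = \<zero>" by simp
  then show ?thesis using j by (simp add: r_def)
qed

text \<open>On the coefficients this is \<open>c x - x c = D c\<close>, and powers of \<open>x\<close> commute with \<open>x\<close>.  The formula does not
  mention the expansion, so the defining description determines a unique value.\<close>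

lemma induced_derivation_eq:
  assumes y: "y \<in> carrier Q"
  shows "induced_derivation B D f n y = y \<otimes>\<^bsub>Q\<^esub> qx \<ominus>\<^bsub>Q\<^esub> qx \<otimes>\<^bsub>Q\<^esub> y"
proof -
  have on_sum: "quot_sum B D f n (\<lambda>j. D (c j)) = quot_sum B D f n c \<otimes>\<^bsub>Q\<^esub> qx \<ominus>\<^bsub>Q\<^esub> qx \<otimes>\<^bsub>Q\<^esub> quot_sum B D f n c"
    if c: "c \<in> {..<n} \<rightarrow> carrier B" for c
  proof -
    have cc [simp]: "c j \<in> carrier B" if "j < n" for j using c that by auto
    have pow: "qx [^]\<^bsub>Q\<^esub> j \<otimes>\<^bsub>Q\<^esub> qx = qx \<otimes>\<^bsub>Q\<^esub> qx [^]\<^bsub>Q\<^esub> j" for j :: nat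
      using Q.nat_pow_comm[of qx j 1] by simp
    have car: "quot_sum B D f n c \<in> carrier Q" "quot_sum B D f n (\<lambda>j. D (c j)) \<in> carrier Q"
      unfolding quot_sum_def by (auto intro!: Q.finsum_closed)
    have "qx \<otimes>\<^bsub>Q\<^esub> quot_sum B D f n c \<oplus>\<^bsub>Q\<^esub> quot_sum B D f n (\<lambda>j. D (c j))
        = (\<Oplus>\<^bsub>Q\<^esub>j\<in>{..<n}. qx \<otimes>\<^bsub>Q\<^esub> (qx [^]\<^bsub>Q\<^esub> j \<otimes>\<^bsub>Q\<^esub> qc (c j)) \<oplus>\<^bsub>Q\<^esub> qx [^]\<^bsub>Q\<^esub> j \<otimes>\<^bsub>Q\<^esub> qc (D (c j)))"
      unfolding quot_sum_def
      by (subst Q.finsum_rdistr, simp, simp, force, subst Q.finsum_addf) auto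
    also have "\<dots> = (\<Oplus>\<^bsub>Q\<^esub>j\<in>{..<n}. qx [^]\<^bsub>Q\<^esub> j \<otimes>\<^bsub>Q\<^esub> qc (c j) \<otimes>\<^bsub>Q\<^esub> qx)"
    proof (rule Q.finsum_cong')
      fix j assume j: "j \<in> {..<n}"
      have "qx [^]\<^bsub>Q\<^esub> j \<otimes>\<^bsub>Q\<^esub> qc (c j) \<otimes>\<^bsub>Q\<^esub> qx = qx [^]\<^bsub>Q\<^esub> j \<otimes>\<^bsub>Q\<^esub> qx \<otimes>\<^bsub>Q\<^esub> qc (c j) \<oplus>\<^bsub>Q\<^esub> qx [^]\<^bsub>Q\<^esub> j \<otimes>\<^bsub>Q\<^esub> qc (D (c j))"
        using j by (simp add: Q.m_assoc qc_x Q.r_distr)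
      then show "qx \<otimes>\<^bsub>Q\<^esub> (qx [^]\<^bsub>Q\<^esub> j \<otimes>\<^bsub>Q\<^esub> qc (c j)) \<oplus>\<^bsub>Q\<^esub> qx [^]\<^bsub>Q\<^esub> j \<otimes>\<^bsub>Q\<^esub> qc (D (c j))
          = qx [^]\<^bsub>Q\<^esub> j \<otimes>\<^bsub>Q\<^esub> qc (c j) \<otimes>\<^bsub>Q\<^esub> qx"
        using j pow[of j] by (simp add: Q.m_assoc[symmetric])
    qed auto
    also have "\<dots> = quot_sum B D f n c \<otimes>\<^bsub>Q\<^esub> qx"
      unfolding quot_sum_def by (subst Q.finsum_ldistr) auto
    finally have "quot_sum B D f n (\<lambda>j. D (c j)) \<oplus>\<^bsub>Q\<^esub> qx \<otimes>\<^bsub>Q\<^esub> quot_sum B D f n c = quot_sum B D f n c \<otimes>\<^bsub>Q\<^esub> qx"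
      using car by (simp add: Q.a_comm)
    then show ?thesis
      using car by (metis a_minus_def Q.add.inv_solve_right' Q.m_closed qx_closed)
  qed
  obtain c where c: "c \<in> {..<n} \<rightarrow> carrier B" "y = quot_sum B D f n c"
    using quot_expansion[OF y] by blast
  show ?thesis
    unfolding induced_derivation_def
  proof (rule the_equality)
    show "\<exists>c\<in>{..<n} \<rightarrow> carrier B. y = quot_sum B D f n c \<and>
        y \<otimes>\<^bsub>Q\<^esub> qx \<ominus>\<^bsub>Q\<^esub> qx \<otimes>\<^bsub>Q\<^esub> y = quot_sum B D f n (\<lambda>j. D (c j))"
      using c on_sum[OF c(1)] by (intro bexI[OF _ c(1)]) simp
  next
    fix z assume "\<exists>c\<in>{..<n} \<rightarrow> carrier B. y = quot_sum B D f n c \<and> z = quot_sum B D f n (\<lambda>j. D (c j))"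
    then show "z = y \<otimes>\<^bsub>Q\<^esub> qx \<ominus>\<^bsub>Q\<^esub> qx \<otimes>\<^bsub>Q\<^esub> y"
      using on_sum by auto
  qed
qed

end

text \<open>The relation \<open>f(x) = 0\<close> is the vanishing of \<open>f\<close> modulo the ideal that it generates, and the basis comes from division
  with remainder by \<open>f\<close>, which is monic of degree \<open>p\<^sup>e\<close>.\<close>

lemma p_polynomial_extension_quotient:
  fixes B :: "('a, 'm) ring_scheme"
  assumes B: "ring B" and p: "Factorial_Ring.prime p" and char: "ring_char B = p"
    and D: "ring_derivation B D" and e: "e \<ge> 1"
    and b: "\<forall>j\<le>e. b j \<in> carrier B" "b (e + 1) = \<one>\<^bsub>B\<^esub>"
    and P: "P = skew_poly B D"
    and f: "f = (\<Oplus>\<^bsub>P\<^esub>j\<in>{0..e}. skew_X B [^]\<^bsub>P\<^esub> (p ^ j) \<otimes>\<^bsub>P\<^esub> skew_const B (b (j + 1)))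
            \<oplus>\<^bsub>P\<^esub> skew_const B (b 0)"
    and normal: "f \<in> monic_normal B D"
  shows "monic_normal_quotient B D f (p ^ e)"
    "p_polynomial_extension (skew_quot B D f) (quot_base B D f) (quot_x B D f) p e
      (\<lambda>j. quot_const B D f (b j))"
proof -
  interpret derivation B D using B D by (simp add: derivation_def derivation_axioms_def)
  interpret skew_polynomials B D ..
  have p1: "p > 1" using p prime_gt_1_nat by blast
  have b_car [simp]: "b j \<in> carrier B" if "j \<le> Suc e" for j
    using b that by (cases "j = Suc e") auto
  have "f i = (\<Oplus>\<^bsub>B\<^esub>j\<in>{0..e}. if i = p ^ j then b (j + 1) else \<zero>\<^bsub>B\<^esub>) \<oplus>\<^bsub>B\<^esub> skew_const B (b 0) i" for i
    unfolding f P using monomial_sum_coeff[of "{0..e}" "\<lambda>j. b (j + 1)" "\<lambda>j. p ^ j" i] by simp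
  moreover have "(\<Oplus>\<^bsub>B\<^esub>j\<in>{0..e}. if i = p ^ j then b (j + 1) else \<zero>\<^bsub>B\<^esub>) = (if i = p ^ e then \<one>\<^bsub>B\<^esub> else \<zero>\<^bsub>B\<^esub>)"
    if i: "i \<ge> p ^ e" for i
  proof -
    have pj: "p ^ j < p ^ e" if "j \<le> e" "j \<noteq> e" for j
      using that p1 by simp
    have "(\<Oplus>\<^bsub>B\<^esub>j\<in>{0..e}. if i = p ^ j then b (j + 1) else \<zero>\<^bsub>B\<^esub>)
        = (\<Oplus>\<^bsub>B\<^esub>j\<in>{0..e}. if j = e then (if i = p ^ e then \<one>\<^bsub>B\<^esub> else \<zero>\<^bsub>B\<^esub>) else \<zero>\<^bsub>B\<^esub>)"
    proof (rule finsum_cong')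
      fix j assume "j \<in> {0..e}"
      then show "(if i = p ^ j then b (j + 1) else \<zero>\<^bsub>B\<^esub>)
          = (if j = e then (if i = p ^ e then \<one>\<^bsub>B\<^esub> else \<zero>\<^bsub>B\<^esub>) else \<zero>\<^bsub>B\<^esub>)"
        using i b(2) pj[of j] by (cases "j = e") auto
    qed auto
    also have "\<dots> = (if i = p ^ e then \<one>\<^bsub>B\<^esub> else \<zero>\<^bsub>B\<^esub>)"
      by (subst add.finprod_singleton_swap) auto
    finally show ?thesis .
  qed
  ultimately have top_coeff: "f i = (if i = p ^ e then \<one>\<^bsub>B\<^esub> else \<zero>\<^bsub>B\<^esub>)" if "i \<ge> p ^ e" for i
    using that zero_less_power[of p e] p1 by (cases "i = 0") (simp_all add: const_apply)
  show quot: "monic_normal_quotient B D f (p ^ e)"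
    using normal top_coeff by unfold_locales (auto simp: monic_normal_def)
  interpret monic_normal_quotient B D f "p ^ e" by (rule quot)
  have base: "quot_base B D f = qc ` carrier B" by (simp add: quot_base_def)
  show "p_polynomial_extension Q (quot_base B D f) qx p e (\<lambda>j. qc (b j))"
  proof (rule p_polynomial_extension.intro[OF Q.ring_axioms], rule p_polynomial_extension_axioms.intro)
    show "subring (quot_base B D f) Q"
      unfolding base by (rule qc.img_is_subring[OF carrier_is_subring])
    show "qx \<in> carrier Q" by simp
    show "k \<otimes>\<^bsub>Q\<^esub> qx \<ominus>\<^bsub>Q\<^esub> qx \<otimes>\<^bsub>Q\<^esub> k \<in> quot_base B D f" if "k \<in> quot_base B D f" for k
    proof -
      obtain a where a: "a \<in> carrier B" "k = qc a" using \<open>k \<in> quot_base B D f\<close> by (auto simp: base)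
      have "k \<otimes>\<^bsub>Q\<^esub> qx \<ominus>\<^bsub>Q\<^esub> qx \<otimes>\<^bsub>Q\<^esub> k = qc (D a)"
        unfolding a(2) qc_x[OF a(1)] using a(1)
        by (simp add: a_minus_def Q.a_ac Q.r_neg Q.r_neg1)
      then show ?thesis using a by (simp add: base)
    qed
    show "Factorial_Ring.prime p" by (rule p)
    have "[p] \<cdot>\<^bsub>B\<^esub> \<one>\<^bsub>B\<^esub> = \<zero>\<^bsub>B\<^esub>"
      using group.pow_ord_eq_1[OF add.is_group, of "\<one>\<^bsub>B\<^esub>"] char
      by (simp add: ring_char_def add_pow_def)
    moreover have "qc ([k] \<cdot>\<^bsub>B\<^esub> \<one>\<^bsub>B\<^esub>) = [k] \<cdot>\<^bsub>Q\<^esub> \<one>\<^bsub>Q\<^esub>" for k :: nat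
      by (induction k) simp_all
    ultimately show "[p] \<cdot>\<^bsub>Q\<^esub> \<one>\<^bsub>Q\<^esub> = \<zero>\<^bsub>Q\<^esub>"
      by (metis qc.hom_zero)
    show "1 \<le> e" by (rule e)
    show "qc (b j) \<in> quot_base B D f" if "j \<le> e" for j using that by (simp add: base)
    show "qc (b (Suc e)) = \<one>\<^bsub>Q\<^esub>" using b(2) by simp
    have "\<pi> f = \<zero>\<^bsub>Q\<^esub>"
      using f_up const_up[of "\<one>\<^bsub>B\<^esub>"] mult_const[OF f_up one_closed]
      by (subst \<pi>_zero_iff) (auto simp: skew_ideal_eq_image(1) intro!: image_eqI[of _ _ "skew_const B \<one>\<^bsub>B\<^esub>"])
    moreover have "\<pi> f = (\<Oplus>\<^bsub>Q\<^esub>j\<in>{0..e}. qx [^]\<^bsub>Q\<^esub> (p ^ j) \<otimes>\<^bsub>Q\<^esub> qc (b (j + 1))) \<oplus>\<^bsub>Q\<^esub> qc (b 0)"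
    proof -
      have "(\<Oplus>\<^bsub>skew_poly B D\<^esub>j\<in>{0..e}. skew_X B [^]\<^bsub>skew_poly B D\<^esub> (p ^ j) \<otimes>\<^bsub>skew_poly B D\<^esub> skew_const B (b (j + 1)))
          \<in> carrier (skew_poly B D)"
        by (intro P.finsum_closed) (auto simp: X_pow)
      then show ?thesis
        using \<pi>_monomial_sum[of "{0..e}" "\<lambda>j. b (j + 1)" "\<lambda>j. p ^ j"]
        by (subst f, unfold P, subst \<pi>.hom_add) (auto simp: quot_const_def)
    qed
    ultimately show "(\<Oplus>\<^bsub>Q\<^esub>j\<in>{..e}. qx [^]\<^bsub>Q\<^esub> (p ^ j) \<otimes>\<^bsub>Q\<^esub> qc (b (Suc j))) \<oplus>\<^bsub>Q\<^esub> qc (b 0) = \<zero>\<^bsub>Q\<^esub>"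
      by (simp add: atLeast0AtMost)
  next
    fix y assume "y \<in> carrier Q"
    then obtain c where c: "c \<in> {..<p ^ e} \<rightarrow> carrier B" "y = quot_sum B D f (p ^ e) c"
      by (rule quot_expansion)
    then show "\<exists>c\<in>{..<p ^ e} \<rightarrow> quot_base B D f. y = (\<Oplus>\<^bsub>Q\<^esub>j\<in>{..<p ^ e}. qx [^]\<^bsub>Q\<^esub> j \<otimes>\<^bsub>Q\<^esub> c j)"
      by (intro bexI[of _ "\<lambda>j. qc (c j)"]) (auto simp: quot_sum_def base)
  next
    fix c j assume c: "c \<in> {..<p ^ e} \<rightarrow> quot_base B D f"
      and zero: "(\<Oplus>\<^bsub>Q\<^esub>j\<in>{..<p ^ e}. qx [^]\<^bsub>Q\<^esub> j \<otimes>\<^bsub>Q\<^esub> c j) = \<zero>\<^bsub>Q\<^esub>" and j: "j < p ^ e"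
    have "\<forall>j\<in>{..<p ^ e}. \<exists>a\<in>carrier B. c j = qc a" using c by (auto simp: base)
    then obtain a where a: "\<And>j. j < p ^ e \<Longrightarrow> a j \<in> carrier B" "\<And>j. j < p ^ e \<Longrightarrow> c j = qc (a j)"
      by (metis lessThan_iff)
    have "quot_sum B D f (p ^ e) a = (\<Oplus>\<^bsub>Q\<^esub>j\<in>{..<p ^ e}. qx [^]\<^bsub>Q\<^esub> j \<otimes>\<^bsub>Q\<^esub> c j)"
      unfolding quot_sum_def using a by (intro Q.finsum_cong') auto
    then have "a j = \<zero>\<^bsub>B\<^esub>"
      using zero a(1) j by (intro quot_independent) auto
    then show "c j = \<zero>\<^bsub>Q\<^esub>" using a(2)[OF j] by simp
  qed
qed

theorem theorem3p10:
  fixes B :: "('a, 'm) ring_scheme" and D :: "'a \<Rightarrow> 'a" and p e :: nat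
    and b f :: "nat \<Rightarrow> 'a"
  assumes "ring B" and "Factorial_Ring.prime p" and "ring_char B = p"
    and "ring_derivation B D"
    and "e \<ge> 1"
    and "\<forall>j\<le>e. b j \<in> carrier B" and "b (e + 1) = \<one>\<^bsub>B\<^esub>"
    and "P = skew_poly B D"
    and "f = (\<Oplus>\<^bsub>P\<^esub>j\<in>{0..e}. skew_X B [^]\<^bsub>P\<^esub> (p ^ j) \<otimes>\<^bsub>P\<^esub> skew_const B (b (j + 1)))
            \<oplus>\<^bsub>P\<^esub> skew_const B (b 0)"
    and "f \<in> monic_normal B D"
    and "A = skew_quot B D f"
    and "D' = induced_derivation B D f (p ^ e)"
    and "V = centralizer_in A (quot_base B D f)"
    and "VD = {v \<in> V. D' v = \<zero>\<^bsub>A\<^esub>}"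
    and "\<tau> = (\<lambda>h. \<Oplus>\<^bsub>A\<^esub>j\<in>{0..e}. (D' ^^ (p ^ j - 1)) h \<otimes>\<^bsub>A\<^esub> quot_const B D f (b (j + 1)))"
    and "bV = sub_bimodule A V" and "bVD = sub_bimodule A VD" and "bO = sub_bimodule A {\<zero>\<^bsub>A\<^esub>}"
  shows "(weakly_separable_poly B D f \<longleftrightarrow>
           exact_bimodule_seq VD [bVD, bV, bV, bVD, bO] [\<tau>, D', (\<lambda>v. v), (\<lambda>_. \<zero>\<^bsub>A\<^esub>)]) \<and>
         (separable_poly B D f \<longleftrightarrow>
           exact_bimodule_seq VD [bO, bVD, bV, bV, bVD, bO]
             [(\<lambda>_. \<zero>\<^bsub>A\<^esub>), \<tau>, D', (\<lambda>v. v), (\<lambda>_. \<zero>\<^bsub>A\<^esub>)])"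
proof -
  interpret M: monic_normal_quotient B D f "p ^ e"
    by (rule p_polynomial_extension_quotient(1)[OF assms(1-10)])
  interpret E: p_polynomial_extension A "quot_base B D f" "quot_x B D f" p e "\<lambda>j. quot_const B D f (b j)"
    unfolding \<open>A = _\<close> by (rule p_polynomial_extension_quotient(2)[OF assms(1-10)])
  let ?x = "quot_x B D f"
  have ad: "D' y = E.reg.ad ?x y" if "y \<in> carrier A" for y
    unfolding E.reg_ad using that M.induced_derivation_eq[of y] \<open>D' = _\<close> \<open>A = _\<close> by simp
  have V: "V = E.reg.V"
    unfolding \<open>V = _\<close> E.reg_V ..
  have VD: "VD = E.VD"
    unfolding \<open>VD = _\<close> V E.VD_def by (intro Collect_cong conj_cong refl) (simp add: ad)
  have pow: "(D' ^^ i) y = (E.reg.ad ?x ^^ i) y" if "y \<in> carrier A" for i y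
    using that by (induction i) (simp_all add: ad)
  have \<tau>: "\<tau> v = E.reg.tau v" if "v \<in> E.reg.V" for v
    unfolding \<open>\<tau> = _\<close> E.tau_eq using that by (simp add: pow atLeast0AtMost)
  have D': "D' v = E.reg.ad ?x v" if "v \<in> E.reg.V" for v
    using that by (simp add: ad)
  show ?thesis
    using E.separability_iff_exact[of D' \<tau>, OF D' \<tau>] assms(16-18)
    unfolding weakly_separable_poly_def separable_poly_def \<open>A = _\<close>[symmetric] V VD by simp
qed

end
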